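(* Let $\Gamma$ be a connected negative definite plumbing graph whose plumbed 3-manifold is a rational homology sphere, with vertex set $\mathcal{V}$; let $\mathcal{I}\subset\mathcal{V}$ be non-empty and $h\in H$. Write $$\mathbf{t}_{\mathcal{I}}^{Z_K-E}\,Z_{[Z_K]-h}(\mathbf{t}_{\mathcal{I}}^{-1})=\sum_{l'\in Z_K-E-\mathcal{S}'}w(l')\,\mathbf{t}_{\mathcal{I}}^{l'},$$ (with $w(l')=z(Z_K-E-l')$ if $[l']=h$ and $w(l')=0$ otherwise), which is the expansion at infinity of $f_h(\mathbf{t}_{\mathcal{I}})$, and define $$P^+_{h,\mathcal{I}}(\mathbf{t}_{\mathcal{I}}):=\sum_{l'|_{\mathcal{I}}\nprec0}w(l')\,\mathbf{t}_{\mathcal{I}}^{l'},\qquad f^{neg}_{h,\mathcal{I}}(\mathbf{t}_{\mathcal{I}}):=\sum_{l'|_{\mathcal{I}}\prec0}w(l')\,\mathbf{t}_{\mathcal{I}}^{l'}.$$ Consider the decomposition $f_h(\mathbf{t}_{\mathcal{I}})=P^+_{h,\mathcal{I}}(\mathbf{t}_{\mathcal{I}})+f^{neg}_{h,\mathcal{I}}(\mathbf{t}_{\mathcal{I}})$. (a) $P^+_{h,\mathcal{I}}$ is a finite sum $\sum_jn_j\mathbf{t}_{\mathcal{I}}^{c_j}$ with $c_j\nprec0$ for all $j$, and $f^{neg}_{h,\mathcal{I}}$ is a rational function with negative degree in all variables $t_i$, $i\in\mathcal{I}$. In particular, by the uniqueness of a decomposition with these two properties, this decomposition agrees with the decomposition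 of $f_h(\mathbf{t}_{\mathcal{I}})$ given by the multivariable Euclidean division. (b) $P^+_{h,\mathcal{I}}(\mathbf{1})=Q_{[Z_K]-h,\mathcal{I}}(Z_K-r_h)$, where $P^+_{h,\mathcal{I}}(\mathbf{1})$ is the value at $t_i=1$ for all $i\in\mathcal{I}$. In particular, $$P^+_{h,\mathcal{I}}(\mathbf{1})=\mathrm{pc}^{\pi_{\mathcal{I}}(\mathcal{S}'_{\mathbb{R}})}(Z_h(\mathbf{t}_{\mathcal{I}})).$$
   Context: Graph and lattices. $\Gamma$ is a tree with all genus decorations zero (equivalent to the plumbed manifold $M=M(\Gamma)$ being a rational homology sphere). $\delta_v$ is the valency of $v\in\mathcal{V}$. $L=\mathbb{Z}\langle E_v\rangle_{v\in\mathcal{V}}$ carries the negative definite intersection form $(\,,\,)$: $(E_v,E_v)$ is the Euler decoration of $v$, and for $v\neq w$, $(E_v,E_w)=1$ if $v,w$ are adjacent, $0$ otherwise. $L'=\{l'\in L\otimes\mathbb{Q}:(l',L)\subset\mathbb{Z}\}$, generated by $E_v^*$ with $(E_v^*,E_w)=-1$ if $v=w$ and $0$ otherwise. $H=L'/L$, $[x]$ is the class of $x\in L'$. Write $l'=\sum_vl'_vE_v$ and $l'|_{\mathcal{I}}=(l'_v)_{v\in\mathcal{I}}$. For $h\in H$, $r_h\in L'$ is the unique representative of $h$ with all $E_v$-coordinates in $[0,1)$. $E=\sum_vE_v$, and $Z_K\in L'$ is determined by $(Z_K,E_v)=(E_v,E_v)+2$ for all $v$; equivalently $Z_K-E=\sum_v(\delta_v-2)E_v^*$.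 For vectors, $a\ge b$ means $a_v\ge b_v$ for all coordinates, and $a\prec b$ means $a_v<b_v$ for all coordinates. Series. $Z(\mathbf{t})=\sum_{l'\in L'}z(l')\mathbf{t}^{l'}$ is the Taylor expansion at the origin of $f(\mathbf{t})=\prod_{v\in\mathcal{V}}(1-\mathbf{t}^{E_v^*})^{\delta_v-2}$, with $\mathbf{t}^{l'}=\prod_vt_v^{l'_v}$ and $\mathbf{t}_{\mathcal{I}}^{l'}=\prod_{v\in\mathcal{I}}t_v^{l'_v}$; rational exponents are allowed in 'polynomials' and 'rational functions'. It is supported on $\mathcal{S}'=\mathbb{Z}_{\ge0}\langle E_v^*\rangle_v$. $Z_h(\mathbf{t})=\sum_{[l']=h}z(l')\mathbf{t}^{l'}$, and $f=\sum_hf_h$ is the corresponding decomposition into rational functions ($Z_h$ being the Taylor expansion of $f_h$). $Z_h(\mathbf{t}_{\mathcal{I}})$, $f_h(\mathbf{t}_{\mathcal{I}})$ are obtained by setting $t_v=1$ for $v\notin\mathcal{I}$. The degree of a rational function in $t_i$ is the degree of the numerator minus that of the denominator. Euclidean division. Let $g=\sum_k\iota_k\mathbf{t}^{b_k}/\prod_{i=1}^n(1-\mathbf{t}^{a_i})$ with $\iota_k\in\mathbb{Z}$, $b_k\nprec0$, $0\prec a_i$. Repeatedly replace any summand $\mathbf{t}^b/\prod_{i\in S}(1-\mathbf{t}^{a_i})$ for which some $i_0\in S$ has $b\nprec a_{i_0}$ by $-\mathbf{t}^{b-a_{i_0}}/\prod_{i\in S\setminus\{i_0\}}(1-\mathbf{t}^{a_i})+\mathbf{t}^{b-a_{i_0}}/\prod_{i\in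 S}(1-\mathbf{t}^{a_i})$. One arrives at $g=\sum_{S\subset\{1,\dots,n\}}\big(\sum_j\iota_{S,j}\mathbf{t}^{b_{S,j}}\big)/\prod_{i\in S}(1-\mathbf{t}^{a_i})$ with $b_{S,j}\nprec0$ and $b_{S,j}\prec a_i$ for all $i\in S$. The decomposition of $g$ given by Euclidean division is (term with $S=\emptyset$) + (sum of terms with $S\ne\emptyset$). Counting function and periodic constant. For $g\in H$ and $x\in L'$ with $[x]=g$, $Q_{g,\mathcal{I}}(x)=\sum_{l'|_{\mathcal{I}}\not\geq x|_{\mathcal{I}},\,[l']=g}z(l')$ (finite sum). $\mathcal{S}'_{\mathbb{R}}=\mathbb{R}_{\ge0}\langle E_v^*\rangle_v$, and $\pi_{\mathcal{I}}:x\mapsto x|_{\mathcal{I}}$. For a top-dimensional cone $\mathcal{K}\subset\mathbb{R}^{|\mathcal{I}|}$: if there are $l'_*\in\mathcal{K}$, a finite index sublattice $\widetilde L\subset L$ and a quasipolynomial $\mathfrak{Q}$ on $\widetilde L$ with $Q_{h,\mathcal{I}}(l+r_h)=\mathfrak{Q}(l)$ for all $l\in\widetilde L$ with $(l+r_h)|_{\mathcal{I}}\in l'_*+\mathcal{K}$, then $\mathrm{pc}^{\mathcal{K}}(Z_h(\mathbf{t}_{\mathcal{I}})):=\mathfrak{Q}(0)$ (independent of choices). *)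

theory Defs
  imports
    "HOL-Analysis.Analysis"
    "HOL-Library.Poly_Mapping"
    "HOL-Computational_Algebra.Fraction_Field"
begin

section \<open>Rational vectors\<close>

text \<open>
  The rational vector space spanned by the vertices, i.e. \<open>L \<otimes> \<rat>\<close>. Its elements also serve as
  exponents. It is a type of its own, and not just the function space, because
  \<^theory>\<open>HOL-Library.Poly_Mapping\<close> provides integral domains only over linearly ordered exponent
  groups. The lexicographic order below is used for nothing else: the orders of
  the mathematics are \<open>geq_on\<close> and \<open>prec_on\<close>.
\<close>

typedef 'v qvec = "UNIV :: ('v \<Rightarrow> rat) set"
  morphisms coord Qvec ..

setup_lifting type_definition_qvec

lemma coord_Qvec [simp]: "coord (Qvec x) = x"
  by (simp add: Qvec_inverse)

lemma qvec_eq_iff: "x = y \<longleftrightarrow> (\<forall>v. coord x v = coord y v)"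
  by (metis coord_inject ext)

instantiation qvec :: (type) ab_group_add
begin

lift_definition zero_qvec :: "'a qvec" is "\<lambda>_. 0" .
lift_definition plus_qvec :: "'a qvec \<Rightarrow> 'a qvec \<Rightarrow> 'a qvec" is "\<lambda>x y v. x v + y v" .
lift_definition minus_qvec :: "'a qvec \<Rightarrow> 'a qvec \<Rightarrow> 'a qvec" is "\<lambda>x y v. x v - y v" .
lift_definition uminus_qvec :: "'a qvec \<Rightarrow> 'a qvec" is "\<lambda>x v. - x v" .

instance
  by intro_classes (transfer; simp add: fun_eq_iff)+

end

lemma coord_zero [simp]: "coord 0 v = 0"
  by transfer simp

lemma coord_plus [simp]: "coord (x + y) v = coord x v + coord y v"
  by transfer simp

lemma coord_minus [simp]: "coord (x - y) v = coord x v - coord y v"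
  by transfer simp

lemma coord_uminus [simp]: "coord (- x) v = - coord x v"
  by transfer simp

instantiation qvec :: (finite) linordered_ab_group_add
begin

definition less_qvec :: "'a qvec \<Rightarrow> 'a qvec \<Rightarrow> bool" where
  "x < y \<longleftrightarrow> (\<exists>v. coord x v < coord y v \<and> (\<forall>u. to_nat u < to_nat v \<longrightarrow> coord x u = coord y u))"

definition less_eq_qvec :: "'a qvec \<Rightarrow> 'a qvec \<Rightarrow> bool" where
  "x \<le> y \<longleftrightarrow> x = y \<or> x < (y :: 'a qvec)"

instance
proof
  have irrefl: "\<not> x < x" for x :: "'a qvec"
    by (auto simp: less_qvec_def)
  have trans: "x < z" if xy: "x < y" and yz: "y < z" for x y z :: "'a qvec"
  proof -
    obtain v where v: "coord x v < coord y v" "\<And>u. to_nat u < to_nat v \<Longrightarrow> coord x u = coord y u"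
      using xy unfolding less_qvec_def by blast
    obtain w where w: "coord y w < coord z w" "\<And>u. to_nat u < to_nat w \<Longrightarrow> coord y u = coord z u"
      using yz unfolding less_qvec_def by blast
    consider "to_nat v < to_nat w" | "v = w" | "to_nat w < to_nat v"
      by (metis from_nat_to_nat less_linear)
    then show ?thesis
    proof cases
      case 1
      then show ?thesis
        unfolding less_qvec_def by (metis v w(2) order.strict_trans)
    next
      case 2
      then show ?thesis
        unfolding less_qvec_def by (metis v w order.strict_trans)
    next
      case 3
      then show ?thesis
        unfolding less_qvec_def by (metis v(2) w order.strict_trans)
    qed
  qed
  have total: "x < y \<or> y < x" if neq: "x \<noteq> y" for x y :: "'a qvec"
  proof -
    obtain v0 where v0: "coord x v0 \<noteq> coord y v0"
      using neq unfolding qvec_eq_iff by blast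
    define v where "v = arg_min to_nat (\<lambda>v. coord x v \<noteq> coord y v)"
    have v: "coord x v \<noteq> coord y v"
      unfolding v_def using v0 by (rule arg_min_natI)
    have below: "coord x u = coord y u" if "to_nat u < to_nat v" for u
      using that arg_min_nat_le[of "\<lambda>v. coord x v \<noteq> coord y v" u to_nat]
      unfolding v_def by (meson not_le)
    show ?thesis
      using v below unfolding less_qvec_def by (metis less_linear)
  qed
  fix x y z :: "'a qvec"
  show "x < y \<longleftrightarrow> x \<le> y \<and> \<not> y \<le> x"
    unfolding less_eq_qvec_def by (metis irrefl trans)
  show "x \<le> x"
    by (simp add: less_eq_qvec_def)
  show "x \<le> y \<Longrightarrow> y \<le> z \<Longrightarrow> x \<le> z"
    unfolding less_eq_qvec_def by (metis trans)
  show "x \<le> y \<Longrightarrow> y \<le> x \<Longrightarrow> x = y"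
    unfolding less_eq_qvec_def by (metis irrefl trans)
  show "x \<le> y \<or> y \<le> x"
    unfolding less_eq_qvec_def by (metis total)
  show "x \<le> y \<Longrightarrow> z + x \<le> z + y"
    unfolding less_eq_qvec_def less_qvec_def by auto
qed

end

text \<open>The coordinates outside \<open>I\<close> are set to 0, so that \<open>\<rat>\<^sup>I\<close> is the range of \<open>restr I\<close>.\<close>

definition restr :: "'v set \<Rightarrow> 'v qvec \<Rightarrow> 'v qvec" where
  "restr I x = Qvec (\<lambda>v. if v \<in> I then coord x v else 0)"

definition geq_on :: "'v set \<Rightarrow> 'v qvec \<Rightarrow> 'v qvec \<Rightarrow> bool" where
  "geq_on I a b \<longleftrightarrow> (\<forall>v\<in>I. coord b v \<le> coord a v)"

definition prec_on :: "'v set \<Rightarrow> 'v qvec \<Rightarrow> 'v qvec \<Rightarrow> bool" where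
  "prec_on I a b \<longleftrightarrow> (\<forall>v\<in>I. coord a v < coord b v)"

definition to_real :: "'v::finite qvec \<Rightarrow> real ^ 'v" where
  "to_real x = (\<chi> v. of_rat (coord x v))"

definition restr_real :: "'v::finite set \<Rightarrow> real ^ 'v \<Rightarrow> real ^ 'v" where
  "restr_real I x = (\<chi> v. if v \<in> I then x $ v else 0)"


section \<open>Plumbing graphs and their lattices\<close>

text \<open>
  The vertex set is the whole type. Genus decorations are left out, as they are all zero
  for the graphs considered.
\<close>

record 'v plumbing =
  adj :: "'v \<Rightarrow> 'v \<Rightarrow> bool"
  euler :: "'v \<Rightarrow> int"

definition valency :: "'v plumbing \<Rightarrow> 'v \<Rightarrow> nat" where
  "valency \<Gamma> v = card {w. adj \<Gamma> v w}"

definition is_cycle :: "'v plumbing \<Rightarrow> 'v list \<Rightarrow> bool" where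
  "is_cycle \<Gamma> p \<longleftrightarrow> 3 \<le> length p \<and> distinct p \<and>
     (\<forall>i < length p. adj \<Gamma> (p ! i) (p ! (Suc i mod length p)))"

definition is_tree :: "'v plumbing \<Rightarrow> bool" where
  "is_tree \<Gamma> \<longleftrightarrow>
     (\<forall>v. \<not> adj \<Gamma> v v) \<and> (\<forall>v w. adj \<Gamma> v w \<longrightarrow> adj \<Gamma> w v) \<and>
     (\<forall>v w. (v, w) \<in> {(x, y). adj \<Gamma> x y}\<^sup>*) \<and> (\<nexists>p. is_cycle \<Gamma> p)"

definition latL :: "'v qvec set" where
  "latL = {x. \<forall>v. coord x v \<in> \<int>}"

definition basisE :: "'v \<Rightarrow> 'v qvec" where
  "basisE v = Qvec (\<lambda>w. if w = v then 1 else 0)"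

definition basis_form :: "'v plumbing \<Rightarrow> 'v \<Rightarrow> 'v \<Rightarrow> int" where
  "basis_form \<Gamma> v w = (if v = w then euler \<Gamma> v else if adj \<Gamma> v w then 1 else 0)"

definition form :: "'v::finite plumbing \<Rightarrow> 'v qvec \<Rightarrow> 'v qvec \<Rightarrow> rat" where
  "form \<Gamma> x y = (\<Sum>v\<in>UNIV. \<Sum>w\<in>UNIV. coord x v * coord y w * of_int (basis_form \<Gamma> v w))"

definition negative_definite :: "'v::finite plumbing \<Rightarrow> bool" where
  "negative_definite \<Gamma> \<longleftrightarrow> (\<forall>x\<in>latL. x \<noteq> 0 \<longrightarrow> form \<Gamma> x x < 0)"

definition dualL :: "'v::finite plumbing \<Rightarrow> 'v qvec set" where
  "dualL \<Gamma> = {x. \<forall>y\<in>latL. form \<Gamma> x y \<in> \<int>}"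

definition Estar :: "'v::finite plumbing \<Rightarrow> 'v \<Rightarrow> 'v qvec" where
  "Estar \<Gamma> v = (THE x. \<forall>w. form \<Gamma> x (basisE w) = (if v = w then -1 else 0))"

definition sumE :: "'v::finite qvec" where
  "sumE = (\<Sum>v\<in>UNIV. basisE v)"

definition ZK :: "'v::finite plumbing \<Rightarrow> 'v qvec" where
  "ZK \<Gamma> = (THE x. \<forall>v. form \<Gamma> x (basisE v) = form \<Gamma> (basisE v) (basisE v) + 2)"

text \<open>Elements of \<open>H = L'/L\<close> are cosets.\<close>

definition cls :: "'v qvec \<Rightarrow> 'v qvec set" where
  "cls x = {x + l | l. l \<in> latL}"

definition groupH :: "'v::finite plumbing \<Rightarrow> 'v qvec set set" where
  "groupH \<Gamma> = cls ` dualL \<Gamma>"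

definition cls_diff :: "'v qvec set \<Rightarrow> 'v qvec set \<Rightarrow> 'v qvec set" where
  "cls_diff A B = {a - b | a b. a \<in> A \<and> b \<in> B}"

definition rep :: "'v qvec set \<Rightarrow> 'v qvec" where
  "rep h = (THE x. x \<in> h \<and> (\<forall>v. 0 \<le> coord x v \<and> coord x v < 1))"

definition monoidS :: "'v::finite plumbing \<Rightarrow> 'v qvec set" where
  "monoidS \<Gamma> = {Qvec (\<lambda>u. \<Sum>v\<in>UNIV. of_nat (k v) * coord (Estar \<Gamma> v) u) | k. True}"

definition coneS :: "'v::finite plumbing \<Rightarrow> (real ^ 'v) set" where
  "coneS \<Gamma> = {\<Sum>v\<in>UNIV. a v *\<^sub>R to_real (Estar \<Gamma> v) | a. \<forall>v. 0 \<le> a v}"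


section \<open>Polynomials, rational functions and series\<close>

text \<open>
  Polynomials have integer coefficients and arbitrary, possibly negative, rational exponents,
  and rational functions are their fractions.
\<close>

type_synonym 'v qpoly = "'v qvec \<Rightarrow>\<^sub>0 int"
type_synonym 'v ratfun = "'v qpoly fract"
type_synonym 'v series = "'v qvec \<Rightarrow> int"

definition mon :: "'v qvec \<Rightarrow> 'v qpoly" where
  "mon a = Poly_Mapping.single a 1"

definition of_poly :: "'v::finite qpoly \<Rightarrow> 'v ratfun" where
  "of_poly p = Fract p 1"

definition polys_in :: "'v::finite set \<Rightarrow> 'v qpoly set" where
  "polys_in I = {p. \<forall>c\<in>Poly_Mapping.keys p. restr I c = c}"

definition ratfuns_in :: "'v::finite set \<Rightarrow> 'v ratfun set" where
  "ratfuns_in I = {Fract n d | n d. n \<in> polys_in I \<and> d \<in> polys_in I \<and> d \<noteq> 0}"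

definition eval_one :: "'v qpoly \<Rightarrow> int" where
  "eval_one p = (\<Sum>c\<in>Poly_Mapping.keys p. Poly_Mapping.lookup p c)"

text \<open>The degree of the zero polynomial, and of the zero rational function, is \<open>-\<infinity>\<close>.\<close>

definition poly_degree :: "'v \<Rightarrow> 'v qpoly \<Rightarrow> ereal" where
  "poly_degree i p = (SUP c\<in>Poly_Mapping.keys p. ereal (of_rat (coord c i)))"

definition rat_degree :: "'v::finite \<Rightarrow> 'v ratfun \<Rightarrow> ereal" where
  "rat_degree i q = (THE e. \<exists>n d. d \<noteq> 0 \<and> q = Fract n d \<and> e = poly_degree i n - poly_degree i d)"

text \<open>
  Setting \<open>t\<^sub>v = 1\<close> for \<open>v \<notin> I\<close>. In a rational function this is possible once
  some denominator does not become zero, and the result does not depend on the choice of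
  such a representation.
\<close>

definition reduce_poly :: "'v::finite set \<Rightarrow> 'v qpoly \<Rightarrow> 'v qpoly" where
  "reduce_poly I p =
     (\<Sum>c\<in>Poly_Mapping.keys p. Poly_Mapping.single (restr I c) (Poly_Mapping.lookup p c))"

definition reduce_rat :: "'v::finite set \<Rightarrow> 'v ratfun \<Rightarrow> 'v ratfun" where
  "reduce_rat I q = (THE r. \<exists>n d. d \<noteq> 0 \<and> q = Fract n d \<and> reduce_poly I d \<noteq> 0 \<and>
     r = Fract (reduce_poly I n) (reduce_poly I d))"

text \<open>
  Meaningful only if, for each \<open>c\<close>, finitely many \<open>l\<close> with \<open>s l \<noteq> 0\<close> restrict to \<open>c\<close>. This is
  so for all series below, since the coordinates of each \<open>Estar \<Gamma> v\<close> are positive and \<open>I\<close> is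
  non-empty.
\<close>

definition reduce_series :: "'v set \<Rightarrow> 'v series \<Rightarrow> 'v series" where
  "reduce_series I s c = (\<Sum>l | s l \<noteq> 0 \<and> restr I l = c. s l)"

text \<open>
  A series \<open>s\<close> represents \<open>n / d\<close> if \<open>d s = n\<close>. With exponents in a lattice and bounded
  on one side, a series is determined by the rational function that it represents, and
  conversely.
\<close>

definition represents :: "'v::finite series \<Rightarrow> 'v ratfun \<Rightarrow> bool" where
  "represents s q \<longleftrightarrow> (\<exists>n d. d \<noteq> 0 \<and> q = Fract n d \<and>
     (\<forall>l. (\<Sum>k\<in>Poly_Mapping.keys d. Poly_Mapping.lookup d k * s (l - k)) = Poly_Mapping.lookup n l))"

definition common_denominator :: "'v series \<Rightarrow> bool" where
  "common_denominator s \<longleftrightarrow>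
     (\<exists>N::nat. 0 < N \<and> (\<forall>l v. s l \<noteq> 0 \<longrightarrow> of_nat N * coord l v \<in> \<int>))"

definition taylor_at_origin :: "'v::finite series \<Rightarrow> 'v ratfun \<Rightarrow> bool" where
  "taylor_at_origin s q \<longleftrightarrow> represents s q \<and> common_denominator s \<and>
     (\<forall>l v. s l \<noteq> 0 \<longrightarrow> 0 \<le> coord l v)"

definition expansion_at_infinity :: "'v::finite series \<Rightarrow> 'v ratfun \<Rightarrow> bool" where
  "expansion_at_infinity s q \<longleftrightarrow> represents s q \<and> common_denominator s \<and>
     (\<exists>b. \<forall>l v. s l \<noteq> 0 \<longrightarrow> coord l v \<le> coord b v)"


section \<open>The series of the graph\<close>

definition zeta :: "'v::finite plumbing \<Rightarrow> 'v ratfun" where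
  "zeta \<Gamma> = (\<Prod>v\<in>UNIV. of_poly (1 - mon (Estar \<Gamma> v)) powi (int (valency \<Gamma> v) - 2))"

definition zcoeff :: "'v::finite plumbing \<Rightarrow> 'v series" where
  "zcoeff \<Gamma> = (THE s. taylor_at_origin s (zeta \<Gamma>))"

definition Zh :: "'v::finite plumbing \<Rightarrow> 'v qvec set \<Rightarrow> 'v series" where
  "Zh \<Gamma> h l = (if cls l = h then zcoeff \<Gamma> l else 0)"

definition fh :: "'v::finite plumbing \<Rightarrow> 'v qvec set \<Rightarrow> 'v ratfun" where
  "fh \<Gamma> h = (THE q. taylor_at_origin (Zh \<Gamma> h) q)"

definition fh_red :: "'v::finite plumbing \<Rightarrow> 'v set \<Rightarrow> 'v qvec set \<Rightarrow> 'v ratfun" where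
  "fh_red \<Gamma> I h = reduce_rat I (fh \<Gamma> h)"

definition wcoeff :: "'v::finite plumbing \<Rightarrow> 'v qvec set \<Rightarrow> 'v series" where
  "wcoeff \<Gamma> h l = (if cls l = h then zcoeff \<Gamma> (ZK \<Gamma> - sumE - l) else 0)"

text \<open>
  Over an infinite index set the sum would be 0 by convention; that the index set is finite
  has to be proved along with anything about \<open>Pplus\<close>.
\<close>

definition Pplus :: "'v::finite plumbing \<Rightarrow> 'v set \<Rightarrow> 'v qvec set \<Rightarrow> 'v qpoly" where
  "Pplus \<Gamma> I h = (\<Sum>l | wcoeff \<Gamma> h l \<noteq> 0 \<and> \<not> prec_on I l 0. Poly_Mapping.single (restr I l) (wcoeff \<Gamma> h l))"

text \<open>
  The series \<open>f\<^sup>n\<^sup>e\<^sup>g\<close>, and the rational function of which it is the expansion at infinity.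
\<close>

definition fneg_series :: "'v::finite plumbing \<Rightarrow> 'v set \<Rightarrow> 'v qvec set \<Rightarrow> 'v series" where
  "fneg_series \<Gamma> I h = reduce_series I (\<lambda>l. if prec_on I l 0 then wcoeff \<Gamma> h l else 0)"

definition fneg :: "'v::finite plumbing \<Rightarrow> 'v set \<Rightarrow> 'v qvec set \<Rightarrow> 'v ratfun" where
  "fneg \<Gamma> I h = (THE q. expansion_at_infinity (fneg_series \<Gamma> I h) q)"


section \<open>Multivariable Euclidean division\<close>

text \<open>
  \<open>A S\<close> is the numerator over \<open>\<Prod>i\<in>S. 1 - t\<^sup>a\<^sup>i\<close>. A step applies the replacement to a whole term
  \<open>\<iota> t\<^sup>b\<close> of such a numerator at once.
\<close>

definition euclid_step ::
  "'v set \<Rightarrow> (nat \<Rightarrow> 'v qvec) \<Rightarrow> (nat set \<Rightarrow> 'v qpoly) \<Rightarrow> (nat set \<Rightarrow> 'v qpoly) \<Rightarrow> bool" where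
  "euclid_step I a A A' \<longleftrightarrow> (\<exists>S b i. i \<in> S \<and> b \<in> Poly_Mapping.keys (A S) \<and> \<not> prec_on I b (a i) \<and>
     (let c = Poly_Mapping.lookup (A S) b in
      A' = A (S := A S - Poly_Mapping.single b c + Poly_Mapping.single (b - a i) c,
              S - {i} := A (S - {i}) - Poly_Mapping.single (b - a i) c)))"

definition euclid_term :: "(nat \<Rightarrow> 'v::finite qvec) \<Rightarrow> (nat set \<Rightarrow> 'v qpoly) \<Rightarrow> nat set \<Rightarrow> 'v ratfun" where
  "euclid_term a A S = of_poly (A S) / (\<Prod>i\<in>S. of_poly (1 - mon (a i)))"

text \<open>
  Euclidean division, started at some presentation of \<open>g\<close> of the required form, may end at
  the decomposition \<open>g = P + R\<close>.
\<close>

definition euclid_decomposition ::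
  "'v::finite set \<Rightarrow> 'v ratfun \<Rightarrow> 'v qpoly \<Rightarrow> 'v ratfun \<Rightarrow> bool" where
  "euclid_decomposition I g P R \<longleftrightarrow> (\<exists>n a N A.
     N \<in> polys_in I \<and> (\<forall>b\<in>Poly_Mapping.keys N. \<not> prec_on I b 0) \<and>
     (\<forall>i\<in>{1..n}. restr I (a i) = a i \<and> prec_on I 0 (a i)) \<and>
     g = of_poly N / (\<Prod>i\<in>{1..n}. of_poly (1 - mon (a i))) \<and>
     (euclid_step I a)\<^sup>*\<^sup>* (\<lambda>S. if S = {1..n} then N else 0) A \<and>
     (\<forall>S\<subseteq>{1..n}. \<forall>b\<in>Poly_Mapping.keys (A S). \<not> prec_on I b 0 \<and> (\<forall>i\<in>S. prec_on I b (a i))) \<and>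
     P = A {} \<and>
     R = (\<Sum>S\<in>Pow {1..n} - {{}}. euclid_term a A S))"


section \<open>Counting function and periodic constant\<close>

definition Qcount :: "'v::finite plumbing \<Rightarrow> 'v qvec set \<Rightarrow> 'v set \<Rightarrow> 'v qvec \<Rightarrow> int" where
  "Qcount \<Gamma> g I x = (\<Sum>l | zcoeff \<Gamma> l \<noteq> 0 \<and> cls l = g \<and> \<not> geq_on I l x. zcoeff \<Gamma> l)"

definition finite_index_sublattice :: "'v qvec set \<Rightarrow> 'v qvec set \<Rightarrow> bool" where
  "finite_index_sublattice M L \<longleftrightarrow> M \<subseteq> L \<and> 0 \<in> M \<and> (\<forall>x\<in>M. \<forall>y\<in>M. x - y \<in> M) \<and>
     finite ((\<lambda>x. (+) x ` M) ` L)"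

definition quasipolynomial_on :: "'v::finite qvec set \<Rightarrow> ('v qvec \<Rightarrow> real) \<Rightarrow> bool" where
  "quasipolynomial_on M q \<longleftrightarrow> (\<exists>M0. finite_index_sublattice M0 M \<and>
     (\<forall>a\<in>M. \<exists>p. real_polynomial_function p \<and> (\<forall>x\<in>M0. q (a + x) = p (to_real (a + x)))))"

definition top_dim_cone :: "'v::finite set \<Rightarrow> (real ^ 'v) set \<Rightarrow> bool" where
  "top_dim_cone I K \<longleftrightarrow> convex_cone K \<and> K \<subseteq> range (restr_real I) \<and> dim K = card I"

definition has_pc ::
  "'v::finite plumbing \<Rightarrow> 'v set \<Rightarrow> 'v qvec set \<Rightarrow> (real ^ 'v) set \<Rightarrow> real \<Rightarrow> bool" where
  "has_pc \<Gamma> I h K c \<longleftrightarrow> top_dim_cone I K \<and>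
     (\<exists>l0\<in>K. \<exists>M q. finite_index_sublattice M latL \<and> quasipolynomial_on M q \<and>
        (\<forall>l\<in>M. restr_real I (to_real (l + rep h)) \<in> (+) l0 ` K \<longrightarrow>
           of_int (Qcount \<Gamma> h I (l + rep h)) = q l) \<and>
        c = q 0)"

definition pc :: "'v::finite plumbing \<Rightarrow> 'v set \<Rightarrow> 'v qvec set \<Rightarrow> (real ^ 'v) set \<Rightarrow> real" where
  "pc \<Gamma> I h K = (THE c. has_pc \<Gamma> I h K c)"

end

theory Submission
  imports Defs
begin

text \<open>
  The expansion at infinity of \<open>f\<^sub>h\<close> comes from a reflection. The coefficients of the series
  \<open>Z\<close> are products over the vertices, in the coordinates \<open>k\<^sub>v = - (l, E\<^sub>v)\<close> of \<open>l\<close> with respect to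
  the dual basis, of coefficients of \<open>(1 - x)\<close> to the power \<open>\<delta>\<^sub>v - 2\<close>. The map
  \<open>l \<mapsto> Z\<^sub>K - E - l\<close> replaces \<open>k\<^sub>v\<close> by \<open>\<delta>\<^sub>v - 2 - k\<^sub>v\<close>, and multiplying \<open>Z\<close> or its
  reflection \<open>w\<close> by \<open>\<Prod>(1 - t\<^bsup>E\<^sup>*\<^sub>v\<^esup>)\<^sup>2\<close> gives the same polynomial, because the sum of the
  valencies is even (\<open>conv_zden_zcoeff\<close>, \<open>conv_zden_reflected\<close>). With denominators in \<open>L\<close> the
  classes in \<open>H\<close> separate, and setting variables to 1 commutes with multiplication by
  polynomials (\<open>class_presentation\<close>, \<open>fh_red_presentation\<close>).

  Part (a). Positivity of the \<open>E\<^sup>*\<^sub>v\<close> bounds the terms of \<open>w\<close> with an exponent that is not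
  \<open>\<prec> 0\<close>, so \<open>P\<^sup>+\<close> is finite. In \<open>f\<^sup>n\<^sup>e\<^sup>g\<close> all exponents are negative, which forces negative
  degrees (\<open>rat_degree_neg_represents\<close>). Uniqueness is a comparison of degrees
  (\<open>decomposition_unique\<close>), and every run of Euclidean division preserves the value and ends
  in a decomposition of the same kind (\<open>euclid_decomposition_iff\<close>).

  Part (b). The first equation is the same reflection applied to the index set of the sum
  (\<open>eval_one_Pplus\<close>). For the periodic constant, let \<open>\<chi>(l) = - (l, l - Z\<^sub>K) / 2\<close> and give a cube,
  with vertices \<open>l + E\<^sub>K\<close> for \<open>K \<subseteq> J\<close>, the maximum of \<open>\<chi>\<close> on its vertices as weight. On a tree,
  \<open>- z(l)\<close> is the alternating sum of the weights of the cubes with least vertex \<open>l\<close>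
  (\<open>zcoeff_cubes\<close>), so that counting functions become differences of weighted Euler
  characteristics of boxes (\<open>Qcount_euler_char\<close>). Such an Euler characteristic does not change
  as long as a corner moves in a direction in which \<open>\<chi>\<close> is monotone (\<open>euler_char_grow\<close>). The
  lower corner can be moved up to \<open>r\<^sub>h\<close> (\<open>euler_char_bottom\<close>), and the upper corner can be
  moved arbitrarily far once it lies deep enough in the cone (\<open>euler_char_top\<close>).

  Hence \<open>Q\<close> for the class \<open>[Z\<^sub>K] - h\<close> at \<open>Z\<^sub>K - r\<^sub>h\<close> is the difference between the Euler
  characteristics of the slice \<open>l|\<^sub>I = r\<^sub>h|\<^sub>I\<close> and of a large box (\<open>Qcount_dual\<close>). Deep in the cone,
  \<open>Q\<close> for the class \<open>h\<close> at \<open>l + r\<^sub>h\<close> is the same difference with the slice moved to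
  \<open>(l + r\<^sub>h)|\<^sub>I\<close>. Translation by the harmonic extension \<open>m\<close> of \<open>l|\<^sub>I\<close>, the vector orthogonal to all
  \<open>E\<^sub>v\<close> with \<open>v \<notin> I\<close>, moves one slice to the other and changes \<open>\<chi>\<close> by the constant
  \<open>\<chi>(m) - (m, r\<^sub>h)\<close> (\<open>Qcount_quadratic\<close>). So \<open>Q\<close> is a quadratic polynomial in \<open>l\<close>, on a
  sublattice on which \<open>m\<close> is integral, and its value at \<open>l = 0\<close> is the number of part (b).
\<close>

abbreviation "keys \<equiv> Poly_Mapping.keys"
abbreviation "lookup \<equiv> Poly_Mapping.lookup"
abbreviation "single \<equiv> Poly_Mapping.single"

section \<open>The intersection form and the dual basis\<close>

lemma coord_basisE [simp]: "coord (basisE v) w = (if w = v then 1 else 0)"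
  by (simp add: basisE_def)

lemma coord_restr [simp]: "coord (restr I x) v = (if v \<in> I then coord x v else 0)"
  by (simp add: restr_def)

lemma coord_sum: "coord (sum f A) v = (\<Sum>a\<in>A. coord (f a) v)"
  by (induction A rule: infinite_finite_induct) auto

definition qscale :: "rat \<Rightarrow> 'v qvec \<Rightarrow> 'v qvec" where
  "qscale c x = Qvec (\<lambda>v. c * coord x v)"

lemma coord_qscale [simp]: "coord (qscale c x) v = c * coord x v"
  by (simp add: qscale_def)

lemma qvec_eqI: "(\<And>v. coord x v = coord y v) \<Longrightarrow> x = y"
  by (simp add: qvec_eq_iff)

text \<open>The number \<open>(f, E\<^sub>v)\<close>, over any field, for a vector given by its coordinates.\<close>

definition pairing :: "'v::finite plumbing \<Rightarrow> ('v \<Rightarrow> 'a::field_char_0) \<Rightarrow> 'v \<Rightarrow> 'a" where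
  "pairing \<Gamma> f v = (\<Sum>u\<in>UNIV. f u * of_int (basis_form \<Gamma> u v))"

lemma form_basisE: "form \<Gamma> x (basisE v) = pairing \<Gamma> (coord x) v"
proof -
  have "coord x u * (if w = v then 1 else 0) * of_int (basis_form \<Gamma> u w)
      = (if w = v then coord x u * of_int (basis_form \<Gamma> u w) else 0)" for u w
    by simp
  then show ?thesis
    by (simp add: form_def pairing_def)
qed

lemma form_pairing: "form \<Gamma> x y = (\<Sum>v\<in>UNIV. coord y v * pairing \<Gamma> (coord x) v)"
  unfolding form_def pairing_def
  by (subst sum.swap) (simp add: sum_distrib_left mult_ac)

lemma pairing_diff: "pairing \<Gamma> (\<lambda>v. f v - g v) v = pairing \<Gamma> f v - pairing \<Gamma> g v"
  by (simp add: pairing_def algebra_simps sum_subtractf)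

lemma pairing_scale: "pairing \<Gamma> (\<lambda>v. c * f v) v = c * pairing \<Gamma> f v"
  by (simp add: pairing_def sum_distrib_left mult_ac)

lemma pairing_coord_simps [simp]:
  "pairing \<Gamma> (coord (x + y)) v = pairing \<Gamma> (coord x) v + pairing \<Gamma> (coord y) v"
  "pairing \<Gamma> (coord (x - y)) v = pairing \<Gamma> (coord x) v - pairing \<Gamma> (coord y) v"
  "pairing \<Gamma> (coord (qscale c x)) v = c * pairing \<Gamma> (coord x) v"
  by (simp_all add: pairing_def algebra_simps sum.distrib sum_subtractf sum_distrib_left)

lemma pairing_sum: "pairing \<Gamma> (\<lambda>u. \<Sum>a\<in>A. f a u) v = (\<Sum>a\<in>A. pairing \<Gamma> (f a) v)"
  unfolding pairing_def by (subst sum.swap) (simp add: sum_distrib_right)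

lemma pairing_split:
  "pairing \<Gamma> f v = f v * of_int (euler \<Gamma> v) + (\<Sum>u\<in>UNIV - {v}. f u * (if adj \<Gamma> u v then 1 else 0))"
  unfolding pairing_def
  by (subst sum.remove[of _ v]) (auto simp: basis_form_def intro!: sum.cong split: if_splits)

lemma common_denominator_ex:
  fixes f :: "'a \<Rightarrow> rat"
  assumes "finite A"
  shows "\<exists>N::nat. 0 < N \<and> (\<forall>a\<in>A. of_nat N * f a \<in> \<int>)"
  using assms
proof (induction A)
  case empty
  then show ?case by (auto intro: exI[of _ 1])
next
  case (insert a A)
  then obtain N :: nat where N: "0 < N" "\<And>b. b \<in> A \<Longrightarrow> of_nat N * f b \<in> \<int>" by blast
  obtain p q where pq: "quotient_of (f a) = (p, q)"
    by fastforce
  then have q: "q > 0" by (rule quotient_of_denom_pos)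
  have 1: "of_int q * f a = of_int p"
    using quotient_of_div[OF pq] q by simp
  have "of_nat (N * nat q) * f b \<in> \<int>" if "b \<in> insert a A" for b
  proof (cases "b = a")
    case True
    have "rat_of_nat (N * nat q) * f a = of_nat N * (of_int q * f a)"
      using q by (simp add: of_nat_nat)
    moreover have "rat_of_nat N * (of_int q * f a) \<in> \<int>" unfolding 1 by simp
    ultimately show ?thesis unfolding True by metis
  next
    case False
    then have "of_nat (N * nat q) * f b = of_int q * (of_nat N * f b)"
      using q by (simp add: of_nat_nat)
    moreover have "of_int q * (of_nat N * f b) \<in> \<int>"
      using N(2)[of b] that False by (intro Ints_mult[OF Ints_of_int]) auto
    ultimately show ?thesis by metis
  qed
  moreover have "0 < N * nat q" using N q by simp
  ultimately show ?case by blast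
qed

lemma common_denominator_qvec:
  fixes f :: "'a::finite \<Rightarrow> 'v::finite qvec"
  obtains N :: nat where "0 < N" "\<And>a v. of_nat N * coord (f a) v \<in> \<int>"
  using common_denominator_ex[of "UNIV :: ('a \<times> 'v) set" "\<lambda>(a, v). coord (f a) v"] by auto

text \<open>The inverse matrix, for vectors given as functions.\<close>

lemma linear_system_inverse:
  fixes A :: "'v::finite \<Rightarrow> 'v \<Rightarrow> rat"
  assumes ker: "\<And>x. (\<And>v. (\<Sum>u\<in>UNIV. A v u * x u) = 0) \<Longrightarrow> x = (\<lambda>_. 0)"
  obtains H :: "'v \<Rightarrow> 'v \<Rightarrow> rat"
    where "\<And>b v. (\<Sum>u\<in>UNIV. A v u * (\<Sum>w\<in>UNIV. H u w * b w)) = b v"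
proof -
  define M :: "rat^'v^'v" where "M = (\<chi> v u. A v u)"
  have "x = 0" if "M *v x = 0" for x
  proof -
    have "(\<Sum>u\<in>UNIV. A v u * x $ u) = 0" for v
      using that by (simp add: vec_eq_iff matrix_vector_mult_def M_def)
    then have "(\<lambda>u. x $ u) = (\<lambda>_. 0)" by (rule ker)
    then show ?thesis by (simp add: vec_eq_iff fun_eq_iff)
  qed
  then have "\<exists>B. B ** M = mat 1"
    by (simp add: matrix_left_invertible_ker)
  then obtain B where "B ** M = mat 1" ..
  then have MB: "M ** B = mat 1"
    by (rule matrix_left_right_inverse1)
  have "(\<Sum>u\<in>UNIV. A v u * (\<Sum>w\<in>UNIV. B $ u $ w * b w)) = b v" for b v
  proof -
    have "(M *v (B *v (\<chi> w. b w))) $ v = b v"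
      by (simp add: matrix_vector_mul_assoc MB)
    then show ?thesis by (simp add: matrix_vector_mult_def M_def)
  qed
  then show ?thesis by (rule that)
qed

locale negdef_tree =
  fixes \<Gamma> :: "'v::finite plumbing"
  assumes tree: "is_tree \<Gamma>" and negdef: "negative_definite \<Gamma>"
begin

lemma adj_irrefl: "\<not> adj \<Gamma> v v" and adj_sym: "adj \<Gamma> v w \<Longrightarrow> adj \<Gamma> w v"
  and adj_connected: "(v, w) \<in> {(x, y). adj \<Gamma> x y}\<^sup>*"
  using tree by (auto simp: is_tree_def)

lemma basis_form_sym: "basis_form \<Gamma> v w = basis_form \<Gamma> w v"
  using adj_sym by (auto simp: basis_form_def)

lemma form_sym: "form \<Gamma> x y = form \<Gamma> y x"
proof -
  have "form \<Gamma> x y = (\<Sum>w\<in>UNIV. \<Sum>v\<in>UNIV. coord x v * coord y w * of_int (basis_form \<Gamma> v w))"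
    unfolding form_def by (rule sum.swap)
  also have "\<dots> = form \<Gamma> y x"
    unfolding form_def by (intro sum.cong refl) (metis basis_form_sym mult.commute)
  finally show ?thesis .
qed

text \<open>Definiteness on the lattice extends to rational vectors, as these have integral multiples.\<close>

lemma form_neg:
  assumes "x \<noteq> 0"
  shows "form \<Gamma> x x < 0"
proof -
  obtain N :: nat where N: "0 < N" "\<And>v. of_nat N * coord x v \<in> \<int>"
    using common_denominator_ex[of UNIV "coord x"] by auto
  define y where "y = qscale (of_nat N) x"
  have "y \<in> latL" using N by (simp add: latL_def y_def)
  moreover have "y \<noteq> 0" using assms N by (auto simp: y_def qvec_eq_iff)
  ultimately have "form \<Gamma> y y < 0" using negdef by (simp add: negative_definite_def)
  also have "form \<Gamma> y y = of_nat N * of_nat N * form \<Gamma> x x"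
    by (simp add: form_def y_def sum_distrib_left mult_ac)
  finally show ?thesis using N(1) by (simp add: mult_less_0_iff zero_less_mult_iff)
qed

lemma euler_neg: "euler \<Gamma> v < 0"
proof -
  have "basisE v \<noteq> (0 :: 'v qvec)"
    by (auto simp: qvec_eq_iff)
  then have "form \<Gamma> (basisE v) (basisE v) < 0" by (rule form_neg)
  then show ?thesis
    by (simp add: form_basisE pairing_split of_int_less_0_iff)
qed

text \<open>
  A maximum principle: \<open>(x, x\<^sup>-) \<le> 0\<close> for the negative part \<open>x\<^sup>-\<close>, whereas
  \<open>(x\<^sup>+, x\<^sup>-) \<ge> 0\<close>, as the two have disjoint supports; hence \<open>(x\<^sup>-, x\<^sup>-) \<ge> 0\<close>.
\<close>

lemma max_principle:
  assumes pos: "\<And>v. v \<in> T \<Longrightarrow> 0 \<le> coord x v"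
    and anti: "\<And>v. v \<notin> T \<Longrightarrow> pairing \<Gamma> (coord x) v \<le> 0"
  shows "0 \<le> coord x v"
proof -
  define m where "m = Qvec (\<lambda>v. max 0 (- coord x v))"
  define p where "p = Qvec (\<lambda>v. max 0 (coord x v))"
  have x: "coord x v = coord p v - coord m v" for v by (simp add: p_def m_def max_def)
  have "form \<Gamma> x m \<le> 0"
    unfolding form_pairing
  proof (rule sum_nonpos)
    fix v
    show "coord m v * pairing \<Gamma> (coord x) v \<le> 0"
    proof (cases "v \<in> T")
      case True
      then show ?thesis using pos[of v] by (simp add: m_def max_def)
    next
      case False
      then show ?thesis using anti[of v] by (intro mult_nonneg_nonpos) (auto simp: m_def)
    qed
  qed
  moreover have "form \<Gamma> x m = form \<Gamma> p m - form \<Gamma> m m"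
    unfolding form_def x by (simp add: algebra_simps sum_subtractf)
  moreover have "0 \<le> form \<Gamma> p m"
    unfolding form_def
  proof (intro sum_nonneg)
    fix v w
    show "0 \<le> coord p v * coord m w * of_int (basis_form \<Gamma> v w)"
      by (cases "v = w") (auto simp: p_def m_def basis_form_def max_def)
  qed
  ultimately have "\<not> form \<Gamma> m m < 0" by simp
  then have "m = 0" using form_neg by blast
  then have "coord m v = 0" by simp
  then show ?thesis by (simp add: m_def max_def split: if_splits)
qed

lemma pairing_eq_0:
  assumes "\<And>v. pairing \<Gamma> (coord x) v = 0"
  shows "x = 0"
proof (rule ccontr)
  assume "x \<noteq> 0"
  then have "form \<Gamma> x x < 0" by (rule form_neg)
  then show False using assms by (simp add: form_pairing)
qed

lemma pairing_inj:
  assumes "\<And>v. pairing \<Gamma> (coord x) v = pairing \<Gamma> (coord y) v"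
  shows "x = y"
proof -
  have "x - y = 0"
    using assms by (intro pairing_eq_0) simp
  then show ?thesis by simp
qed

lemma pairing_surj: "\<exists>x. \<forall>v. pairing \<Gamma> (coord x) v = b v"
proof -
  obtain H :: "'v \<Rightarrow> 'v \<Rightarrow> rat" where H: "\<And>b v. (\<Sum>u\<in>UNIV. of_int (basis_form \<Gamma> u v) * (\<Sum>w\<in>UNIV. H u w * b w)) = b v"
  proof (rule linear_system_inverse[of "\<lambda>v u. of_int (basis_form \<Gamma> u v)"])
    fix x :: "'v \<Rightarrow> rat"
    assume "\<And>v. (\<Sum>u\<in>UNIV. of_int (basis_form \<Gamma> u v) * x u) = 0"
    then have "Qvec x = 0"
      by (intro pairing_eq_0) (simp add: pairing_def mult.commute)
    then show "x = (\<lambda>_. 0)" by (metis coord_Qvec coord_zero ext)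
  qed blast
  have "pairing \<Gamma> (coord (Qvec (\<lambda>u. \<Sum>w\<in>UNIV. H u w * b w))) v = b v" for v
    using H[of v b] by (simp add: pairing_def mult.commute)
  then show ?thesis by blast
qed

lemma pairing_Estar: "pairing \<Gamma> (coord (Estar \<Gamma> v)) w = (if v = w then -1 else 0)"
proof -
  have "\<exists>!x. \<forall>w. form \<Gamma> x (basisE w) = (if v = w then -1 else 0)"
    unfolding form_basisE using pairing_surj[of "\<lambda>w. if v = w then -1 else 0"]
    by (metis pairing_inj)
  from theI'[OF this] show ?thesis by (simp add: form_basisE Estar_def)
qed

lemma pairing_ZK: "pairing \<Gamma> (coord (ZK \<Gamma>)) v = of_int (euler \<Gamma> v) + 2"
proof -
  have E: "form \<Gamma> (basisE v) (basisE v) = of_int (euler \<Gamma> v)" for v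
    by (simp add: form_basisE pairing_split)
  have "\<exists>!x. \<forall>w. form \<Gamma> x (basisE w) = form \<Gamma> (basisE w) (basisE w) + 2"
    unfolding form_basisE using pairing_surj[of "\<lambda>w. pairing \<Gamma> (coord (basisE w)) w + 2"]
    by (metis pairing_inj)
  from theI'[OF this] show ?thesis by (simp add: E ZK_def flip: form_basisE)
qed

text \<open>The coordinates with respect to the dual basis, by \<open>coord_expansion\<close> below.\<close>

definition dual_coord :: "'v qvec \<Rightarrow> 'v \<Rightarrow> rat" where
  "dual_coord x v = - pairing \<Gamma> (coord x) v"

lemma dual_coord_add [simp]: "dual_coord (x + y) v = dual_coord x v + dual_coord y v"
  by (simp add: dual_coord_def)

lemma dual_coord_diff [simp]: "dual_coord (x - y) v = dual_coord x v - dual_coord y v"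
  by (simp add: dual_coord_def)

lemma dual_coord_zero [simp]: "dual_coord 0 v = 0"
  by (simp add: dual_coord_def pairing_def)

lemma dual_coord_qscale [simp]: "dual_coord (qscale c x) v = c * dual_coord x v"
  by (simp add: dual_coord_def)

lemma dual_coord_sum: "dual_coord (sum f A) v = (\<Sum>a\<in>A. dual_coord (f a) v)"
  by (induction A rule: infinite_finite_induct) auto

lemma dual_coord_Estar [simp]: "dual_coord (Estar \<Gamma> v) w = (if v = w then 1 else 0)"
  by (simp add: dual_coord_def pairing_Estar)

lemma dual_coord_ZK [simp]: "dual_coord (ZK \<Gamma>) v = - of_int (euler \<Gamma> v) - 2"
  by (simp add: dual_coord_def pairing_ZK)

lemma dual_coord_basisE: "dual_coord (basisE v) w = - of_int (basis_form \<Gamma> v w)"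
proof -
  have "(if u = v then 1 else 0) * rat_of_int (basis_form \<Gamma> u w)
      = (if u = v then of_int (basis_form \<Gamma> u w) else 0)" for u
    by simp
  then show ?thesis by (simp add: dual_coord_def pairing_def)
qed

lemma dual_coord_sumE: "dual_coord sumE v = - of_int (euler \<Gamma> v) - of_nat (valency \<Gamma> v)"
proof -
  have "dual_coord sumE v = - (\<Sum>u\<in>UNIV. of_int (basis_form \<Gamma> u v))"
    by (simp add: sumE_def dual_coord_sum dual_coord_basisE sum_negf)
  also have "(\<Sum>u\<in>UNIV. rat_of_int (basis_form \<Gamma> u v))
      = of_int (euler \<Gamma> v) + (\<Sum>u\<in>UNIV - {v}. if adj \<Gamma> u v then 1 else 0)"
    by (subst sum.remove[of _ v]) (auto simp: basis_form_def intro!: sum.cong split: if_splits)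
  also have "(\<Sum>u\<in>UNIV - {v}. if adj \<Gamma> u v then 1 else 0 :: rat) = of_nat (card {u \<in> UNIV - {v}. adj \<Gamma> u v})"
    by (simp flip: sum.inter_filter)
  also have "{u \<in> UNIV - {v}. adj \<Gamma> u v} = {w. adj \<Gamma> v w}"
    using adj_irrefl adj_sym by auto
  finally show ?thesis by (simp add: valency_def)
qed

text \<open>The equation \<open>Z\<^sub>K - E = \<Sum>(\<delta>\<^sub>v - 2) E\<^sup>*\<^sub>v\<close>.\<close>

lemma dual_coord_ZK_sumE: "dual_coord (ZK \<Gamma> - sumE) v = of_nat (valency \<Gamma> v) - 2"
  by (simp add: dual_coord_sumE)

lemma dual_coord_inj: "(\<And>v. dual_coord x v = dual_coord y v) \<Longrightarrow> x = y"
  by (rule pairing_inj) (simp add: dual_coord_def)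

lemma expansion: "x = (\<Sum>v\<in>UNIV. qscale (dual_coord x v) (Estar \<Gamma> v))"
  by (rule dual_coord_inj) (simp add: dual_coord_sum if_distrib cong: if_cong)

lemma coord_expansion: "coord x u = (\<Sum>v\<in>UNIV. dual_coord x v * coord (Estar \<Gamma> v) u)"
  using arg_cong[OF expansion[of x], of "\<lambda>x. coord x u"] by (simp only: coord_sum coord_qscale)

lemma max_principle_dual_coord:
  assumes "\<And>v. v \<in> T \<Longrightarrow> 0 \<le> coord x v" and "\<And>v. v \<notin> T \<Longrightarrow> 0 \<le> dual_coord x v"
  shows "0 \<le> coord x v"
  using assms(2) by (intro max_principle[of T x v] assms(1)) (simp_all add: dual_coord_def)

lemma Estar_nonneg: "0 \<le> coord (Estar \<Gamma> v) u"
  by (rule max_principle_dual_coord[of "{}"]) simp_all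

text \<open>If one coordinate vanished, so would those of all neighbours, hence all of them.\<close>

lemma Estar_pos: "0 < coord (Estar \<Gamma> v) u"
proof (rule ccontr)
  let ?x = "Estar \<Gamma> v"
  assume "\<not> 0 < coord ?x u"
  then have u: "coord ?x u = 0" using Estar_nonneg[of v u] by simp
  have step: "coord ?x w' = 0" if w: "coord ?x w = 0" and adj: "adj \<Gamma> w w'" for w w'
  proof -
    have "(\<Sum>t\<in>UNIV - {w}. coord ?x t * (if adj \<Gamma> t w then 1 else 0)) \<le> 0"
      using pairing_Estar[of v w] w by (simp add: pairing_split split: if_splits)
    moreover have "coord ?x w' * (if adj \<Gamma> w' w then 1 else 0)
        \<le> (\<Sum>t\<in>UNIV - {w}. coord ?x t * (if adj \<Gamma> t w then 1 else 0))"
      using adj adj_irrefl by (intro member_le_sum) (auto simp: Estar_nonneg)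
    ultimately show ?thesis using adj adj_sym Estar_nonneg[of v w'] by auto
  qed
  have "coord ?x w = 0" for w
    using adj_connected[of u w] by induction (use u step in auto)
  then have "?x = 0" by (simp add: qvec_eq_iff)
  then show False using dual_coord_Estar[of v v] by simp
qed

lemma form_dual_coord: "form \<Gamma> x y = - (\<Sum>v\<in>UNIV. coord y v * dual_coord x v)"
  by (simp add: form_pairing dual_coord_def sum_negf)

lemma dualL_iff: "x \<in> dualL \<Gamma> \<longleftrightarrow> (\<forall>v. dual_coord x v \<in> \<int>)"
proof
  assume x: "x \<in> dualL \<Gamma>"
  have "basisE v \<in> latL" for v :: 'v by (simp add: latL_def)
  then show "\<forall>v. dual_coord x v \<in> \<int>"
    using x by (auto simp: dualL_def dual_coord_def simp flip: form_basisE)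
next
  assume "\<forall>v. dual_coord x v \<in> \<int>"
  then show "x \<in> dualL \<Gamma>"
    by (auto simp: dualL_def form_dual_coord latL_def intro!: Ints_mult)
qed

lemma monoidS_iff: "x \<in> monoidS \<Gamma> \<longleftrightarrow> (\<forall>v. dual_coord x v \<in> \<nat>)"
proof
  assume "x \<in> monoidS \<Gamma>"
  then obtain k :: "'v \<Rightarrow> nat" where "x = Qvec (\<lambda>u. \<Sum>v\<in>UNIV. of_nat (k v) * coord (Estar \<Gamma> v) u)"
    by (auto simp: monoidS_def)
  then have "x = (\<Sum>v\<in>UNIV. qscale (of_nat (k v)) (Estar \<Gamma> v))"
    by (simp add: qvec_eq_iff coord_sum)
  then show "\<forall>v. dual_coord x v \<in> \<nat>" by (auto simp: dual_coord_sum if_distrib cong: if_cong)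
next
  assume "\<forall>v. dual_coord x v \<in> \<nat>"
  then have "\<forall>v. \<exists>k. dual_coord x v = of_nat k"
    by (meson Nats_cases)
  then obtain k where "\<And>v. dual_coord x v = of_nat (k v)"
    by metis
  then have "x = Qvec (\<lambda>u. \<Sum>v\<in>UNIV. of_nat (k v) * coord (Estar \<Gamma> v) u)"
    using coord_expansion[of x] by (simp add: qvec_eq_iff)
  then show "x \<in> monoidS \<Gamma>" by (auto simp: monoidS_def)
qed

lemma monoidS_nonneg: "x \<in> monoidS \<Gamma> \<Longrightarrow> 0 \<le> coord x v"
  using max_principle_dual_coord[of "{}" x v] by (simp add: monoidS_iff Nats_altdef2)

text \<open>Finiteness of all sums below: one bounded coordinate bounds all coefficients at the \<open>E\<^sup>*\<^sub>v\<close>.\<close>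

lemma finite_monoidS_below:
  "finite {x \<in> monoidS \<Gamma>. coord x i \<le> M}"
proof -
  obtain B :: nat where B: "\<And>v. M / coord (Estar \<Gamma> v) i \<le> of_nat B"
  proof -
    define m where "m = Max (range (\<lambda>v. M / coord (Estar \<Gamma> v) i))"
    obtain B :: nat where "m \<le> of_nat B" by (meson less_imp_le reals_Archimedean2)
    then have "M / coord (Estar \<Gamma> v) i \<le> of_nat B" for v
      using Max_ge[of "range (\<lambda>v. M / coord (Estar \<Gamma> v) i)" "M / coord (Estar \<Gamma> v) i"]
      by (simp add: m_def)
    then show ?thesis by (rule that)
  qed
  define F where "F = (\<lambda>k :: 'v \<Rightarrow> nat. Qvec (\<lambda>u. \<Sum>v\<in>UNIV. of_nat (k v) * coord (Estar \<Gamma> v) u))"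
  have "{x \<in> monoidS \<Gamma>. coord x i \<le> M} \<subseteq> F ` (PiE UNIV (\<lambda>_. {..B}))"
  proof
    fix x assume "x \<in> {x \<in> monoidS \<Gamma>. coord x i \<le> M}"
    then obtain k where k: "x = F k" and le: "coord x i \<le> M"
      by (auto simp: monoidS_def F_def)
    have "k v \<le> B" for v
    proof -
      have "of_nat (k v) * coord (Estar \<Gamma> v) i \<le> (\<Sum>v\<in>UNIV. of_nat (k v) * coord (Estar \<Gamma> v) i)"
        by (rule member_le_sum) (auto simp: Estar_nonneg)
      also have "\<dots> \<le> M" using le by (simp add: k F_def)
      finally have "of_nat (k v) \<le> M / coord (Estar \<Gamma> v) i"
        using Estar_pos[of v i] by (simp add: field_simps)
      then have "(of_nat (k v) :: rat) \<le> of_nat B" using B[of v] by linarith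
      then show ?thesis by simp
    qed
    then show "x \<in> F ` (PiE UNIV (\<lambda>_. {..B}))" using k by (auto simp: PiE_def)
  qed
  then show ?thesis by (rule finite_subset) (simp add: finite_PiE)
qed

end

section \<open>Polynomials acting on series\<close>

text \<open>
  Series multiply by polynomials without any condition on their supports, and functions on all
  exponents become a module over the polynomials.
\<close>

definition conv :: "'v::finite qpoly \<Rightarrow> 'v series \<Rightarrow> 'v series" where
  "conv p s l = (\<Sum>k\<in>keys p. lookup p k * s (l - k))"

lemma poly_sum_single: "p = (\<Sum>k\<in>keys p. single k (lookup p k))"
proof (rule poly_mapping_eqI)
  fix j
  have "lookup (\<Sum>k\<in>keys p. single k (lookup p k)) j
      = (\<Sum>k\<in>keys p. if k = j then lookup p k else 0)"
    unfolding lookup_sum by (intro sum.cong refl) (simp add: lookup_single when_def)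
  then show "lookup p j
      = lookup (\<Sum>k\<in>keys p. single k (lookup p k)) j"
    by (simp add: in_keys_iff)
qed

lemma poly_induct [case_names zero single add]:
  fixes p :: "'v::finite qpoly"
  assumes "P 0" "\<And>k c. P (single k c)" "\<And>p q. P p \<Longrightarrow> P q \<Longrightarrow> P (p + q)"
  shows "P p"
proof -
  have "P (\<Sum>k\<in>A. single k (f k))" if "finite A" for A f
    using that by induction (use assms in auto)
  then show ?thesis using poly_sum_single[of p] by (metis finite_keys)
qed

lemma conv_superset:
  assumes "finite A" "keys p \<subseteq> A"
  shows "conv p s l = (\<Sum>k\<in>A. lookup p k * s (l - k))"
  unfolding conv_def using assms by (intro sum.mono_neutral_left) (auto simp: in_keys_iff)

lemma conv_zero [simp]: "conv 0 s l = 0"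
  by (simp add: conv_def)

lemma conv_single [simp]: "conv (single k c) s l = c * s (l - k)"
  by (subst conv_superset[of "{k}"]) auto

lemma conv_add: "conv (p + q) s l = conv p s l + conv q s l"
proof -
  let ?A = "keys p \<union> keys q"
  have "conv (p + q) s l = (\<Sum>k\<in>?A. lookup (p + q) k * s (l - k))"
    by (rule conv_superset) (auto simp: keys_add)
  then show ?thesis
    by (simp add: conv_superset[of ?A] lookup_add algebra_simps sum.distrib)
qed

lemma conv_uminus: "conv (- p) s l = - conv p s l"
  using conv_add[of "- p" p s l] by simp

lemma conv_diff: "conv (p - q) s l = conv p s l - conv q s l"
  using conv_add[of p "- q" s l] by (simp add: conv_uminus)

lemma conv_one [simp]: "conv 1 s = s"
  by (rule ext) (simp add: conv_def)

lemma conv_single_mult: "conv (single k c * q) s l = c * conv q s (l - k)"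
proof (induction q rule: poly_induct)
  case (add p q)
  then show ?case by (simp add: conv_add algebra_simps)
qed (auto simp: mult_single algebra_simps)

lemma conv_mult: "conv (p * q) s = conv p (conv q s)"
proof (rule ext)
  fix l
  show "conv (p * q) s l = conv p (conv q s) l"
  proof (induction p rule: poly_induct)
    case (add p p')
    then show ?case by (simp add: conv_add algebra_simps)
  qed (auto simp: conv_single_mult)
qed

text \<open>A polynomial is the result of its action on the series 1.\<close>

lemma conv_delta: "conv p (\<lambda>l. if l = 0 then 1 else 0) = lookup p"
proof (rule ext)
  fix l
  show "conv p (\<lambda>l. if l = 0 then 1 else 0) l = lookup p l"
    by (induction p rule: poly_induct) (auto simp: conv_add lookup_add lookup_single when_def)
qed

lemma conv_lookup: "conv p (lookup q) = lookup (p * q)"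
  by (simp flip: conv_delta add: conv_mult)

lemma conv_diff_right: "conv p (\<lambda>l. s l - s' l) l = conv p s l - conv p s' l"
  by (simp add: conv_def algebra_simps sum_subtractf)

lemma conv_nonzeroE:
  assumes "conv p s l \<noteq> 0"
  obtains k where "k \<in> keys p" "s (l - k) \<noteq> 0"
  using assms sum.not_neutral_contains_not_neutral[of "\<lambda>k. lookup p k * s (l - k)" "keys p"]
  unfolding conv_def by auto

lemma keys_multE:
  assumes "k \<in> keys (p * q)"
  obtains a b where "a \<in> keys p" "b \<in> keys q" "k = a + b"
  using assms keys_mult[of p q] by blast

lemma represents_iff:
  "represents s q \<longleftrightarrow> (\<exists>n d. d \<noteq> 0 \<and> q = Fract n d \<and> conv d s = lookup n)"
  by (simp add: represents_def conv_def fun_eq_iff)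

lemma representsI:
  "d \<noteq> 0 \<Longrightarrow> conv d s = lookup n \<Longrightarrow> represents s (Fract n d)"
  unfolding represents_iff by blast

text \<open>From \<open>d s = n\<close> and \<open>d' s = n'\<close> follows \<open>d' n = d' d s = d n'\<close>.\<close>

lemma represents_unique:
  assumes "represents s q" "represents s q'"
  shows "q = q'"
proof -
  obtain n d where 1: "d \<noteq> 0" "q = Fract n d" "conv d s = lookup n"
    using assms(1) unfolding represents_iff by blast
  obtain n' d' where 2: "d' \<noteq> 0" "q' = Fract n' d'" "conv d' s = lookup n'"
    using assms(2) unfolding represents_iff by blast
  have "lookup (d' * n) = conv (d' * d) s"
    by (simp add: conv_mult 1 conv_lookup)
  also have "\<dots> = conv (d * d') s" by (simp add: mult.commute)
  also have "\<dots> = lookup (d * n')"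
    by (simp add: conv_mult 2 conv_lookup)
  finally have "lookup (d' * n) = lookup (d * n')" .
  then have "d' * n = d * n'" by (simp only: lookup_inject)
  then have "n * d' = n' * d" by (simp only: mult.commute)
  then show ?thesis using 1(1) 2(1) unfolding 1(2) 2(2) by (subst eq_fract) auto
qed

lemma represents_diff_poly:
  assumes "represents s q"
  shows "represents (\<lambda>l. s l - lookup P l) (q - of_poly P)"
proof -
  obtain n d where 1: "d \<noteq> 0" "q = Fract n d" "conv d s = lookup n"
    using assms(1) unfolding represents_iff by blast
  have "conv d (\<lambda>l. s l - lookup P l) = lookup (n - d * P)"
    using 1(3) by (intro ext) (simp add: conv_diff_right conv_lookup lookup_minus)
  moreover have "q - of_poly P = Fract (n - d * P) d"
    using 1 by (simp add: of_poly_def mult.commute)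
  ultimately show ?thesis using 1(1) representsI by metis
qed

section \<open>Lowest terms and degrees\<close>

text \<open>
  The lexicographic order only breaks ties between terms with the same value of the additive
  function \<open>\<rho>\<close>. With \<open>\<rho>\<close> the negative of a coordinate, the lowest term is one of top degree.
\<close>

definition is_lowest :: "('v::finite qvec \<Rightarrow> rat) \<Rightarrow> 'v qvec set \<Rightarrow> 'v qvec \<Rightarrow> bool" where
  "is_lowest \<rho> S k \<longleftrightarrow> k \<in> S \<and> (\<forall>l\<in>S. \<rho> k < \<rho> l \<or> \<rho> k = \<rho> l \<and> k \<le> l)"

lemma is_lowest_exists:
  assumes "l \<in> S" and min: "\<And>x. x \<in> S \<Longrightarrow> \<rho> l \<le> \<rho> x" and fin: "finite {x \<in> S. \<rho> x = \<rho> l}"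
  shows "\<exists>k. is_lowest \<rho> S k"
proof -
  define k where "k = Min {x \<in> S. \<rho> x = \<rho> l}"
  have "k \<in> {x \<in> S. \<rho> x = \<rho> l}"
    unfolding k_def using assms by (intro Min_in) auto
  moreover have "k \<le> x" if "x \<in> S" "\<rho> x = \<rho> l" for x
    unfolding k_def using that fin by (intro Min_le) auto
  ultimately show ?thesis
    using min unfolding is_lowest_def by (intro exI[of _ k]) (auto simp: order_less_le)
qed

lemma is_lowest_exists_finite:
  assumes "finite S" "S \<noteq> {}"
  shows "\<exists>k. is_lowest \<rho> S k"
proof -
  obtain l where "l \<in> S" "\<And>x. x \<in> S \<Longrightarrow> \<rho> l \<le> \<rho> x"
    using ex_min_if_finite[of "\<rho> ` S"] assms by (auto simp: not_less)
  then show ?thesis using assms by (intro is_lowest_exists[of l]) auto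
qed

text \<open>
  Only the product of the two lowest terms contributes to the lowest exponent of a product, as
  \<open>(\<rho> x, x)\<close> is additive and totally ordered.
\<close>

lemma conv_lowest:
  assumes add: "\<And>x y. \<rho> (x + y) = \<rho> x + \<rho> y"
    and k: "is_lowest \<rho> (keys p) k" and l: "is_lowest \<rho> {l. s l \<noteq> 0} l"
  shows "conv p s (k + l) = lookup p k * s l"
proof -
  have diff: "\<rho> (x - y) = \<rho> x - \<rho> y" for x y
    using add[of "x - y" y] by simp
  have "s (k + l - j) = 0" if j: "j \<in> keys p - {k}" for j
  proof (rule ccontr)
    assume "s (k + l - j) \<noteq> 0"
    then have "\<rho> l < \<rho> (k + l - j) \<or> \<rho> l = \<rho> (k + l - j) \<and> l \<le> k + l - j"
      using l unfolding is_lowest_def by blast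
    moreover have "\<rho> k < \<rho> j \<or> \<rho> k = \<rho> j \<and> k \<le> j"
      using k j unfolding is_lowest_def by blast
    ultimately have "k \<le> j" "l \<le> k + l - j"
      by (auto simp: add diff)
    then have "j = k" by (simp add: algebra_simps)
    then show False using j by simp
  qed
  moreover have "k \<in> keys p" using k by (simp add: is_lowest_def)
  ultimately show ?thesis
    unfolding conv_def by (subst sum.remove[of _ k]) auto
qed

lemma finite_lattice_box:
  assumes "0 < N"
  shows "finite {l :: 'v::finite qvec. \<forall>v. of_nat N * coord l v \<in> \<int> \<and> c v \<le> coord l v \<and> coord l v \<le> C v}"
    (is "finite ?S")
proof -
  define F :: "('v \<Rightarrow> int) \<Rightarrow> 'v qvec" where "F = (\<lambda>k. Qvec (\<lambda>v. of_int (k v) / of_nat N))"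
  have "?S \<subseteq> F ` (PiE UNIV (\<lambda>v. {\<lfloor>of_nat N * c v\<rfloor>..\<lceil>of_nat N * C v\<rceil>}))"
  proof
    fix l assume l: "l \<in> ?S"
    define k where "k = (\<lambda>v. \<lfloor>of_nat N * coord l v\<rfloor>)"
    have k: "of_int (k v) = of_nat N * coord l v" for v
      using l unfolding k_def by (auto elim: Ints_cases)
    have "l = F k" using assms by (simp add: F_def k qvec_eq_iff)
    moreover have "k \<in> PiE UNIV (\<lambda>v. {\<lfloor>of_nat N * c v\<rfloor>..\<lceil>of_nat N * C v\<rceil>})"
    proof (clarsimp simp: PiE_def)
      fix v
      have "of_nat N * c v \<le> of_int (k v)" "of_int (k v) \<le> of_nat N * C v"
        using l assms unfolding k by (auto intro!: mult_left_mono)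
      then show "\<lfloor>of_nat N * c v\<rfloor> \<le> k v \<and> k v \<le> \<lceil>of_nat N * C v\<rceil>" by linarith
    qed
    ultimately show "l \<in> F ` (PiE UNIV (\<lambda>v. {\<lfloor>of_nat N * c v\<rfloor>..\<lceil>of_nat N * C v\<rceil>}))" by blast
  qed
  then show ?thesis by (rule finite_subset) (simp add: finite_PiE)
qed

text \<open>
  The sum of the coordinates attains its minimum on the support of \<open>u\<close>, at finitely many exponents,
  so \<open>u\<close> has a lowest term. Its product with the lowest term of \<open>D\<close> cannot be cancelled.
\<close>

lemma conv_eq_0:
  assumes "conv D u = (\<lambda>_. 0)" "D \<noteq> 0" and N: "0 < N"
    and int: "\<And>l v. u l \<noteq> 0 \<Longrightarrow> of_nat N * coord l v \<in> \<int>"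
    and nonneg: "\<And>l v. u l \<noteq> 0 \<Longrightarrow> 0 \<le> coord l v"
  shows "u = (\<lambda>_. 0)"
proof (rule ccontr)
  assume "u \<noteq> (\<lambda>_. 0)"
  then obtain l0 where l0: "u l0 \<noteq> 0" by auto
  define \<rho> where "\<rho> = (\<lambda>l :: 'a qvec. \<Sum>v\<in>UNIV. coord l v)"
  have add: "\<rho> (x + y) = \<rho> x + \<rho> y" for x y by (simp add: \<rho>_def sum.distrib)
  have \<rho>_nat: "of_nat (nat \<lfloor>of_nat N * \<rho> l\<rfloor>) = of_nat N * \<rho> l" if "u l \<noteq> 0" for l
  proof -
    have "of_nat N * \<rho> l \<in> \<int>"
      unfolding \<rho>_def sum_distrib_left using int[OF that] by (rule Ints_sum)
    moreover have "0 \<le> \<rho> l" unfolding \<rho>_def using nonneg[OF that] by (intro sum_nonneg)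
    ultimately show ?thesis by (auto elim!: Ints_cases)
  qed
  define l1 where "l1 = arg_min (\<lambda>l. nat \<lfloor>of_nat N * \<rho> l\<rfloor>) (\<lambda>l. u l \<noteq> 0)"
  have l1: "u l1 \<noteq> 0" unfolding l1_def using l0 by (rule arg_min_natI)
  have min: "\<rho> l1 \<le> \<rho> l" if "u l \<noteq> 0" for l
  proof -
    have "nat \<lfloor>of_nat N * \<rho> l1\<rfloor> \<le> nat \<lfloor>of_nat N * \<rho> l\<rfloor>"
      unfolding l1_def using that by (rule arg_min_nat_le)
    then have "of_nat N * \<rho> l1 \<le> of_nat N * \<rho> l"
      using \<rho>_nat[OF l1] \<rho>_nat[OF that] by (metis of_nat_le_iff)
    then show ?thesis using N by simp
  qed
  have "finite {l \<in> {l. u l \<noteq> 0}. \<rho> l = \<rho> l1}"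
  proof (rule finite_subset)
    show "{l \<in> {l. u l \<noteq> 0}. \<rho> l = \<rho> l1}
        \<subseteq> {l. \<forall>v. of_nat N * coord l v \<in> \<int> \<and> 0 \<le> coord l v \<and> coord l v \<le> \<rho> l1}"
    proof clarsimp
      fix l v assume l: "u l \<noteq> 0" "\<rho> l = \<rho> l1"
      have "coord l v \<le> \<rho> l" unfolding \<rho>_def using nonneg[OF l(1)] by (intro member_le_sum) auto
      then show "of_nat N * coord l v \<in> \<int> \<and> 0 \<le> coord l v \<and> coord l v \<le> \<rho> l1"
        using int[OF l(1)] nonneg[OF l(1)] l(2) by auto
    qed
    show "finite {l :: 'a qvec. \<forall>v. of_nat N * coord l v \<in> \<int> \<and> 0 \<le> coord l v \<and> coord l v \<le> \<rho> l1}"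
      using N by (rule finite_lattice_box)
  qed
  then obtain l where l: "is_lowest \<rho> {l. u l \<noteq> 0} l"
    using is_lowest_exists[of l1 "{l. u l \<noteq> 0}" \<rho>] l1 min by blast
  obtain k where k: "is_lowest \<rho> (keys D) k"
    using is_lowest_exists_finite[of "keys D" \<rho>] \<open>D \<noteq> 0\<close> by auto
  have "conv D u (k + l) = lookup D k * u l"
    using add k l by (rule conv_lowest)
  moreover have "lookup D k \<noteq> 0" "u l \<noteq> 0"
    using k l by (auto simp: is_lowest_def in_keys_iff)
  ultimately show False using assms(1) by simp
qed

text \<open>The difference of two expansions is annihilated by the product of the denominators.\<close>

lemma taylor_at_origin_unique:
  assumes "taylor_at_origin s q" "taylor_at_origin s' q"
  shows "s = s'"
proof -
  obtain n d where 1: "d \<noteq> 0" "q = Fract n d" "conv d s = lookup n"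
    using assms(1) unfolding taylor_at_origin_def represents_iff by blast
  obtain n' d' where 2: "d' \<noteq> 0" "q = Fract n' d'" "conv d' s' = lookup n'"
    using assms(2) unfolding taylor_at_origin_def represents_iff by blast
  obtain N N' :: nat where N: "0 < N" "\<And>l v. s l \<noteq> 0 \<Longrightarrow> of_nat N * coord l v \<in> \<int>"
    and N': "0 < N'" "\<And>l v. s' l \<noteq> 0 \<Longrightarrow> of_nat N' * coord l v \<in> \<int>"
    using assms unfolding taylor_at_origin_def common_denominator_def by blast
  have "n * d' = n' * d" using 1 2 by (simp add: eq_fract)
  then have "d' * n = d * n'" by (simp add: mult.commute)
  then have "conv (d' * d) s = conv (d * d') s'"
    unfolding conv_mult 1(3) 2(3) conv_lookup by simp
  define u where "u = (\<lambda>l. s l - s' l)"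
  have conv: "conv (d * d') u = (\<lambda>_. 0)"
    using \<open>conv (d' * d) s = conv (d * d') s'\<close>
    by (intro ext) (simp add: u_def conv_diff_right mult.commute)
  have int: "of_nat (N * N') * coord l v \<in> \<int>" if "u l \<noteq> 0" for l v
  proof (cases "s l = 0")
    case True
    then have "of_nat N' * coord l v \<in> \<int>" using that N'(2)[of l v] by (simp add: u_def)
    then have "of_nat N * (of_nat N' * coord l v) \<in> \<int>" by (rule Ints_mult[OF Ints_of_nat])
    then show ?thesis by (simp add: mult_ac)
  next
    case False
    then have "of_nat N * coord l v \<in> \<int>" by (rule N(2))
    then have "of_nat N' * (of_nat N * coord l v) \<in> \<int>" by (rule Ints_mult[OF Ints_of_nat])
    then show ?thesis by (simp add: mult_ac)
  qed
  have nonneg: "0 \<le> coord l v" if "u l \<noteq> 0" for l v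
    using assms that unfolding taylor_at_origin_def by (cases "s l = 0") (auto simp: u_def)
  have "d * d' \<noteq> 0" "0 < N * N'" using 1(1) 2(1) N(1) N'(1) by auto
  then have "u = (\<lambda>_. 0)"
    by (rule conv_eq_0[OF conv _ _ int nonneg])
  then show ?thesis by (simp add: u_def fun_eq_iff)
qed

definition top_coord :: "'v::finite \<Rightarrow> 'v qpoly \<Rightarrow> rat" where
  "top_coord i p = Max ((\<lambda>c. coord c i) ` keys p)"

lemma top_coord_ge: "c \<in> keys p \<Longrightarrow> coord c i \<le> top_coord i p"
  unfolding top_coord_def by (rule Max_ge) auto

lemma top_coord_attained:
  assumes "p \<noteq> 0"
  obtains c where "c \<in> keys p" "coord c i = top_coord i p"
proof -
  have "top_coord i p \<in> (\<lambda>c. coord c i) ` keys p"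
    unfolding top_coord_def using assms by (intro Max_in) auto
  then show ?thesis using that by auto
qed

lemma top_coord_eqI:
  assumes "c \<in> keys p" "\<And>x. x \<in> keys p \<Longrightarrow> coord x i \<le> coord c i"
  shows "top_coord i p = coord c i"
  unfolding top_coord_def using assms by (intro Max_eqI) auto

text \<open>Degrees add because the terms that are lowest for the negative coordinate do not cancel.\<close>

lemma top_coord_mult:
  assumes "p \<noteq> 0" "q \<noteq> 0"
  shows "top_coord i (p * q) = top_coord i p + top_coord i q"
proof -
  define \<rho> where "\<rho> = (\<lambda>l :: 'a qvec. - coord l i)"
  obtain k where k: "is_lowest \<rho> (keys p) k"
    using is_lowest_exists_finite[of "keys p" \<rho>] assms by auto
  obtain l where l: "is_lowest \<rho> (keys q) l"
    using is_lowest_exists_finite[of "keys q" \<rho>] assms by auto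
  have "lookup (p * q) (k + l) = lookup p k * lookup q l"
    unfolding conv_lookup[symmetric] using k l
    by (intro conv_lowest[of \<rho>]) (auto simp: \<rho>_def keys.rep_eq)
  then have "k + l \<in> keys (p * q)"
    using k l by (auto simp: is_lowest_def in_keys_iff)
  moreover have kl: "coord x i \<le> coord k i" if "x \<in> keys p" for x
    using k that by (auto simp: is_lowest_def \<rho>_def)
  moreover have ll: "coord x i \<le> coord l i" if "x \<in> keys q" for x
    using l that by (auto simp: is_lowest_def \<rho>_def)
  ultimately have "top_coord i (p * q) = coord (k + l) i"
    by (intro top_coord_eqI) (auto elim!: keys_multE intro!: add_mono)
  also have "\<dots> = top_coord i p + top_coord i q"
    using k l kl ll by (simp add: top_coord_eqI[of k p] top_coord_eqI[of l q] is_lowest_def)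
  finally show ?thesis .
qed

lemma top_coord_one [simp]: "top_coord i 1 = 0"
  by (simp add: top_coord_def)

lemma poly_degree_eq:
  assumes "p \<noteq> 0"
  shows "poly_degree i p = ereal (of_rat (top_coord i p))"
proof -
  obtain c where c: "c \<in> keys p" "coord c i = top_coord i p"
    using top_coord_attained[OF assms] .
  show ?thesis
    unfolding poly_degree_def
  proof (rule antisym)
    show "(SUP c\<in>keys p. ereal (of_rat (coord c i))) \<le> ereal (of_rat (top_coord i p))"
      by (rule SUP_least) (simp add: top_coord_ge of_rat_less_eq)
    show "ereal (of_rat (top_coord i p)) \<le> (SUP c\<in>keys p. ereal (of_rat (coord c i)))"
      using c by (intro SUP_upper2[of c]) auto
  qed
qed

lemma poly_degree_zero: "poly_degree i 0 = - \<infinity>"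
  by (simp add: poly_degree_def bot_ereal_def)

lemma rat_degree_Fract:
  assumes "d \<noteq> 0"
  shows "rat_degree i (Fract n d) = poly_degree i n - poly_degree i d"
  unfolding rat_degree_def
proof (rule the_equality)
  show "\<exists>n' d'. d' \<noteq> 0 \<and> Fract n d = Fract n' d' \<and>
      poly_degree i n - poly_degree i d = poly_degree i n' - poly_degree i d'"
    using assms by blast
next
  fix e assume "\<exists>n' d'. d' \<noteq> 0 \<and> Fract n d = Fract n' d' \<and> e = poly_degree i n' - poly_degree i d'"
  then obtain n' d' where 1: "d' \<noteq> 0" "Fract n d = Fract n' d'"
    and e: "e = poly_degree i n' - poly_degree i d'" by blast
  have eq: "n * d' = n' * d" using 1 assms by (simp add: eq_fract)
  show "e = poly_degree i n - poly_degree i d"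
  proof (cases "n = 0")
    case True
    then have "n' = 0" using eq assms by simp
    then show ?thesis using True assms 1 e by (simp add: poly_degree_eq poly_degree_zero)
  next
    case False
    then have "n' \<noteq> 0" using eq 1 by auto
    have "top_coord i n + top_coord i d' = top_coord i n' + top_coord i d"
      using eq False 1 assms \<open>n' \<noteq> 0\<close> top_coord_mult by metis
    then have "top_coord i n' - top_coord i d' = top_coord i n - top_coord i d"
      by (simp add: algebra_simps)
    then show ?thesis using False \<open>n' \<noteq> 0\<close> assms 1 e
      by (simp add: poly_degree_eq flip: of_rat_diff)
  qed
qed

text \<open>
  Comparing each exponent of the numerator with the degree of the denominator also covers the
  zero function.
\<close>

lemma rat_degree_neg_iff:
  assumes "d \<noteq> 0"
  shows "rat_degree i (Fract n d) < 0 \<longleftrightarrow> (\<forall>k\<in>keys n. coord k i < top_coord i d)"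
proof (cases "n = 0")
  case True
  then show ?thesis using assms by (simp add: rat_degree_Fract poly_degree_eq poly_degree_zero)
next
  case False
  have "rat_degree i (Fract n d) < 0 \<longleftrightarrow> top_coord i n < top_coord i d"
    using False assms
    by (simp add: rat_degree_Fract poly_degree_eq of_rat_less flip: of_rat_diff zero_ereal_def)
  also have "\<dots> \<longleftrightarrow> (\<forall>k\<in>keys n. coord k i < top_coord i d)"
  proof
    show "\<forall>k\<in>keys n. coord k i < top_coord i d" if "top_coord i n < top_coord i d"
      using that top_coord_ge[of _ n i] by (auto intro: order.strict_trans1)
    show "top_coord i n < top_coord i d" if "\<forall>k\<in>keys n. coord k i < top_coord i d"
      using that top_coord_attained[OF False, of i] by metis
  qed
  finally show ?thesis .
qed

lemma rat_degree_neg_zero: "rat_degree i 0 < 0"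
  using rat_degree_neg_iff[of 1 i 0] by (simp add: Zero_fract_def)

lemma rat_degree_neg_of_poly:
  "rat_degree i (of_poly P) < 0 \<longleftrightarrow> (\<forall>k\<in>keys P. coord k i < 0)"
  using rat_degree_neg_iff[of 1 i P] by (simp add: of_poly_def)

lemma rat_degree_neg_add:
  assumes "rat_degree i q < 0" "rat_degree i q' < 0"
  shows "rat_degree i (q + q') < 0"
proof -
  obtain n d where q: "q = Fract n d" "d \<noteq> 0" by (cases q rule: Fract_cases)
  obtain n' d' where q': "q' = Fract n' d'" "d' \<noteq> 0" by (cases q' rule: Fract_cases)
  have dd: "top_coord i (d * d') = top_coord i d + top_coord i d'"
    using q(2) q'(2) by (rule top_coord_mult)
  have n: "coord a i < top_coord i d" if "a \<in> keys n" for a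
    using assms(1) that unfolding q(1) rat_degree_neg_iff[OF q(2)] by blast
  have n': "coord a i < top_coord i d'" if "a \<in> keys n'" for a
    using assms(2) that unfolding q'(1) rat_degree_neg_iff[OF q'(2)] by blast
  have "coord k i < top_coord i (d * d')" if "k \<in> keys (n * d' + n' * d)" for k
  proof -
    have "k \<in> keys (n * d') \<or> k \<in> keys (n' * d)"
      using that keys_add[of "n * d'" "n' * d"] by auto
    then show ?thesis
    proof
      assume "k \<in> keys (n * d')"
      then obtain a b where "a \<in> keys n" "b \<in> keys d'" "k = a + b"
        by (rule keys_multE)
      then show ?thesis using n[of a] top_coord_ge[of b d' i] unfolding dd by simp
    next
      assume "k \<in> keys (n' * d)"
      then obtain a b where "a \<in> keys n'" "b \<in> keys d" "k = a + b"
        by (rule keys_multE)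
      then show ?thesis using n'[of a] top_coord_ge[of b d i] unfolding dd by simp
    qed
  qed
  moreover have "q + q' = Fract (n * d' + n' * d) (d * d')"
    using q q' by simp
  ultimately show ?thesis using q(2) q'(2) by (simp add: rat_degree_neg_iff)
qed

lemma rat_degree_neg_uminus:
  assumes "rat_degree i q < 0"
  shows "rat_degree i (- q) < 0"
proof -
  obtain n d where "q = Fract n d" "d \<noteq> 0" by (cases q rule: Fract_cases)
  then show ?thesis using assms by (simp add: rat_degree_neg_iff keys.rep_eq)
qed

lemma rat_degree_neg_sum:
  "(\<And>a. a \<in> A \<Longrightarrow> rat_degree i (f a) < 0) \<Longrightarrow> rat_degree i (\<Sum>a\<in>A. f a) < 0"
  by (induction A rule: infinite_finite_induct) (auto simp: rat_degree_neg_zero rat_degree_neg_add)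

text \<open>
  Each exponent of the numerator \<open>d s\<close> is an exponent of the denominator \<open>d\<close> plus one of \<open>s\<close>,
  so it stays below the degree of \<open>d\<close>.
\<close>

lemma rat_degree_neg_represents:
  assumes "represents s q" "\<And>l. s l \<noteq> 0 \<Longrightarrow> coord l i < 0"
  shows "rat_degree i q < 0"
proof -
  obtain n d where 1: "d \<noteq> 0" "q = Fract n d" "conv d s = lookup n"
    using assms(1) unfolding represents_iff by blast
  have "coord l i < top_coord i d" if "l \<in> keys n" for l
  proof -
    have "conv d s l \<noteq> 0" using that 1(3) by (simp add: in_keys_iff)
    then obtain k where k: "k \<in> keys d" "s (l - k) \<noteq> 0" by (rule conv_nonzeroE)
    then show ?thesis using assms(2)[OF k(2)] top_coord_ge[OF k(1), of i] by simp
  qed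
  then show ?thesis using 1 by (simp add: rat_degree_neg_iff)
qed

section \<open>Setting variables to 1\<close>

lemma restr_add: "restr I (x + y) = restr I x + restr I y"
  and restr_diff: "restr I (x - y) = restr I x - restr I y"
  and restr_zero [simp]: "restr I 0 = 0"
  and restr_restr [simp]: "restr I (restr I x) = restr I x"
  by (auto simp: qvec_eq_iff)

lemma reduce_poly_superset:
  assumes "finite A" "keys p \<subseteq> A"
  shows "reduce_poly I p = (\<Sum>c\<in>A. single (restr I c) (lookup p c))"
  unfolding reduce_poly_def using assms by (intro sum.mono_neutral_left) (auto simp: in_keys_iff)

lemma reduce_poly_zero [simp]: "reduce_poly I 0 = 0"
  by (simp add: reduce_poly_def)

lemma reduce_poly_single [simp]:
  "reduce_poly I (single k c) = single (restr I k) c"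
  by (subst reduce_poly_superset[of "{k}"]) auto

lemma reduce_poly_one [simp]: "reduce_poly I 1 = 1"
  using reduce_poly_single[of I 0 1] by simp

lemma reduce_poly_add: "reduce_poly I (p + q) = reduce_poly I p + reduce_poly I q"
proof -
  let ?A = "keys p \<union> keys q"
  have "reduce_poly I (p + q) = (\<Sum>c\<in>?A. single (restr I c) (lookup (p + q) c))"
    by (rule reduce_poly_superset) (auto simp: keys_add)
  then show ?thesis
    by (simp add: reduce_poly_superset[of ?A] lookup_add single_add sum.distrib)
qed

lemma reduce_poly_diff: "reduce_poly I (p - q) = reduce_poly I p - reduce_poly I q"
  using reduce_poly_add[of I "p - q" q] by simp

lemma reduce_poly_single_mult:
  "reduce_poly I (single k c * q) = single (restr I k) c * reduce_poly I q"
  by (induction q rule: poly_induct) (auto simp: mult_single restr_add reduce_poly_add algebra_simps)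

lemma reduce_poly_mult: "reduce_poly I (p * q) = reduce_poly I p * reduce_poly I q"
  by (induction p rule: poly_induct) (auto simp: reduce_poly_add reduce_poly_single_mult distrib_right)

lemma reduce_poly_prod: "reduce_poly I (prod f A) = (\<Prod>a\<in>A. reduce_poly I (f a))"
  by (induction A rule: infinite_finite_induct) (auto simp: reduce_poly_mult)

lemma reduce_poly_power: "reduce_poly I (p ^ n) = reduce_poly I p ^ n"
  by (induction n) (auto simp: reduce_poly_mult)

lemma keys_reduce_poly: "keys (reduce_poly I p) \<subseteq> restr I ` keys p"
proof
  fix c assume "c \<in> keys (reduce_poly I p)"
  then have "(\<Sum>k\<in>keys p. lookup (single (restr I k) (lookup p k)) c) \<noteq> 0"
    by (simp add: reduce_poly_def in_keys_iff lookup_sum)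
  then obtain k where "k \<in> keys p"
    "lookup (single (restr I k) (lookup p k)) c \<noteq> 0"
    using sum.not_neutral_contains_not_neutral by blast
  then show "c \<in> restr I ` keys p" by (auto simp: lookup_single when_def split: if_splits)
qed

lemma reduce_poly_in: "reduce_poly I p \<in> polys_in I"
  using keys_reduce_poly[of I p] unfolding polys_in_def by force

lemma reduce_rat_Fract:
  assumes "reduce_poly I d \<noteq> 0"
  shows "reduce_rat I (Fract n d) = Fract (reduce_poly I n) (reduce_poly I d)"
  unfolding reduce_rat_def
proof (rule the_equality)
  have "d \<noteq> 0" using assms by auto
  then show "\<exists>n' d'. d' \<noteq> 0 \<and> Fract n d = Fract n' d' \<and> reduce_poly I d' \<noteq> 0 \<and>
     Fract (reduce_poly I n) (reduce_poly I d) = Fract (reduce_poly I n') (reduce_poly I d')"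
    using assms by blast
  fix r assume "\<exists>n' d'. d' \<noteq> 0 \<and> Fract n d = Fract n' d' \<and> reduce_poly I d' \<noteq> 0 \<and>
     r = Fract (reduce_poly I n') (reduce_poly I d')"
  then obtain n' d' where 1: "d' \<noteq> 0" "Fract n d = Fract n' d'" "reduce_poly I d' \<noteq> 0"
    and r: "r = Fract (reduce_poly I n') (reduce_poly I d')" by blast
  have "n * d' = n' * d" using 1 \<open>d \<noteq> 0\<close> by (simp add: eq_fract)
  then have "reduce_poly I n * reduce_poly I d' = reduce_poly I n' * reduce_poly I d"
    by (metis reduce_poly_mult)
  then show "r = Fract (reduce_poly I n) (reduce_poly I d)"
    using r 1 assms by (simp add: eq_fract)
qed

text \<open>The condition under which the variables of a series may be set to 1.\<close>

definition reducible :: "'v set \<Rightarrow> 'v series \<Rightarrow> bool" where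
  "reducible I s \<longleftrightarrow> (\<forall>c. finite {l. s l \<noteq> 0 \<and> restr I l = c})"

lemma reduce_series_superset:
  assumes "finite A" "{l. s l \<noteq> 0 \<and> restr I l = c} \<subseteq> A" "\<And>l. l \<in> A \<Longrightarrow> restr I l = c"
  shows "reduce_series I s c = sum s A"
  unfolding reduce_series_def using assms by (intro sum.mono_neutral_left) auto

lemma reduce_series_lookup: "reduce_series I (lookup p) = lookup (reduce_poly I p)"
proof (rule ext)
  fix c
  have "lookup (reduce_poly I p) c
      = (\<Sum>k\<in>keys p. if restr I k = c then lookup p k else 0)"
    unfolding reduce_poly_def lookup_sum by (intro sum.cong refl) (simp add: lookup_single when_def)
  also have "\<dots> = (\<Sum>k | k \<in> keys p \<and> restr I k = c. lookup p k)"
    by (simp add: sum.inter_filter)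
  also have "{k. k \<in> keys p \<and> restr I k = c} = {l. lookup p l \<noteq> 0 \<and> restr I l = c}"
    by (auto simp: in_keys_iff)
  finally show "reduce_series I (lookup p) c = lookup (reduce_poly I p) c"
    by (simp add: reduce_series_def)
qed

lemma reduce_series_add:
  assumes "reducible I s" "reducible I s'"
  shows "reduce_series I (\<lambda>l. s l + s' l) c = reduce_series I s c + reduce_series I s' c"
proof -
  let ?A = "{l. s l \<noteq> 0 \<and> restr I l = c} \<union> {l. s' l \<noteq> 0 \<and> restr I l = c}"
  have fin: "finite ?A" using assms by (simp add: reducible_def)
  have "reduce_series I (\<lambda>l. s l + s' l) c = (\<Sum>l\<in>?A. s l + s' l)"
    by (rule reduce_series_superset[OF fin]) auto
  moreover have "reduce_series I s c = sum s ?A" "reduce_series I s' c = sum s' ?A"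
    by (rule reduce_series_superset[OF fin]; auto)+
  ultimately show ?thesis by (simp add: sum.distrib)
qed

lemma reducible_conv:
  assumes "reducible I s"
  shows "reducible I (conv p s)"
  unfolding reducible_def
proof
  fix c
  have "{l. conv p s l \<noteq> 0 \<and> restr I l = c}
      \<subseteq> (\<Union>k\<in>keys p. (+) k ` {l. s l \<noteq> 0 \<and> restr I l = c - restr I k})"
  proof clarify
    fix l assume "conv p s l \<noteq> 0" "c = restr I l"
    then obtain k where "k \<in> keys p" "s (l - k) \<noteq> 0" using conv_nonzeroE by blast
    then show "l \<in> (\<Union>k\<in>keys p. (+) k ` {l'. s l' \<noteq> 0 \<and> restr I l' = restr I l - restr I k})"
      by (intro UN_I[of k] image_eqI[of _ _ "l - k"]) (auto simp: restr_diff)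
  qed
  then show "finite {l. conv p s l \<noteq> 0 \<and> restr I l = c}"
    by (rule finite_subset) (use assms in \<open>auto simp: reducible_def\<close>)
qed

lemma reduce_series_single:
  "reduce_series I (conv (single k a) s) c = a * reduce_series I s (c - restr I k)"
proof (cases "a = 0")
  case True
  then show ?thesis by (simp add: reduce_series_def)
next
  case False
  have "reduce_series I (conv (single k a) s) c
      = (\<Sum>l | s (l - k) \<noteq> 0 \<and> restr I l = c. a * s (l - k))"
    using False by (simp add: reduce_series_def)
  also have "\<dots> = (\<Sum>l | s l \<noteq> 0 \<and> restr I l = c - restr I k. a * s l)"
    by (rule sum.reindex_bij_witness[of _ "\<lambda>l. l + k" "\<lambda>l. l - k"]) (auto simp: restr_diff restr_add)
  finally show ?thesis by (simp only: reduce_series_def sum_distrib_left)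
qed

lemma reduce_series_conv:
  assumes "reducible I s"
  shows "reduce_series I (conv p s) c = conv (reduce_poly I p) (reduce_series I s) c"
proof (induction p arbitrary: c rule: poly_induct)
  case zero
  show ?case by (simp only: reduce_poly_zero conv_zero) (simp add: reduce_series_def)
next
  case (single k a)
  show ?case by (subst reduce_series_single) (simp only: reduce_poly_single conv_single)
next
  case (add p q)
  have "conv (p + q) s = (\<lambda>l. conv p s l + conv q s l)" by (simp add: conv_add fun_eq_iff)
  then show ?case
    using add reducible_conv[OF assms] by (simp add: reduce_series_add reduce_poly_add conv_add)
qed

lemma reduce_series_nonzeroE:
  assumes "reduce_series I s c \<noteq> 0"
  obtains l where "s l \<noteq> 0" "c = restr I l"
proof -
  obtain l where "l \<in> {l. s l \<noteq> 0 \<and> restr I l = c}"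
    using assms sum.not_neutral_contains_not_neutral[of s "{l. s l \<noteq> 0 \<and> restr I l = c}"]
    unfolding reduce_series_def by blast
  then show ?thesis using that by blast
qed

text \<open>Setting variables to 1 is compatible with passing from a rational function to an expansion.\<close>

lemma represents_reduce:
  assumes "conv d s = lookup n" "reducible I s" "reduce_poly I d \<noteq> 0"
  shows "represents (reduce_series I s) (Fract (reduce_poly I n) (reduce_poly I d))"
proof (rule representsI[OF assms(3)])
  have "conv (reduce_poly I d) (reduce_series I s) = reduce_series I (conv d s)"
    using assms(2) by (simp add: reduce_series_conv fun_eq_iff)
  then show "conv (reduce_poly I d) (reduce_series I s) = lookup (reduce_poly I n)"
    by (simp add: assms(1) reduce_series_lookup)
qed

section \<open>The series of the graph and its reflection\<close>

lemma mon_mult: "mon a * mon b = mon (a + b)"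
  by (simp add: mon_def mult_single)

lemma mon_zero [simp]: "mon 0 = 1"
  by (simp add: mon_def)

lemma mon_eq_1_iff: "mon a = 1 \<longleftrightarrow> a = 0"
proof
  assume "mon a = 1"
  then have "keys (mon a) = keys 1" by simp
  then show "a = 0" by (simp add: mon_def)
qed simp

lemma one_minus_mon_neq_0: "a \<noteq> 0 \<Longrightarrow> 1 - mon a \<noteq> 0"
  using mon_eq_1_iff[of a] by auto

lemma keys_one_minus_mon: "keys (1 - mon a) \<subseteq> {0, a}"
proof
  fix k assume "k \<in> keys (1 - mon a)"
  then show "k \<in> {0, a}"
    by (auto simp: in_keys_iff lookup_minus lookup_one mon_def lookup_single when_def split: if_splits)
qed

lemma mon_qscale: "mon (qscale (of_nat n) a) = mon a ^ n"
proof (induction n)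
  case 0
  have "qscale 0 a = 0" by (simp add: qvec_eq_iff)
  then show ?case by simp
next
  case (Suc n)
  have "qscale (of_nat (Suc n)) a = a + qscale (of_nat n) a"
    by (simp add: qvec_eq_iff algebra_simps)
  then show ?case using Suc by (simp flip: mon_mult)
qed

lemma one_minus_mon_dvd: "1 - mon a dvd 1 - mon (qscale (of_nat n) a)"
  unfolding mon_qscale by (simp add: one_diff_power_eq)

lemma conv_one_minus_mon: "conv (1 - mon a) s l = s l - s (l - a)"
  by (simp add: conv_diff mon_def)

lemma of_poly_mult: "of_poly (p * q) = of_poly p * of_poly q"
  and of_poly_one [simp]: "of_poly 1 = 1"
  and of_poly_zero [simp]: "of_poly 0 = 0"
  and of_poly_diff: "of_poly (p - q) = of_poly p - of_poly q"
  and of_poly_uminus: "of_poly (- p) = - of_poly p"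
  by (simp_all add: of_poly_def One_fract_def Zero_fract_def)

lemma of_poly_power: "of_poly (p ^ n) = of_poly p ^ n"
  by (induction n) (auto simp: of_poly_mult)

lemma of_poly_prod: "of_poly (prod f A) = (\<Prod>a\<in>A. of_poly (f a))"
  by (induction A rule: infinite_finite_induct) (auto simp: of_poly_mult)

lemma of_poly_eq_0_iff [simp]: "of_poly p = 0 \<longleftrightarrow> p = 0"
  by (simp add: of_poly_def Zero_fract_def eq_fract)

lemma Fract_of_poly: "d \<noteq> 0 \<Longrightarrow> Fract n d = of_poly n / of_poly d"
  by (simp add: of_poly_def)

lemma keys_diff_subset: "keys (p - q) \<subseteq> keys p \<union> keys q"
  by (auto simp: in_keys_iff lookup_minus)

lemma keys_mult_closed:
  assumes "\<And>x y. x \<in> M \<Longrightarrow> y \<in> M \<Longrightarrow> x + y \<in> M"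
    and "keys p \<subseteq> M" "keys q \<subseteq> M"
  shows "keys (p * q) \<subseteq> M"
  using assms by (auto elim!: keys_multE)

lemma keys_prod_closed:
  fixes f :: "'a \<Rightarrow> 'v::finite qpoly"
  assumes "0 \<in> M" "\<And>x y. x \<in> M \<Longrightarrow> y \<in> M \<Longrightarrow> x + y \<in> M" "\<And>a. a \<in> A \<Longrightarrow> keys (f a) \<subseteq> M"
  shows "keys (prod f A) \<subseteq> M"
  using assms(3)
proof (induction A rule: infinite_finite_induct)
  case (insert a A)
  then show ?case by (simp add: keys_mult_closed[OF assms(2)])
qed (use assms(1) in auto)

lemma poly_of_finite_support:
  fixes f :: "'v qvec \<Rightarrow> int"
  assumes "finite {l. f l \<noteq> 0}"
  obtains p where "lookup p = f"
  using lookup_Abs_poly_mapping[OF assms] by blast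

lemma latL_zero [simp]: "0 \<in> latL"
  and latL_add: "x \<in> latL \<Longrightarrow> y \<in> latL \<Longrightarrow> x + y \<in> latL"
  and latL_diff: "x \<in> latL \<Longrightarrow> y \<in> latL \<Longrightarrow> x - y \<in> latL"
  and latL_uminus: "x \<in> latL \<Longrightarrow> - x \<in> latL"
  by (auto simp: latL_def)

lemma cls_eq_iff: "cls x = cls y \<longleftrightarrow> x - y \<in> latL"
proof
  assume "cls x = cls y"
  moreover have "x \<in> cls x" by (auto simp: cls_def intro: exI[of _ 0])
  ultimately obtain l where "x = y + l" "l \<in> latL" by (auto simp: cls_def)
  then show "x - y \<in> latL" by simp
next
  have sub: "cls x \<subseteq> cls y" if "x - y \<in> latL" for x y :: "'a qvec"
  proof
    fix z assume "z \<in> cls x"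
    then obtain l where "z = x + l" "l \<in> latL" by (auto simp: cls_def)
    then have "z = y + (x - y + l)" "x - y + l \<in> latL" using that by (auto intro: latL_add)
    then show "z \<in> cls y" unfolding cls_def by blast
  qed
  assume "x - y \<in> latL"
  then show "cls x = cls y" using sub[of x y] sub[of y x] latL_uminus[of "x - y"] by auto
qed

lemma conv_class_part:
  assumes "keys d \<subseteq> latL"
  shows "conv d (\<lambda>l. if cls l = h then s l else 0) l = (if cls l = h then conv d s l else 0)"
proof -
  have "cls (l - k) = cls l" if "k \<in> keys d" for k
    using assms that by (auto simp: cls_eq_iff intro: latL_uminus)
  then show ?thesis unfolding conv_def by (auto intro!: sum.cong sum.neutral)
qed

text \<open>Multiplication by \<open>1 - x\<close>, on sequences of coefficients.\<close>

definition backward_diff :: "(int \<Rightarrow> int) \<Rightarrow> int \<Rightarrow> int" where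
  "backward_diff c k = c k - c (k - 1)"

definition unit_seq :: "int \<Rightarrow> int" where
  "unit_seq k = (if k = 0 then 1 else 0)"

text \<open>
  The coefficients of \<open>(1 - x)\<^sup>n\<^sup>-\<^sup>2\<close>: the sequence that starts with 1, 2, 3 belongs to
  \<open>(1 - x)\<^sup>-\<^sup>2\<close>.
\<close>

definition vertex_coeff :: "nat \<Rightarrow> int \<Rightarrow> int" where
  "vertex_coeff n = (backward_diff ^^ n) (\<lambda>k. if 0 \<le> k then k + 1 else 0)"

lemma backward_diff_vertex_coeff: "(backward_diff ^^ 2) (vertex_coeff n) = (backward_diff ^^ n) unit_seq"
proof -
  have "(backward_diff ^^ 2) (\<lambda>k. if 0 \<le> k then k + 1 else 0) = unit_seq"
    by (auto simp: numeral_2_eq_2 backward_diff_def unit_seq_def fun_eq_iff)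
  moreover have "(backward_diff ^^ (2 + n)) G = (backward_diff ^^ (n + 2)) G" for G
    by (simp only: add.commute)
  then have "(backward_diff ^^ 2) ((backward_diff ^^ n) G) = (backward_diff ^^ n) ((backward_diff ^^ 2) G)" for G
    by (simp only: funpow_add comp_apply)
  ultimately show ?thesis
    unfolding vertex_coeff_def by (simp only:)
qed

lemma vertex_coeff_neg: "k < 0 \<Longrightarrow> vertex_coeff n k = 0"
proof (induction n arbitrary: k)
  case (Suc n)
  then show ?case by (simp add: vertex_coeff_def backward_diff_def)
qed (simp add: vertex_coeff_def)

text \<open>The symmetry of the binomial coefficients, with signs.\<close>

lemma backward_diff_unit_reflect: "(backward_diff ^^ n) unit_seq (int n - k) = (-1) ^ n * (backward_diff ^^ n) unit_seq k"
proof (induction n arbitrary: k)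
  case (Suc n)
  have step: "(backward_diff ^^ Suc n) unit_seq j = (backward_diff ^^ n) unit_seq j - (backward_diff ^^ n) unit_seq (j - 1)" for j
    by (simp add: backward_diff_def[of "(backward_diff ^^ n) unit_seq"])
  have "int (Suc n) - k = int n - (k - 1)" "int (Suc n) - k - 1 = int n - k" by simp_all
  then have "(backward_diff ^^ Suc n) unit_seq (int (Suc n) - k)
      = (backward_diff ^^ n) unit_seq (int n - (k - 1)) - (backward_diff ^^ n) unit_seq (int n - k)"
    by (simp only: step)
  also have "\<dots> = (-1) ^ n * ((backward_diff ^^ n) unit_seq (k - 1) - (backward_diff ^^ n) unit_seq k)"
    by (simp only: Suc right_diff_distrib)
  also have "\<dots> = (-1) ^ Suc n * (backward_diff ^^ Suc n) unit_seq k"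
    unfolding step by (simp add: algebra_simps)
  finally show ?case .
qed (simp add: unit_seq_def)

lemma backward_diff_reflect: "(backward_diff ^^ 2) (\<lambda>k. c (m - k)) k = (backward_diff ^^ 2) c (m + 2 - k)"
  by (simp add: numeral_2_eq_2 backward_diff_def algebra_simps)

context negdef_tree begin

text \<open>
  A series in the independent monomials \<open>t\<close> to the power \<open>E\<^sup>*\<^sub>v\<close> whose coefficients are products
  over the vertices. The sequences are indexed by all integers, so that expansions at
  infinity are covered as well.
\<close>

definition prod_series :: "('v \<Rightarrow> int \<Rightarrow> int) \<Rightarrow> 'v series" where
  "prod_series a l = (if \<forall>v. dual_coord l v \<in> \<int> then \<Prod>v\<in>UNIV. a v \<lfloor>dual_coord l v\<rfloor> else 0)"

text \<open>Multiplication by \<open>1 - t\<^bsup>E\<^sup>*\<^sub>v\<^esup>\<close> only acts on the factor of \<open>v\<close>.\<close>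

lemma conv_prod_series_step:
  "conv (1 - mon (Estar \<Gamma> v)) (prod_series a) = prod_series (a(v := backward_diff (a v)))"
proof (rule ext)
  fix l
  show "conv (1 - mon (Estar \<Gamma> v)) (prod_series a) l = prod_series (a(v := backward_diff (a v))) l"
  proof (cases "\<forall>w. dual_coord l w \<in> \<int>")
    case True
    have int: "dual_coord (l - Estar \<Gamma> v) w \<in> \<int>" for w using True by simp
    have prod: "(\<Prod>w\<in>UNIV. f w) = f v * (\<Prod>w\<in>UNIV - {v}. f w)" for f :: "'v \<Rightarrow> int"
      by (rule prod.remove) auto
    have "prod_series a (l - Estar \<Gamma> v) = a v (\<lfloor>dual_coord l v\<rfloor> - 1) * (\<Prod>w\<in>UNIV - {v}. a w \<lfloor>dual_coord l w\<rfloor>)"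
      using int unfolding prod_series_def prod by (auto intro!: prod.cong)
    moreover have "prod_series a l = a v \<lfloor>dual_coord l v\<rfloor> * (\<Prod>w\<in>UNIV - {v}. a w \<lfloor>dual_coord l w\<rfloor>)"
      using True unfolding prod_series_def prod by simp
    moreover have "prod_series (a(v := backward_diff (a v))) l = backward_diff (a v) \<lfloor>dual_coord l v\<rfloor> * (\<Prod>w\<in>UNIV - {v}. a w \<lfloor>dual_coord l w\<rfloor>)"
      using True unfolding prod_series_def prod by (auto intro!: prod.cong)
    ultimately show ?thesis
      by (simp add: conv_one_minus_mon backward_diff_def algebra_simps)
  next
    case False
    then obtain w where w: "dual_coord l w \<notin> \<int>" by blast
    have "dual_coord (l - Estar \<Gamma> v) w \<notin> \<int>"
    proof
      assume "dual_coord (l - Estar \<Gamma> v) w \<in> \<int>"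
      then have "dual_coord (l - Estar \<Gamma> v) w + dual_coord (Estar \<Gamma> v) w \<in> \<int>" by (intro Ints_add) auto
      then show False using w by simp
    qed
    then show ?thesis using w by (auto simp: conv_one_minus_mon prod_series_def)
  qed
qed

lemma conv_prod_series_power:
  "conv ((1 - mon (Estar \<Gamma> v)) ^ n) (prod_series a) = prod_series (a(v := (backward_diff ^^ n) (a v)))"
proof (induction n)
  case (Suc n)
  show ?case
    by (simp only: power_Suc conv_mult Suc conv_prod_series_step fun_upd_same fun_upd_upd funpow.simps comp_apply)
qed simp

lemma conv_prod_series_prod:
  "conv (\<Prod>v\<in>A. (1 - mon (Estar \<Gamma> v)) ^ n v) (prod_series a)
    = prod_series (\<lambda>v. if v \<in> A then (backward_diff ^^ n v) (a v) else a v)"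
proof (induction A rule: infinite_finite_induct)
  case (insert v A)
  have "conv (\<Prod>v\<in>insert v A. (1 - mon (Estar \<Gamma> v)) ^ n v) (prod_series a)
      = conv ((1 - mon (Estar \<Gamma> v)) ^ n v) (prod_series (\<lambda>v. if v \<in> A then (backward_diff ^^ n v) (a v) else a v))"
    using insert by (simp add: conv_mult)
  also have "\<dots> = prod_series (\<lambda>w. if w \<in> insert v A then (backward_diff ^^ n w) (a w) else a w)"
    unfolding conv_prod_series_power using insert(2) by (intro arg_cong[of _ _ prod_series]) auto
  finally show ?case .
qed auto

lemma prod_series_unit: "prod_series (\<lambda>_. unit_seq) = (\<lambda>l. if l = 0 then 1 else 0)"
proof (rule ext)
  fix l
  show "prod_series (\<lambda>_. unit_seq) l = (if l = 0 then 1 else 0)"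
  proof (cases "l = 0")
    case True
    then show ?thesis by (simp add: prod_series_def unit_seq_def)
  next
    case False
    then obtain v where v: "dual_coord l v \<noteq> 0" using dual_coord_inj[of l 0] by auto
    have "\<lfloor>dual_coord l v\<rfloor> \<noteq> 0" if "dual_coord l v \<in> \<int>" using that v by (auto elim!: Ints_cases)
    then have "(\<Prod>v\<in>UNIV. unit_seq \<lfloor>dual_coord l v\<rfloor>) = 0" if "dual_coord l v \<in> \<int>"
      using that by (intro prod_zero bexI[of _ v]) (auto simp: unit_seq_def)
    then show ?thesis using False by (auto simp: prod_series_def)
  qed
qed

text \<open>
  Numerator and denominator of \<open>f\<close> when \<open>(1 - t\<^bsup>E\<^sup>*\<^sub>v\<^esup>)\<^sup>2\<close> is put into the denominator for each
  vertex.
\<close>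

definition znum :: "'v qpoly" where
  "znum = (\<Prod>v\<in>UNIV. (1 - mon (Estar \<Gamma> v)) ^ valency \<Gamma> v)"

definition zden :: "'v qpoly" where
  "zden = (\<Prod>v\<in>UNIV. (1 - mon (Estar \<Gamma> v)) ^ 2)"

lemma lookup_znum: "lookup znum = prod_series (\<lambda>v. (backward_diff ^^ valency \<Gamma> v) unit_seq)"
  unfolding conv_delta[symmetric] prod_series_unit[symmetric] znum_def conv_prod_series_prod by simp

lemma Estar_neq_0: "Estar \<Gamma> v \<noteq> 0"
proof
  assume "Estar \<Gamma> v = 0"
  then have "dual_coord (Estar \<Gamma> v) v = 0" by (simp only: dual_coord_zero)
  then show False by simp
qed

lemma zden_neq_0: "zden \<noteq> 0"
  unfolding zden_def using one_minus_mon_neq_0[OF Estar_neq_0] by simp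

lemma zeta_Fract: "zeta \<Gamma> = Fract znum zden"
proof -
  have nz: "of_poly (1 - mon (Estar \<Gamma> v)) \<noteq> 0" for v
    using one_minus_mon_neq_0[OF Estar_neq_0] by simp
  have "zeta \<Gamma> = (\<Prod>v\<in>UNIV. of_poly (1 - mon (Estar \<Gamma> v)) ^ valency \<Gamma> v / of_poly (1 - mon (Estar \<Gamma> v)) ^ 2)"
    unfolding zeta_def
  proof (intro prod.cong refl)
    fix v
    let ?x = "of_poly (1 - mon (Estar \<Gamma> v))"
    have "?x powi (int (valency \<Gamma> v) - 2) = ?x powi int (valency \<Gamma> v) / ?x powi 2"
      using nz by (intro power_int_diff) auto
    then show "?x powi (int (valency \<Gamma> v) - 2) = ?x ^ valency \<Gamma> v / ?x ^ 2"
      by (simp add: power_int_def)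
  qed
  then show ?thesis
    unfolding Fract_of_poly[OF zden_neq_0] by (simp add: znum_def zden_def of_poly_prod of_poly_power prod_dividef)
qed

lemma conv_zden_prod_series:
  "conv zden (prod_series a) = prod_series (\<lambda>v. (backward_diff ^^ 2) (a v))"
  unfolding zden_def conv_prod_series_prod by simp

lemma prod_series_support: "prod_series (\<lambda>v. vertex_coeff (valency \<Gamma> v)) l \<noteq> 0 \<Longrightarrow> l \<in> monoidS \<Gamma>"
proof -
  assume nz: "prod_series (\<lambda>v. vertex_coeff (valency \<Gamma> v)) l \<noteq> 0"
  then have int: "dual_coord l v \<in> \<int>" for v by (auto simp: prod_series_def split: if_splits)
  have "vertex_coeff (valency \<Gamma> v) \<lfloor>dual_coord l v\<rfloor> \<noteq> 0" for v
    using nz by (auto simp: prod_series_def split: if_splits)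
  then have "0 \<le> \<lfloor>dual_coord l v\<rfloor>" for v using vertex_coeff_neg by (meson not_le)
  then show "l \<in> monoidS \<Gamma>" using int by (auto simp: monoidS_iff Nats_altdef2)
qed

lemma common_denominator_dual:
  obtains N :: nat where "0 < N" "\<And>l u. (\<And>v. dual_coord l v \<in> \<int>) \<Longrightarrow> of_nat N * coord l u \<in> \<int>"
proof -
  obtain N :: nat where N: "0 < N" "\<And>v u. of_nat N * coord (Estar \<Gamma> v) u \<in> \<int>"
    using common_denominator_qvec[of "Estar \<Gamma>"] by metis
  have "of_nat N * coord l u \<in> \<int>" if "\<And>v. dual_coord l v \<in> \<int>" for l u
  proof -
    have "of_nat N * coord l u = (\<Sum>v\<in>UNIV. dual_coord l v * (of_nat N * coord (Estar \<Gamma> v) u))"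
      by (subst coord_expansion) (simp add: sum_distrib_left mult_ac)
    also have "\<dots> \<in> \<int>" by (intro Ints_sum Ints_mult[OF that N(2)])
    finally show ?thesis .
  qed
  then show ?thesis using N that by blast
qed

text \<open>The series has \<open>f\<close> as sum and lies in \<open>\<S>'\<close>, so it is the Taylor expansion by uniqueness.\<close>

lemma zcoeff_prod_series: "zcoeff \<Gamma> = prod_series (\<lambda>v. vertex_coeff (valency \<Gamma> v))"
proof -
  let ?z = "prod_series (\<lambda>v. vertex_coeff (valency \<Gamma> v))"
  obtain N :: nat where N: "0 < N" "\<And>l u. (\<And>v. dual_coord l v \<in> \<int>) \<Longrightarrow> of_nat N * coord l u \<in> \<int>"
    using common_denominator_dual by blast
  have "taylor_at_origin ?z (zeta \<Gamma>)"
    unfolding taylor_at_origin_def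
  proof (intro conjI allI impI)
    show "represents ?z (zeta \<Gamma>)"
      unfolding zeta_Fract by (rule representsI[OF zden_neq_0]) (simp only: conv_zden_prod_series backward_diff_vertex_coeff lookup_znum)
    show "common_denominator ?z"
      unfolding common_denominator_def using N by (auto simp: prod_series_def split: if_splits)
    show "0 \<le> coord l v" if "?z l \<noteq> 0" for l v
      using prod_series_support[OF that] by (rule monoidS_nonneg)
  qed
  then show ?thesis
    unfolding zcoeff_def by (intro the_equality) (auto intro: taylor_at_origin_unique)
qed

lemma zcoeff_support: "zcoeff \<Gamma> l \<noteq> 0 \<Longrightarrow> l \<in> monoidS \<Gamma>"
  unfolding zcoeff_prod_series by (rule prod_series_support)

lemma zcoeff_prod:
  assumes "l \<in> dualL \<Gamma>"
  shows "zcoeff \<Gamma> l = (\<Prod>v\<in>UNIV. vertex_coeff (valency \<Gamma> v) \<lfloor>dual_coord l v\<rfloor>)"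
  using assms by (simp add: zcoeff_prod_series prod_series_def dualL_iff)

text \<open>The sum of the valencies is twice the number of edges.\<close>

lemma even_sum_valency: "even (\<Sum>v\<in>UNIV. valency \<Gamma> v)"
proof -
  define A where "A = {(v, w). adj \<Gamma> v w \<and> to_nat v < to_nat w}"
  define S where "S = {(v, w). adj \<Gamma> v w}"
  have "(v, w) \<in> A \<or> (w, v) \<in> A" if "adj \<Gamma> v w" for v w
  proof -
    show ?thesis
      using less_linear[of "to_nat v" "to_nat w"] that adj_sym adj_irrefl by (auto simp: A_def)
  qed
  then have "S = A \<union> prod.swap ` A"
    using adj_sym by (force simp: A_def S_def prod.swap_def image_iff)
  moreover have "A \<inter> prod.swap ` A = {}" by (auto simp: A_def)
  ultimately have "card S = card A + card (prod.swap ` A)"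
    by (simp add: card_Un_disjoint)
  then have "card S = 2 * card A" by (simp add: card_image)
  moreover have "S = (SIGMA v:UNIV. {w. adj \<Gamma> v w})" by (auto simp: S_def)
  then have "card S = (\<Sum>v\<in>UNIV. valency \<Gamma> v)" by (simp add: valency_def)
  ultimately show ?thesis by simp
qed

text \<open>
  The reflection \<open>l \<mapsto> Z\<^sub>K - E - l\<close> turns the coefficients of \<open>(1 - x)\<^sup>\<delta>\<^sup>-\<^sup>2\<close> around, which
  changes the sign of \<open>(1 - x)\<^sup>\<delta>\<close> by \<open>(-1)\<^sup>\<delta>\<close>; altogether the signs cancel.
\<close>

lemma conv_zden_reflected: "conv zden (\<lambda>l. zcoeff \<Gamma> (ZK \<Gamma> - sumE - l)) = lookup znum"
proof -
  let ?a = "\<lambda>v k. vertex_coeff (valency \<Gamma> v) (int (valency \<Gamma> v) - 2 - k)"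
  have "(\<lambda>l. zcoeff \<Gamma> (ZK \<Gamma> - sumE - l)) = prod_series ?a"
  proof (rule ext)
    fix l
    have dual_coord: "dual_coord (ZK \<Gamma> - sumE - l) v = of_int (int (valency \<Gamma> v) - 2) - dual_coord l v" for v
      using dual_coord_ZK_sumE[of v] by simp
    have "dual_coord (ZK \<Gamma> - sumE - l) v \<in> \<int> \<longleftrightarrow> dual_coord l v \<in> \<int>" for v
    proof
      assume "dual_coord (ZK \<Gamma> - sumE - l) v \<in> \<int>"
      then have "of_int (int (valency \<Gamma> v) - 2) - dual_coord (ZK \<Gamma> - sumE - l) v \<in> \<int>" by (intro Ints_diff) auto
      then show "dual_coord l v \<in> \<int>" unfolding dual_coord by simp
    qed (auto simp: dual_coord simp del: dual_coord_diff)
    moreover have "\<lfloor>dual_coord (ZK \<Gamma> - sumE - l) v\<rfloor> = int (valency \<Gamma> v) - 2 - \<lfloor>dual_coord l v\<rfloor>" if "dual_coord l v \<in> \<int>" for v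
      using that unfolding dual_coord by (auto elim!: Ints_cases simp flip: of_int_diff simp del: of_int_diff)
    ultimately show "zcoeff \<Gamma> (ZK \<Gamma> - sumE - l) = prod_series ?a l"
      unfolding zcoeff_prod_series prod_series_def by (auto intro!: prod.cong)
  qed
  then have "conv zden (\<lambda>l. zcoeff \<Gamma> (ZK \<Gamma> - sumE - l)) = prod_series (\<lambda>v. (backward_diff ^^ 2) (?a v))"
    by (simp only: conv_zden_prod_series)
  also have "\<dots> = prod_series (\<lambda>v k. (-1) ^ valency \<Gamma> v * (backward_diff ^^ valency \<Gamma> v) unit_seq k)"
    by (intro arg_cong[of _ _ prod_series] ext) (simp only: backward_diff_reflect backward_diff_vertex_coeff diff_add_cancel backward_diff_unit_reflect)
  also have "\<dots> = (\<lambda>l. (-1) ^ (\<Sum>v\<in>UNIV. valency \<Gamma> v) * prod_series (\<lambda>v. (backward_diff ^^ valency \<Gamma> v) unit_seq) l)"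
    by (auto simp: prod_series_def fun_eq_iff prod.distrib power_sum)
  also have "\<dots> = lookup znum"
    using even_sum_valency by (simp add: lookup_znum)
  finally show ?thesis .
qed

lemma conv_zden_zcoeff: "conv zden (zcoeff \<Gamma>) = lookup znum"
  by (simp only: zcoeff_prod_series conv_zden_prod_series backward_diff_vertex_coeff lookup_znum)

lemma wcoeff_support: "wcoeff \<Gamma> h l \<noteq> 0 \<Longrightarrow> ZK \<Gamma> - sumE - l \<in> monoidS \<Gamma>"
  by (auto simp: wcoeff_def intro: zcoeff_support split: if_splits)

lemma Zh_support: "Zh \<Gamma> h l \<noteq> 0 \<Longrightarrow> l \<in> monoidS \<Gamma>"
  by (auto simp: Zh_def intro: zcoeff_support split: if_splits)

text \<open>
  With denominators in \<open>L\<close>, the classes in \<open>H\<close> do not mix, and the part of class \<open>h\<close> of the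
  numerator serves both expansions.
\<close>

lemma class_presentation:
  obtains N :: nat and n :: "'v qpoly"
    where "0 < N"
      "conv (\<Prod>v\<in>UNIV. (1 - mon (qscale (of_nat N) (Estar \<Gamma> v))) ^ 2) (Zh \<Gamma> h) = lookup n"
      "conv (\<Prod>v\<in>UNIV. (1 - mon (qscale (of_nat N) (Estar \<Gamma> v))) ^ 2) (wcoeff \<Gamma> h) = lookup n"
      "\<And>k v. k \<in> keys n \<Longrightarrow> 0 \<le> coord k v"
proof -
  obtain N :: nat where N: "0 < N" "\<And>v u. of_nat N * coord (Estar \<Gamma> v) u \<in> \<int>"
    using common_denominator_qvec[of "Estar \<Gamma>"] by metis
  define D where "D = (\<Prod>v\<in>UNIV. (1 - mon (qscale (of_nat N) (Estar \<Gamma> v))) ^ 2)"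
  have "zden dvd D"
    unfolding D_def zden_def by (intro prod_dvd_prod dvd_power_same one_minus_mon_dvd)
  then obtain g where g: "D = g * zden" by (metis dvd_def mult.commute)
  have keysD: "keys D \<subseteq> M"
    if M: "0 \<in> M" "\<And>x y. x \<in> M \<Longrightarrow> y \<in> M \<Longrightarrow> x + y \<in> M" "\<And>v. qscale (of_nat N) (Estar \<Gamma> v) \<in> M" for M
  proof -
    have *: "keys (1 - mon (qscale (of_nat N) (Estar \<Gamma> v))) \<subseteq> M" for v
      using keys_one_minus_mon[of "qscale (of_nat N) (Estar \<Gamma> v)"] M by auto
    have "keys ((1 - mon (qscale (of_nat N) (Estar \<Gamma> v))) ^ 2) \<subseteq> M" for v
      unfolding power2_eq_square using M(2) * * by (rule keys_mult_closed)
    then show ?thesis unfolding D_def using M by (intro keys_prod_closed)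
  qed
  have L: "keys D \<subseteq> latL"
    using N by (intro keysD) (auto simp: latL_def)
  let ?n = "lookup (g * znum)"
  have "finite {l. (if cls l = h then ?n l else 0) \<noteq> 0}"
    by (rule finite_subset[of _ "keys (g * znum)"]) (auto simp: in_keys_iff)
  then obtain n where n: "lookup n = (\<lambda>l. if cls l = h then ?n l else 0)"
    by (rule poly_of_finite_support)
  have "conv D (zcoeff \<Gamma>) = ?n" "conv D (\<lambda>l. zcoeff \<Gamma> (ZK \<Gamma> - sumE - l)) = ?n"
    by (simp_all only: g conv_mult conv_zden_zcoeff conv_zden_reflected conv_lookup)
  then have Z: "conv D (Zh \<Gamma> h) = lookup n"
    and W: "conv D (wcoeff \<Gamma> h) = lookup n"
    unfolding n Zh_def[abs_def] wcoeff_def[abs_def] by (auto simp: conv_class_part[OF L] fun_eq_iff)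
  have "0 \<le> coord k v" if "k \<in> keys n" for k v
  proof -
    have "conv D (Zh \<Gamma> h) k \<noteq> 0" using that by (simp add: Z in_keys_iff)
    then obtain j where j: "j \<in> keys D" "Zh \<Gamma> h (k - j) \<noteq> 0" by (rule conv_nonzeroE)
    have "keys D \<subseteq> {x. 0 \<le> coord x v}"
      by (rule keysD) (auto simp: Estar_nonneg)
    then have "0 \<le> coord j v" using j(1) by auto
    moreover have "0 \<le> coord (k - j) v" using Zh_support[OF j(2)] by (rule monoidS_nonneg)
    ultimately show ?thesis by simp
  qed
  then show ?thesis using N(1) Z W that unfolding D_def by blast
qed

lemma common_denominator_Zh: "common_denominator (Zh \<Gamma> h)"
proof -
  obtain N :: nat where N: "0 < N" "\<And>l u. (\<And>v. dual_coord l v \<in> \<int>) \<Longrightarrow> of_nat N * coord l u \<in> \<int>"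
    using common_denominator_dual by blast
  have "of_nat N * coord l u \<in> \<int>" if "Zh \<Gamma> h l \<noteq> 0" for l u
    using Zh_support[OF that] Nats_subset_Ints by (intro N(2)) (auto simp: monoidS_iff)
  then show ?thesis
    unfolding common_denominator_def using N(1) by blast
qed

text \<open>The Taylor expansion \<open>Z\<^sub>h\<close> determines \<open>f\<^sub>h\<close>, whatever the denominator.\<close>

lemma fh_eq:
  assumes "conv D (Zh \<Gamma> h) = lookup n" "D \<noteq> 0"
  shows "fh \<Gamma> h = Fract n D"
  unfolding fh_def
proof (rule the_equality)
  show "taylor_at_origin (Zh \<Gamma> h) (Fract n D)"
    unfolding taylor_at_origin_def
    using representsI[OF assms(2,1)] common_denominator_Zh monoidS_nonneg[OF Zh_support] by blast
  then show "q = Fract n D" if "taylor_at_origin (Zh \<Gamma> h) q" for q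
    using that represents_unique unfolding taylor_at_origin_def by blast
qed

text \<open>A fixed coordinate in \<open>I\<close> leaves only finitely many elements of \<open>Z\<^sub>K - E - \<S>'\<close>.\<close>

lemma reducible_wcoeff:
  assumes "I \<noteq> {}"
  shows "reducible I (wcoeff \<Gamma> h)"
  unfolding reducible_def
proof
  fix c
  obtain i where i: "i \<in> I" using assms by blast
  define F where "F = {x \<in> monoidS \<Gamma>. coord x i \<le> coord (ZK \<Gamma> - sumE - c) i}"
  have "{l. wcoeff \<Gamma> h l \<noteq> 0 \<and> restr I l = c} \<subseteq> (\<lambda>x. ZK \<Gamma> - sumE - x) ` F"
  proof clarify
    fix l assume l: "wcoeff \<Gamma> h l \<noteq> 0" "c = restr I l"
    then have "ZK \<Gamma> - sumE - l \<in> F" using wcoeff_support[OF l(1)] i by (simp add: F_def)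
    then show "l \<in> (\<lambda>x. ZK \<Gamma> - sumE - x) ` F" by (intro image_eqI[of _ _ "ZK \<Gamma> - sumE - l"]) auto
  qed
  moreover have "finite F" unfolding F_def by (rule finite_monoidS_below)
  ultimately show "finite {l. wcoeff \<Gamma> h l \<noteq> 0 \<and> restr I l = c}" by (meson finite_imageI finite_subset)
qed

end

section \<open>Uniqueness of decompositions and Euclidean division\<close>

lemma polys_in_iff: "p \<in> polys_in I \<longleftrightarrow> keys p \<subseteq> {c. restr I c = c}"
  by (auto simp: polys_in_def)

lemma polys_in_add: "p \<in> polys_in I \<Longrightarrow> q \<in> polys_in I \<Longrightarrow> p + q \<in> polys_in I"
  unfolding polys_in_iff using keys_add[of p q] by blast

lemma polys_in_diff: "p \<in> polys_in I \<Longrightarrow> q \<in> polys_in I \<Longrightarrow> p - q \<in> polys_in I"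
  unfolding polys_in_iff using keys_diff_subset[of p q] by blast

lemma polys_in_mult: "p \<in> polys_in I \<Longrightarrow> q \<in> polys_in I \<Longrightarrow> p * q \<in> polys_in I"
  unfolding polys_in_iff by (rule keys_mult_closed) (auto simp: restr_add)

lemma polys_in_single: "restr I b = b \<Longrightarrow> single b c \<in> polys_in I"
  by (simp add: polys_in_def)

lemma not_prec_onE:
  assumes "\<not> prec_on I a b"
  obtains i where "i \<in> I" "coord b i \<le> coord a i"
  using assms by (auto simp: prec_on_def not_less)

text \<open>
  A nonzero difference of the polynomial parts has an exponent that is nonnegative in some
  \<open>t\<^sub>i\<close>, whereas the difference of the other parts has negative degree in \<open>t\<^sub>i\<close>.
\<close>

lemma decomposition_unique:
  assumes P: "\<And>c. c \<in> keys P \<Longrightarrow> \<not> prec_on I c 0"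
    and P': "\<And>c. c \<in> keys P' \<Longrightarrow> \<not> prec_on I c 0"
    and R: "\<And>i. i \<in> I \<Longrightarrow> rat_degree i R < 0" and R': "\<And>i. i \<in> I \<Longrightarrow> rat_degree i R' < 0"
    and eq: "of_poly P + R = of_poly P' + R'"
  shows "P = P' \<and> R = R'"
proof -
  have eq': "of_poly (P - P') = R' + (- R)" using eq by (simp add: of_poly_diff algebra_simps)
  have "keys (P - P') = {}"
  proof (rule ccontr)
    assume "keys (P - P') \<noteq> {}"
    then obtain c where c: "c \<in> keys (P - P')" by blast
    then have "\<not> prec_on I c 0" using keys_diff_subset[of P P'] P P' by blast
    then obtain i where i: "i \<in> I" "0 \<le> coord c i" by (auto elim: not_prec_onE)
    have "rat_degree i (of_poly (P - P')) < 0"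
      unfolding eq' using R[OF i(1)] R'[OF i(1)] by (intro rat_degree_neg_add rat_degree_neg_uminus)
    then show False using c i(2) by (auto simp: rat_degree_neg_of_poly)
  qed
  then have "P = P'" by simp
  then show ?thesis using eq by simp
qed

lemma top_coord_one_minus_mon:
  assumes "0 < coord a i"
  shows "top_coord i (1 - mon a) = coord a i"
proof (rule top_coord_eqI)
  have "a \<noteq> 0" using assms by auto
  then show "a \<in> keys (1 - mon a)"
    by (simp add: in_keys_iff lookup_minus lookup_one mon_def)
  show "coord x i \<le> coord a i" if "x \<in> keys (1 - mon a)" for x
    using keys_one_minus_mon[of a] that assms by auto
qed

lemma top_coord_prod_one_minus_mon:
  assumes "finite S" "\<And>j. j \<in> S \<Longrightarrow> 0 < coord (a j) i"
  shows "(\<Prod>j\<in>S. 1 - mon (a j)) \<noteq> 0 \<and> top_coord i (\<Prod>j\<in>S. 1 - mon (a j)) = (\<Sum>j\<in>S. coord (a j) i)"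
  using assms
proof (induction S)
  case (insert j S)
  have "a j \<noteq> 0" using insert.prems[of j] by auto
  then have "1 - mon (a j) \<noteq> 0" by (rule one_minus_mon_neq_0)
  then show ?case
    using insert top_coord_one_minus_mon[of "a j" i] by (simp add: top_coord_mult)
qed simp

locale euclidean_division =
  fixes I :: "'v::finite set" and n :: nat and a :: "nat \<Rightarrow> 'v qvec"
  assumes I: "I \<noteq> {}"
    and a_in: "\<And>i. i \<in> {1..n} \<Longrightarrow> restr I (a i) = a i"
    and a_pos: "\<And>i. i \<in> {1..n} \<Longrightarrow> prec_on I 0 (a i)"
begin

text \<open>The invariants of the division: the properties of the exponents, and the sum of all terms.\<close>

definition valid :: "(nat set \<Rightarrow> 'v qpoly) \<Rightarrow> bool" where
  "valid A \<longleftrightarrow> (\<forall>S. A S \<in> polys_in I \<and> (\<forall>b\<in>keys (A S). S \<subseteq> {1..n} \<and> \<not> prec_on I b 0))"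

definition value_of :: "(nat set \<Rightarrow> 'v qpoly) \<Rightarrow> 'v ratfun" where
  "value_of A = (\<Sum>S\<in>Pow {1..n}. euclid_term a A S)"

definition finished :: "(nat set \<Rightarrow> 'v qpoly) \<Rightarrow> bool" where
  "finished A \<longleftrightarrow> (\<forall>S. \<forall>b\<in>keys (A S). \<forall>i\<in>S. prec_on I b (a i))"

lemma a_coord: "i \<in> {1..n} \<Longrightarrow> v \<in> I \<Longrightarrow> 0 < coord (a i) v"
  using a_pos by (auto simp: prec_on_def)

lemma a_neq_0: "i \<in> {1..n} \<Longrightarrow> a i \<noteq> 0"
  using a_coord I by (metis all_not_in_conv coord_zero less_irrefl)

lemma euclid_stepE:
  assumes "euclid_step I a A A'" "valid A"
  obtains S b i c where "S \<subseteq> {1..n}" "i \<in> S" "i \<in> {1..n}" "b \<in> keys (A S)" "\<not> prec_on I b (a i)"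
    "c = lookup (A S) b"
    "A' = A (S := A S - single b c + single (b - a i) c,
             S - {i} := A (S - {i}) - single (b - a i) c)"
proof -
  obtain S b i where 1: "i \<in> S" "b \<in> keys (A S)" "\<not> prec_on I b (a i)"
    and A': "A' = A (S := A S - single b (lookup (A S) b)
                    + single (b - a i) (lookup (A S) b),
             S - {i} := A (S - {i}) - single (b - a i) (lookup (A S) b))"
    using assms(1) unfolding euclid_step_def Let_def by blast
  moreover have "S \<subseteq> {1..n}" using 1(2) assms(2) unfolding valid_def by blast
  ultimately show ?thesis using that by blast
qed

lemma valid_step:
  assumes "euclid_step I a A A'" "valid A"
  shows "valid A'"
proof -
  obtain S b i c where 1: "S \<subseteq> {1..n}" "i \<in> S" "i \<in> {1..n}" "b \<in> keys (A S)" "\<not> prec_on I b (a i)"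
    and A': "A' = A (S := A S - single b c + single (b - a i) c,
             S - {i} := A (S - {i}) - single (b - a i) c)"
    using assms by (rule euclid_stepE)
  have A: "A T \<in> polys_in I" "\<And>b. b \<in> keys (A T) \<Longrightarrow> T \<subseteq> {1..n} \<and> \<not> prec_on I b 0" for T
    using assms(2) by (auto simp: valid_def)
  have b: "restr I b = b" using A(1)[of S] 1(4) by (auto simp: polys_in_def)
  then have b': "restr I (b - a i) = b - a i" using a_in[OF 1(3)] by (simp add: restr_diff)
  have b0: "\<not> prec_on I (b - a i) 0" using 1(5) by (auto simp: prec_on_def)
  have "A' T \<in> polys_in I" for T
    using A(1) b b' by (simp add: A' polys_in_add polys_in_diff polys_in_single)
  moreover have "T \<subseteq> {1..n} \<and> \<not> prec_on I x 0" if x: "x \<in> keys (A' T)" for x T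
  proof -
    have SiS: "S \<noteq> S - {i}" using 1(2) by blast
    have k1: "keys (A' S) \<subseteq> insert (b - a i) (keys (A S))"
      using SiS 1(4) by (auto simp: A' in_keys_iff lookup_add lookup_minus lookup_single when_def split: if_splits)
    have k2: "keys (A' (S - {i})) \<subseteq> insert (b - a i) (keys (A (S - {i})))"
      by (auto simp: A' in_keys_iff lookup_minus lookup_single when_def split: if_splits)
    have k3: "A' T = A T" if "T \<noteq> S" "T \<noteq> S - {i}" using that by (simp add: A')
    consider "T = S" | "T = S - {i}" | "T \<noteq> S" "T \<noteq> S - {i}" by blast
    then have "x \<in> keys (A T) \<or> x = b - a i \<and> (T = S \<or> T = S - {i})"
    proof cases
      case 1
      then show ?thesis using subsetD[OF k1, of x] x by auto
    next
      case 2
      then show ?thesis using subsetD[OF k2, of x] x by auto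
    next
      case 3
      then show ?thesis using x k3 by simp
    qed
    then show ?thesis
    proof
      assume "x = b - a i \<and> (T = S \<or> T = S - {i})"
      then show ?thesis using 1(1) b0 by auto
    qed (rule A(2))
  qed
  ultimately show ?thesis by (auto simp: valid_def)
qed

lemma value_step:
  assumes "euclid_step I a A A'" "valid A"
  shows "value_of A' = value_of A"
proof -
  obtain S b i c where 1: "S \<subseteq> {1..n}" "i \<in> S" "i \<in> {1..n}"
    and A': "A' = A (S := A S - single b c + single (b - a i) c,
             S - {i} := A (S - {i}) - single (b - a i) c)"
    using assms by (rule euclid_stepE)
  define q where "q = single (b - a i) c"
  define d where "d = (\<lambda>T. \<Prod>j\<in>T. of_poly (1 - mon (a j)))"
  have finS: "finite S" using 1(1) finite_subset by blast
  have dS: "d S = of_poly (1 - mon (a i)) * d (S - {i})"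
    unfolding d_def using finS 1(2) by (rule prod.remove)
  have nz: "of_poly (1 - mon (a i)) \<noteq> 0"
    using one_minus_mon_neq_0[OF a_neq_0[OF 1(3)]] by simp
  have single: "single b c = mon (a i) * q"
    by (simp add: q_def mon_def mult_single)
  have SiS: "S \<noteq> S - {i}" using 1(2) by blast
  have "value_of A' - value_of A = (\<Sum>T\<in>Pow {1..n}. of_poly (A' T - A T) / d T)"
    by (simp add: value_of_def euclid_term_def d_def of_poly_diff diff_divide_distrib sum_subtractf)
  also have "\<dots> = (\<Sum>T\<in>{S, S - {i}}. of_poly (A' T - A T) / d T)"
    using 1(1) by (intro sum.mono_neutral_right) (auto simp: A')
  also have "\<dots> = of_poly (A' S - A S) / d S + of_poly (A' (S - {i}) - A (S - {i})) / d (S - {i})"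
    using SiS by simp
  also have "A' S - A S = q * (1 - mon (a i))"
    using SiS by (simp add: A' single algebra_simps flip: q_def)
  also have "A' (S - {i}) - A (S - {i}) = - q"
    by (simp add: A' flip: q_def)
  also have "of_poly (q * (1 - mon (a i))) / d S + of_poly (- q) / d (S - {i}) = 0"
    using nz unfolding dS of_poly_mult of_poly_uminus by simp
  finally show ?thesis by simp
qed

lemma valid_steps:
  assumes "(euclid_step I a)\<^sup>*\<^sup>* A A'" "valid A"
  shows "valid A' \<and> value_of A' = value_of A"
  using assms by (induction rule: rtranclp_induct) (auto simp: valid_step value_step)

text \<open>
  An exponent \<open>b \<prec> a\<^sub>j\<close> for a single \<open>j \<in> S\<close> is already smaller than the degree \<open>\<Sum>a\<^sub>j\<close> of the
  denominator.
\<close>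

lemma rat_degree_euclid_term:
  assumes "valid A" "finished A" "S \<in> Pow {1..n} - {{}}" "v \<in> I"
  shows "rat_degree v (euclid_term a A S) < 0"
proof -
  have fin: "finite S" using assms(3) finite_subset by blast
  have pos: "0 < coord (a j) v" if "j \<in> S" for j using that assms(3,4) a_coord by blast
  define d where "d = (\<Prod>j\<in>S. 1 - mon (a j))"
  have d: "d \<noteq> 0" "top_coord v d = (\<Sum>j\<in>S. coord (a j) v)"
    unfolding d_def using top_coord_prod_one_minus_mon[of S a v] fin pos by auto
  obtain j where j: "j \<in> S" using assms(3) by blast
  have "coord b v < top_coord v d" if "b \<in> keys (A S)" for b
  proof -
    have "coord b v < coord (a j) v"
      using assms(2,4) that j by (auto simp: finished_def prec_on_def)
    also have "\<dots> \<le> (\<Sum>j\<in>S. coord (a j) v)"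
      using fin j pos by (intro member_le_sum) (auto simp: less_imp_le)
    finally show ?thesis by (simp add: d)
  qed
  moreover have "euclid_term a A S = Fract (A S) d"
    unfolding euclid_term_def Fract_of_poly[OF d(1)] by (simp add: d_def of_poly_prod)
  ultimately show ?thesis using rat_degree_neg_iff[OF d(1)] by metis
qed

text \<open>
  Termination: a step moves an exponent down by at least \<open>\<epsilon>\<close> in all coordinates, and the
  largest coordinate stays nonnegative. As one term is replaced by two, the weight of a term
  is a power of 3.
\<close>

definition eps :: rat where
  "eps = Min (insert 1 ((\<lambda>(i, v). coord (a i) v) ` ({1..n} \<times> I)))"

definition height :: "'v qvec \<Rightarrow> nat" where
  "height b = nat \<lfloor>Max (coord b ` I) / eps\<rfloor>"

definition weight :: "'v qpoly \<Rightarrow> nat" where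
  "weight p = (\<Sum>b\<in>keys p. 3 ^ Suc (height b))"

lemma eps_pos: "0 < eps"
  unfolding eps_def using a_coord by (subst Min_gr_iff) auto

lemma eps_le: "i \<in> {1..n} \<Longrightarrow> v \<in> I \<Longrightarrow> eps \<le> coord (a i) v"
  unfolding eps_def by (rule Min_le) auto

lemma height_decreases:
  assumes "i \<in> {1..n}" "\<not> prec_on I b (a i)"
  shows "Suc (height (b - a i)) \<le> height b"
proof -
  let ?M = "\<lambda>b :: 'v qvec. Max (coord b ` I)"
  have ne: "coord x ` I \<noteq> {}" "finite (coord x ` I)" for x :: "'v qvec" using I by auto
  have "?M (b - a i) \<le> ?M b - eps"
  proof (subst Max_le_iff[OF ne(2,1)], clarify)
    fix v assume v: "v \<in> I"
    have "coord b v \<le> ?M b" using v by (intro Max_ge) auto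
    then show "coord (b - a i) v \<le> ?M b - eps" using eps_le[OF assms(1) v] by simp
  qed
  then have "?M (b - a i) / eps \<le> ?M b / eps - 1"
    using eps_pos by (simp add: field_simps)
  moreover have "0 \<le> ?M (b - a i) / eps"
  proof -
    obtain v where v: "v \<in> I" "coord (a i) v \<le> coord b v" using assms(2) by (rule not_prec_onE)
    have "0 \<le> coord (b - a i) v" using v(2) by simp
    also have "\<dots> \<le> ?M (b - a i)" using v(1) by (intro Max_ge) auto
    finally show ?thesis using eps_pos by (rule divide_nonneg_pos)
  qed
  ultimately have "0 \<le> \<lfloor>?M (b - a i) / eps\<rfloor>" "\<lfloor>?M (b - a i) / eps\<rfloor> + 1 \<le> \<lfloor>?M b / eps\<rfloor>"
    by linarith+
  moreover have "Suc (nat p) \<le> nat q" if "0 \<le> p" "p + 1 \<le> q" for p q :: int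
    using that by linarith
  ultimately show ?thesis unfolding height_def by blast
qed

lemma weight_le:
  assumes "keys p \<subseteq> B" "finite B"
  shows "weight p \<le> (\<Sum>b\<in>B. 3 ^ Suc (height b))"
  unfolding weight_def using assms by (intro sum_mono2) auto

lemma weight_step:
  assumes "euclid_step I a A A'" "valid A"
  shows "(\<Sum>S\<in>Pow {1..n}. weight (A' S)) < (\<Sum>S\<in>Pow {1..n}. weight (A S))"
proof -
  obtain S b i c where 1: "S \<subseteq> {1..n}" "i \<in> S" "i \<in> {1..n}" "b \<in> keys (A S)" "\<not> prec_on I b (a i)"
    and c: "c = lookup (A S) b"
    and A': "A' = A (S := A S - single b c + single (b - a i) c,
             S - {i} := A (S - {i}) - single (b - a i) c)"
    using assms by (rule euclid_stepE)
  let ?w = "\<lambda>b. 3 ^ Suc (height b) :: nat"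
  let ?b' = "b - a i"
  have SiS: "S \<noteq> S - {i}" using 1(2) by blast
  have ai: "?b' \<noteq> b" using a_neq_0[OF 1(3)] by simp
  have "keys (A' S) \<subseteq> insert ?b' (keys (A S) - {b})"
    using SiS ai by (auto simp: A' c in_keys_iff lookup_add lookup_minus lookup_single when_def split: if_splits)
  then have "weight (A' S) \<le> (\<Sum>b\<in>insert ?b' (keys (A S) - {b}). ?w b)"
    by (rule weight_le) simp
  also have "\<dots> \<le> ?w ?b' + (\<Sum>b\<in>keys (A S) - {b}. ?w b)"
    by (simp add: sum.insert_if)
  finally have w1: "weight (A' S) + ?w b \<le> ?w ?b' + weight (A S)"
    unfolding weight_def using sum.remove[OF finite_keys 1(4), of ?w] by linarith
  have "keys (A' (S - {i})) \<subseteq> insert ?b' (keys (A (S - {i})))"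
    by (auto simp: A' in_keys_iff lookup_minus lookup_single when_def split: if_splits)
  then have "weight (A' (S - {i})) \<le> (\<Sum>b\<in>insert ?b' (keys (A (S - {i}))). ?w b)"
    by (rule weight_le) simp
  also have "\<dots> \<le> ?w ?b' + weight (A (S - {i}))"
    by (simp add: sum.insert_if weight_def)
  finally have w2: "weight (A' (S - {i})) \<le> ?w ?b' + weight (A (S - {i}))" .
  have split: "(\<Sum>T\<in>Pow {1..n}. f T) = f S + (f (S - {i}) + (\<Sum>T\<in>Pow {1..n} - {S} - {S - {i}}. f T))"
    for f :: "nat set \<Rightarrow> nat"
    using 1(1) SiS by (subst sum.remove[of _ S], simp, simp, subst sum.remove[of _ "S - {i}"]) auto
  have rest: "(\<Sum>T\<in>Pow {1..n} - {S} - {S - {i}}. weight (A' T))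
      = (\<Sum>T\<in>Pow {1..n} - {S} - {S - {i}}. weight (A T))"
    by (intro sum.cong) (auto simp: A')
  have "?w ?b' \<le> 3 ^ height b"
    using height_decreases[OF 1(3,5)] by (intro power_increasing) auto
  moreover have "(0 :: nat) < 3 ^ height b" "?w b = 3 * 3 ^ height b" by simp_all
  ultimately have "2 * ?w ?b' < ?w b" by linarith
  then show ?thesis unfolding split rest using w1 w2 by linarith
qed

lemma division_terminates:
  assumes "valid A"
  shows "\<exists>A'. (euclid_step I a)\<^sup>*\<^sup>* A A' \<and> finished A'"
  using assms
proof (induction "\<Sum>S\<in>Pow {1..n}. weight (A S)" arbitrary: A rule: less_induct)
  case less
  show ?case
  proof (cases "finished A")
    case True
    then show ?thesis by blast
  next
    case False
    then obtain S b i where 1: "b \<in> keys (A S)" "i \<in> S" "\<not> prec_on I b (a i)"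
      unfolding finished_def by blast
    then obtain A' where A': "euclid_step I a A A'"
      unfolding euclid_step_def Let_def by blast
    then obtain A'' where "(euclid_step I a)\<^sup>*\<^sup>* A' A''" "finished A''"
      using less weight_step valid_step by blast
    then show ?thesis using A' by (meson converse_rtranclp_into_rtranclp)
  qed
qed

definition start :: "'v qpoly \<Rightarrow> nat set \<Rightarrow> 'v qpoly" where
  "start N = (\<lambda>S. if S = {1..n} then N else 0)"

lemma valid_start:
  assumes "N \<in> polys_in I" "\<And>b. b \<in> keys N \<Longrightarrow> \<not> prec_on I b 0"
  shows "valid (start N)"
  using assms by (auto simp: valid_def start_def polys_in_def)

lemma value_start: "value_of (start N) = of_poly N / (\<Prod>i\<in>{1..n}. of_poly (1 - mon (a i)))"
proof -
  have "value_of (start N) = (\<Sum>S\<in>{{1..n}}. euclid_term a (start N) S)"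
    unfolding value_of_def by (intro sum.mono_neutral_right) (auto simp: start_def euclid_term_def)
  then show ?thesis by (simp add: start_def euclid_term_def)
qed

lemma value_split: "value_of A = of_poly (A {}) + (\<Sum>S\<in>Pow {1..n} - {{}}. euclid_term a A S)"
  unfolding value_of_def by (subst sum.remove[of _ "{}"]) (auto simp: euclid_term_def)

lemma division_result:
  assumes "valid A" "finished A" "v \<in> I"
  shows "rat_degree v (\<Sum>S\<in>Pow {1..n} - {{}}. euclid_term a A S) < 0"
  using rat_degree_euclid_term[OF assms(1,2) _ assms(3)] by (rule rat_degree_neg_sum)

end

lemma euclid_decomposition_sound:
  assumes "I \<noteq> {}" "euclid_decomposition I g P R"
  shows "(\<forall>c\<in>keys P. \<not> prec_on I c 0) \<and> (\<forall>i\<in>I. rat_degree i R < 0) \<and> g = of_poly P + R"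
proof -
  obtain n a N A where N: "N \<in> polys_in I" "\<forall>b\<in>keys N. \<not> prec_on I b 0"
    and a: "\<forall>i\<in>{1..n}. restr I (a i) = a i \<and> prec_on I 0 (a i)"
    and g: "g = of_poly N / (\<Prod>i\<in>{1..n}. of_poly (1 - mon (a i)))"
    and steps: "(euclid_step I a)\<^sup>*\<^sup>* (\<lambda>S. if S = {1..n} then N else 0) A"
    and fin: "\<forall>S\<subseteq>{1..n}. \<forall>b\<in>keys (A S). \<not> prec_on I b 0 \<and> (\<forall>i\<in>S. prec_on I b (a i))"
    and P: "P = A {}" and R: "R = (\<Sum>S\<in>Pow {1..n} - {{}}. euclid_term a A S)"
    using assms(2) unfolding euclid_decomposition_def by metis
  interpret euclidean_division I n a
    by unfold_locales (use assms(1) a in auto)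
  have "valid (start N)" using N by (intro valid_start) auto
  moreover have "(euclid_step I a)\<^sup>*\<^sup>* (start N) A" using steps by (simp add: start_def)
  ultimately have A: "valid A" "value_of A = value_of (start N)" using valid_steps by blast+
  have "finished A" using A(1) fin unfolding finished_def valid_def by blast
  then have "\<forall>i\<in>I. rat_degree i R < 0" unfolding R using A(1) division_result by blast
  moreover have "g = value_of A" using A(2) by (simp only: g value_start)
  then have "g = of_poly P + R" by (simp only: P R value_split)
  moreover have "\<forall>c\<in>keys P. \<not> prec_on I c 0" using A(1) by (auto simp: P valid_def)
  ultimately show ?thesis by blast
qed

lemma euclid_decomposition_exists:
  fixes n :: nat
  assumes "I \<noteq> {}" "N \<in> polys_in I" "\<And>b. b \<in> keys N \<Longrightarrow> \<not> prec_on I b 0"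
    and "\<And>i. i \<in> {1..n} \<Longrightarrow> restr I (a i) = a i" "\<And>i. i \<in> {1..n} \<Longrightarrow> prec_on I 0 (a i)"
    and g: "g = of_poly N / (\<Prod>i\<in>{1..n}. of_poly (1 - mon (a i)))"
  shows "\<exists>P R. euclid_decomposition I g P R"
proof -
  interpret euclidean_division I n a
    by unfold_locales (use assms in auto)
  have start: "valid (start N)" using assms(2,3) by (rule valid_start)
  then obtain A where A: "(euclid_step I a)\<^sup>*\<^sup>* (start N) A" "finished A"
    using division_terminates by blast
  have "valid A" using valid_steps[OF A(1) start] by blast
  then have fin: "\<forall>S\<subseteq>{1..n}. \<forall>b\<in>keys (A S). \<not> prec_on I b 0 \<and> (\<forall>i\<in>S. prec_on I b (a i))"
    using A(2) unfolding valid_def finished_def by blast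
  have "euclid_decomposition I g (A {}) (\<Sum>S\<in>Pow {1..n} - {{}}. euclid_term a A S)"
    unfolding euclid_decomposition_def
    using assms fin A(1) unfolding start_def
    by (intro exI[of _ n] exI[of _ a] exI[of _ N] exI[of _ A]) simp
  then show ?thesis by blast
qed

lemma prod_pairs:
  fixes f :: "nat \<Rightarrow> 'a::comm_monoid_mult"
  shows "(\<Prod>i\<in>{1..2 * m}. f ((i - 1) div 2)) = (\<Prod>j<m. f j ^ 2)"
proof (induction m)
  case (Suc m)
  have "{1..2 * Suc m} = insert (2 * m + 2) (insert (2 * m + 1) {1..2 * m})" by auto
  then show ?case using Suc by (simp add: power2_eq_square mult_ac)
qed simp

context negdef_tree begin

section \<open>The decomposition of the rational function\<close>

lemma latL_dualL: "x \<in> latL \<Longrightarrow> x \<in> dualL \<Gamma>"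
  unfolding dualL_iff dual_coord_def pairing_def latL_def by (auto intro!: Ints_sum Ints_mult)

lemma rep_properties:
  assumes "h \<in> groupH \<Gamma>"
  shows "h = cls (rep h)" "rep h \<in> dualL \<Gamma>" "0 \<le> coord (rep h) v" "coord (rep h) v < 1"
proof -
  obtain x where x: "h = cls x" "x \<in> dualL \<Gamma>" using assms by (auto simp: groupH_def)
  define r where "r = Qvec (\<lambda>v. frac (coord x v))"
  have r1: "0 \<le> coord r v \<and> coord r v < 1" for v by (simp add: r_def frac_lt_1)
  have "r - x \<in> latL" by (simp add: latL_def r_def frac_def)
  then have r2: "r \<in> h" unfolding x(1) cls_def by (auto intro!: exI[of _ "r - x"])
  have uniq: "y = r" if y: "y \<in> h" "\<forall>v. 0 \<le> coord y v \<and> coord y v < 1" for y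
  proof (rule qvec_eqI)
    fix v
    obtain l where "y = x + l" "l \<in> latL" using y(1) unfolding x(1) cls_def by blast
    moreover obtain l' where "r = x + l'" "l' \<in> latL" using r2 unfolding x(1) cls_def by blast
    ultimately have "coord y v - coord r v \<in> \<int>" by (auto simp: latL_def)
    then obtain k :: int where k: "coord y v - coord r v = of_int k" by (auto elim: Ints_cases)
    have "coord y v < 1" "0 \<le> coord y v" using y(2) by auto
    then have "rat_of_int k < 1" "- 1 < rat_of_int k" unfolding k[symmetric] using r1[of v] by linarith+
    then have "k = 0" by linarith
    then show "coord y v = coord r v" using k by simp
  qed
  have rep: "rep h = r"
    unfolding rep_def
  proof (rule the_equality)
    show "r \<in> h \<and> (\<forall>v. 0 \<le> coord r v \<and> coord r v < 1)" using r1 r2 by blast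
    show "y = r" if "y \<in> h \<and> (\<forall>v. 0 \<le> coord y v \<and> coord y v < 1)" for y
      using that uniq[of y] by blast
  qed
  have "x - r \<in> latL" using latL_uminus[OF \<open>r - x \<in> latL\<close>] by simp
  then have "cls x = cls r" unfolding cls_eq_iff .
  with x(1) show "h = cls (rep h)" unfolding rep by (rule trans)
  show "rep h \<in> dualL \<Gamma>"
    unfolding rep dualL_iff
  proof
    fix v
    have "dual_coord (r - x) v \<in> \<int>" "dual_coord x v \<in> \<int>"
      using latL_dualL[OF \<open>r - x \<in> latL\<close>] x(2) unfolding dualL_iff by blast+
    then have "dual_coord (r - x) v + dual_coord x v \<in> \<int>" by (rule Ints_add)
    then show "dual_coord r v \<in> \<int>" by simp
  qed
  show "0 \<le> coord (rep h) v" "coord (rep h) v < 1" using r1 by (auto simp: rep)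
qed

lemma cls_diff_cls: "cls_diff (cls x) (cls y) = cls (x - y)"
proof (rule set_eqI, rule iffI)
  fix z assume "z \<in> cls_diff (cls x) (cls y)"
  then obtain l l' where "z = (x + l) - (y + l')" "l \<in> latL" "l' \<in> latL"
    by (auto simp: cls_diff_def cls_def)
  then have "z = (x - y) + (l - l')" "l - l' \<in> latL" by (auto intro: latL_diff)
  then show "z \<in> cls (x - y)" unfolding cls_def by blast
next
  fix z assume "z \<in> cls (x - y)"
  then obtain l where "z = (x + l) - (y + 0)" "l \<in> latL" by (auto simp: cls_def)
  then show "z \<in> cls_diff (cls x) (cls y)"
    unfolding cls_diff_def cls_def using latL_zero by blast
qed

lemma coord_sumE [simp]: "coord (sumE :: 'v qvec) v = 1"
  by (simp add: sumE_def coord_sum)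

lemma sumE_latL: "(sumE :: 'v qvec) \<in> latL"
  by (simp add: latL_def)

text \<open>The reflection exchanges the classes \<open>h\<close> and \<open>[Z\<^sub>K] - h\<close>, as \<open>E \<in> L\<close>.\<close>

lemma reflected_class:
  assumes "h \<in> groupH \<Gamma>"
  shows "cls (ZK \<Gamma> - sumE - l) = cls_diff (cls (ZK \<Gamma>)) h \<longleftrightarrow> cls l = h"
proof -
  have "cls (ZK \<Gamma> - sumE - l) = cls_diff (cls (ZK \<Gamma>)) h \<longleftrightarrow> ZK \<Gamma> - sumE - l - (ZK \<Gamma> - rep h) \<in> latL"
    using rep_properties(1)[OF assms] by (metis cls_diff_cls cls_eq_iff)
  also have "ZK \<Gamma> - sumE - l - (ZK \<Gamma> - rep h) = - ((l - rep h) + sumE)" by simp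
  also have "- ((l - rep h) + sumE) \<in> latL \<longleftrightarrow> l - rep h \<in> latL"
  proof
    assume "- (l - rep h + sumE) \<in> latL"
    then have "- (- (l - rep h + sumE)) - sumE \<in> latL" by (rule latL_diff[OF latL_uminus sumE_latL])
    then show "l - rep h \<in> latL" by simp
  qed (intro latL_uminus latL_add sumE_latL)
  also have "l - rep h \<in> latL \<longleftrightarrow> cls l = h"
    using rep_properties(1)[OF assms] by (metis cls_eq_iff)
  finally show ?thesis .
qed

lemma wcoeff_Zh:
  assumes "h \<in> groupH \<Gamma>"
  shows "wcoeff \<Gamma> h l = Zh \<Gamma> (cls_diff (cls (ZK \<Gamma>)) h) (ZK \<Gamma> - sumE - l)"
  unfolding wcoeff_def Zh_def using reflected_class[OF assms] by simp

lemma reduce_wcoeff: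
  assumes "h \<in> groupH \<Gamma>"
  shows "reduce_series I (wcoeff \<Gamma> h) c
    = reduce_series I (Zh \<Gamma> (cls_diff (cls (ZK \<Gamma>)) h)) (restr I (ZK \<Gamma> - sumE) - c)"
  unfolding reduce_series_def
  by (rule sum.reindex_bij_witness[of _ "\<lambda>l. ZK \<Gamma> - sumE - l" "\<lambda>l. ZK \<Gamma> - sumE - l"])
    (auto simp: wcoeff_Zh[OF assms] restr_diff)

text \<open>
  The denominators \<open>1 - t\<^bsup>b\<^sub>v\<^esup>\<close> come from integral multiples of the \<open>E\<^sup>*\<^sub>v\<close>. They do not vanish on
  setting variables to 1, since the \<open>E\<^sup>*\<^sub>v\<close> are positive on \<open>I\<close>. The presentation has the form
  from which Euclidean division starts.
\<close>

lemma fh_red_presentation: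
  assumes "I \<noteq> {}"
  obtains b :: "'v \<Rightarrow> 'v qvec" and m where
    "\<And>v. restr I (b v) = b v" "\<And>v. prec_on I 0 (b v)"
    "m \<in> polys_in I" "\<And>c. c \<in> keys m \<Longrightarrow> \<not> prec_on I c 0"
    "(\<Prod>v\<in>UNIV. (1 - mon (b v)) ^ 2) \<in> polys_in I" "(\<Prod>v\<in>UNIV. (1 - mon (b v)) ^ 2) \<noteq> 0"
    "fh_red \<Gamma> I h = Fract m (\<Prod>v\<in>UNIV. (1 - mon (b v)) ^ 2)"
    "represents (reduce_series I (wcoeff \<Gamma> h)) (fh_red \<Gamma> I h)"
proof -
  obtain i where i: "i \<in> I" using assms by blast
  obtain N :: nat and n where N: "0 < N"
    and Z: "conv (\<Prod>v\<in>UNIV. (1 - mon (qscale (of_nat N) (Estar \<Gamma> v))) ^ 2) (Zh \<Gamma> h) = lookup n"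
    and W: "conv (\<Prod>v\<in>UNIV. (1 - mon (qscale (of_nat N) (Estar \<Gamma> v))) ^ 2) (wcoeff \<Gamma> h) = lookup n"
    and n: "\<And>k v. k \<in> keys n \<Longrightarrow> 0 \<le> coord k v"
    using class_presentation[of h] by blast
  define D where "D = (\<Prod>v\<in>UNIV. (1 - mon (qscale (of_nat N) (Estar \<Gamma> v))) ^ 2)"
  define b where "b = (\<lambda>v. restr I (qscale (of_nat N) (Estar \<Gamma> v)))"
  define d where "d = (\<Prod>v\<in>UNIV. (1 - mon (b v)) ^ 2)"
  have b: "restr I (b v) = b v" "prec_on I 0 (b v)" for v
    using N Estar_pos by (auto simp: b_def prec_on_def)
  have "b v \<noteq> 0" for v
    using b(2)[of v] i by (auto simp: prec_on_def)
  then have "1 - mon (b v) \<noteq> 0" for v by (rule one_minus_mon_neq_0)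
  then have d0: "d \<noteq> 0" unfolding d_def by simp
  have red: "reduce_poly I (mon a) = mon (restr I a)" for a by (simp add: mon_def)
  have d: "reduce_poly I D = d"
    by (simp add: D_def d_def reduce_poly_prod reduce_poly_power reduce_poly_diff red b_def)
  have D0: "D \<noteq> 0" using d d0 by auto
  have "fh \<Gamma> h = Fract n D" by (rule fh_eq) (use Z D0 in \<open>auto simp: D_def\<close>)
  then have fh: "fh_red \<Gamma> I h = Fract (reduce_poly I n) d"
    unfolding fh_red_def using reduce_rat_Fract[of I D n] d d0 by simp
  have rep: "represents (reduce_series I (wcoeff \<Gamma> h)) (fh_red \<Gamma> I h)"
    unfolding fh unfolding d[symmetric]
    by (rule represents_reduce) (use W d d0 reducible_wcoeff[OF assms] in \<open>auto simp: D_def\<close>)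
  have "\<not> prec_on I c 0" if c: "c \<in> keys (reduce_poly I n)" for c
  proof -
    obtain k where "k \<in> keys n" "c = restr I k" using keys_reduce_poly c by blast
    then show ?thesis using n[of k i] i by (auto simp: prec_on_def not_less)
  qed
  moreover have "d \<in> polys_in I" unfolding d[symmetric] by (rule reduce_poly_in)
  ultimately show ?thesis
    using b d0 fh rep reduce_poly_in[of I n] that[of b "reduce_poly I n"] unfolding d_def by blast
qed

lemma wcoeff_bounds:
  obtains N :: nat where "0 < N"
    "\<And>l v. wcoeff \<Gamma> h l \<noteq> 0 \<Longrightarrow> of_nat N * coord l v \<in> \<int> \<and> coord l v \<le> coord (ZK \<Gamma> - sumE) v"
proof -
  obtain N :: nat where N: "0 < N" "\<And>l u. (\<And>v. dual_coord l v \<in> \<int>) \<Longrightarrow> of_nat N * coord l u \<in> \<int>"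
    using common_denominator_dual by blast
  have "of_nat N * coord l v \<in> \<int> \<and> coord l v \<le> coord (ZK \<Gamma> - sumE) v" if "wcoeff \<Gamma> h l \<noteq> 0" for l v
  proof
    have S: "ZK \<Gamma> - sumE - l \<in> monoidS \<Gamma>" using that by (rule wcoeff_support)
    have "dual_coord l u \<in> \<int>" for u
    proof -
      have "dual_coord (ZK \<Gamma> - sumE - l) u \<in> \<int>" using S Nats_subset_Ints by (auto simp: monoidS_iff)
      then have "(of_nat (valency \<Gamma> u) - 2) - dual_coord (ZK \<Gamma> - sumE - l) u \<in> \<int>"
        by (intro Ints_diff[OF _ \<open>dual_coord (ZK \<Gamma> - sumE - l) u \<in> \<int>\<close>]) auto
      then show ?thesis unfolding dual_coord_diff[of "ZK \<Gamma> - sumE" l u] dual_coord_ZK_sumE by simp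
    qed
    then show "of_nat N * coord l v \<in> \<int>" by (rule N(2))
    show "coord l v \<le> coord (ZK \<Gamma> - sumE) v" using monoidS_nonneg[OF S, of v] by simp
  qed
  then show ?thesis using N(1) that by blast
qed

text \<open>Support conditions pass from \<open>w\<close> to all its parts, and to their reductions.\<close>

lemma expansion_at_infinity_part:
  assumes "represents (reduce_series I (\<lambda>l. if Q l then wcoeff \<Gamma> h l else 0)) q"
  shows "expansion_at_infinity (reduce_series I (\<lambda>l. if Q l then wcoeff \<Gamma> h l else 0)) q"
  unfolding expansion_at_infinity_def
proof (intro conjI)
  let ?s = "reduce_series I (\<lambda>l. if Q l then wcoeff \<Gamma> h l else 0)"
  obtain N :: nat where N: "0 < N"
    "\<And>l v. wcoeff \<Gamma> h l \<noteq> 0 \<Longrightarrow> of_nat N * coord l v \<in> \<int> \<and> coord l v \<le> coord (ZK \<Gamma> - sumE) v"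
    using wcoeff_bounds by blast
  have supp: "\<exists>l. wcoeff \<Gamma> h l \<noteq> 0 \<and> c = restr I l" if "?s c \<noteq> 0" for c
    using that by (elim reduce_series_nonzeroE) (auto split: if_splits)
  have "of_nat N * coord c v \<in> \<int>" if "?s c \<noteq> 0" for c v
    using supp[OF that] N(2) by auto
  then show "common_denominator ?s" unfolding common_denominator_def using N(1) by blast
  have "coord c v \<le> coord (Qvec (\<lambda>v. max 0 (coord (ZK \<Gamma> - sumE) v))) v" if "?s c \<noteq> 0" for c v
    using supp[OF that] N(2) by (auto simp: max.coboundedI2)
  then show "\<exists>b. \<forall>l v. ?s l \<noteq> 0 \<longrightarrow> coord l v \<le> coord b v" by blast
qed (rule assms)

text \<open>The reflected exponents lie in \<open>\<S>'\<close> and have a bounded coordinate.\<close>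

lemma finite_Pplus_index:
  "finite {l. wcoeff \<Gamma> h l \<noteq> 0 \<and> \<not> prec_on I l 0}"
proof -
  define F where "F = (\<lambda>i. {x \<in> monoidS \<Gamma>. coord x i \<le> coord (ZK \<Gamma> - sumE) i})"
  have "{l. wcoeff \<Gamma> h l \<noteq> 0 \<and> \<not> prec_on I l 0} \<subseteq> (\<Union>i. (\<lambda>x. ZK \<Gamma> - sumE - x) ` F i)"
  proof clarify
    fix l assume l: "wcoeff \<Gamma> h l \<noteq> 0" "\<not> prec_on I l 0"
    then obtain i where i: "0 \<le> coord l i" by (auto elim: not_prec_onE)
    have "ZK \<Gamma> - sumE - l \<in> F i" using wcoeff_support[OF l(1)] i by (simp add: F_def)
    then show "l \<in> (\<Union>i. (\<lambda>x. ZK \<Gamma> - sumE - x) ` F i)"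
      by (intro UN_I[of i] image_eqI[of _ _ "ZK \<Gamma> - sumE - l"]) auto
  qed
  moreover have "finite (\<Union>i. (\<lambda>x. ZK \<Gamma> - sumE - x) ` F i)"
    unfolding F_def by (intro finite_UN_I finite_imageI finite_monoidS_below) simp
  ultimately show ?thesis by (rule finite_subset)
qed

lemma lookup_Pplus:
  "lookup (Pplus \<Gamma> I h) c
    = reduce_series I (\<lambda>l. if \<not> prec_on I l 0 then wcoeff \<Gamma> h l else 0) c"
proof -
  let ?F = "{l. wcoeff \<Gamma> h l \<noteq> 0 \<and> \<not> prec_on I l 0}"
  have "lookup (Pplus \<Gamma> I h) c = (\<Sum>l\<in>?F. if restr I l = c then wcoeff \<Gamma> h l else 0)"
    unfolding Pplus_def lookup_sum by (intro sum.cong refl) (simp add: lookup_single when_def)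
  also have "\<dots> = (\<Sum>l | l \<in> ?F \<and> restr I l = c. wcoeff \<Gamma> h l)"
    by (rule sum.inter_filter[OF finite_Pplus_index, symmetric])
  also have "\<dots> = reduce_series I (\<lambda>l. if \<not> prec_on I l 0 then wcoeff \<Gamma> h l else 0) c"
    unfolding reduce_series_def by (intro sum.cong) auto
  finally show ?thesis .
qed

lemma keys_Pplus:
  assumes "c \<in> keys (Pplus \<Gamma> I h)"
  shows "restr I c = c" "\<not> prec_on I c 0"
proof -
  have "reduce_series I (\<lambda>l. if \<not> prec_on I l 0 then wcoeff \<Gamma> h l else 0) c \<noteq> 0"
    using assms by (simp add: in_keys_iff lookup_Pplus)
  then obtain l where "\<not> prec_on I l 0" "c = restr I l"
    by (elim reduce_series_nonzeroE) (auto split: if_splits)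
  then show "restr I c = c" "\<not> prec_on I c 0" by (auto simp: prec_on_def)
qed

lemma fneg_series_eq:
  assumes "I \<noteq> {}"
  shows "fneg_series \<Gamma> I h c = reduce_series I (wcoeff \<Gamma> h) c - lookup (Pplus \<Gamma> I h) c"
proof -
  have red: "reducible I (\<lambda>l. if Q l then wcoeff \<Gamma> h l else 0)" for Q
    using reducible_wcoeff[OF assms, of h] unfolding reducible_def
    by (auto elim: rev_finite_subset)
  have "wcoeff \<Gamma> h = (\<lambda>l. (if prec_on I l 0 then wcoeff \<Gamma> h l else 0) + (if \<not> prec_on I l 0 then wcoeff \<Gamma> h l else 0))"
    by auto
  then have "reduce_series I (wcoeff \<Gamma> h) c = fneg_series \<Gamma> I h c + lookup (Pplus \<Gamma> I h) c"
    unfolding lookup_Pplus fneg_series_def using reduce_series_add[OF red red] by metis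
  then show ?thesis by simp
qed

text \<open>
  The series \<open>f\<^sup>n\<^sup>e\<^sup>g\<close> is the reduction of \<open>w\<close> minus a polynomial, so the difference of the rational
  functions is represented by it.
\<close>

lemma fneg_eq:
  assumes "I \<noteq> {}"
  shows "fneg \<Gamma> I h = fh_red \<Gamma> I h - of_poly (Pplus \<Gamma> I h)"
    and "expansion_at_infinity (fneg_series \<Gamma> I h) (fneg \<Gamma> I h)"
proof -
  have "represents (reduce_series I (wcoeff \<Gamma> h)) (fh_red \<Gamma> I h)"
    using fh_red_presentation[OF assms, of h] by metis
  then have "represents (\<lambda>c. reduce_series I (wcoeff \<Gamma> h) c - lookup (Pplus \<Gamma> I h) c)
      (fh_red \<Gamma> I h - of_poly (Pplus \<Gamma> I h))"
    by (rule represents_diff_poly)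
  then have r: "represents (fneg_series \<Gamma> I h) (fh_red \<Gamma> I h - of_poly (Pplus \<Gamma> I h))"
    unfolding fneg_series_eq[OF assms, abs_def] .
  have e: "expansion_at_infinity (fneg_series \<Gamma> I h) (fh_red \<Gamma> I h - of_poly (Pplus \<Gamma> I h))"
    using r unfolding fneg_series_def by (rule expansion_at_infinity_part)
  show eq: "fneg \<Gamma> I h = fh_red \<Gamma> I h - of_poly (Pplus \<Gamma> I h)"
    unfolding fneg_def
  proof (rule the_equality)
    show "q = fh_red \<Gamma> I h - of_poly (Pplus \<Gamma> I h)" if "expansion_at_infinity (fneg_series \<Gamma> I h) q" for q
      using that r represents_unique unfolding expansion_at_infinity_def by blast
  qed (rule e)
  show "expansion_at_infinity (fneg_series \<Gamma> I h) (fneg \<Gamma> I h)"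
    unfolding eq by (rule e)
qed

lemma rat_degree_fneg:
  assumes "I \<noteq> {}" "i \<in> I"
  shows "rat_degree i (fneg \<Gamma> I h) < 0"
proof (rule rat_degree_neg_represents)
  show "represents (fneg_series \<Gamma> I h) (fneg \<Gamma> I h)"
    using fneg_eq(2)[OF assms(1)] by (simp add: expansion_at_infinity_def)
  show "coord c i < 0" if "fneg_series \<Gamma> I h c \<noteq> 0" for c
    using that assms(2) unfolding fneg_series_def
    by (elim reduce_series_nonzeroE) (auto simp: prec_on_def split: if_splits)
qed

lemma fneg_in:
  assumes "I \<noteq> {}"
  shows "fneg \<Gamma> I h \<in> ratfuns_in I"
proof -
  obtain m d where m: "m \<in> polys_in I" and d: "d \<in> polys_in I" "d \<noteq> 0" and f: "fh_red \<Gamma> I h = Fract m d"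
    using fh_red_presentation[OF assms, of h] by metis
  have P: "Pplus \<Gamma> I h \<in> polys_in I" using keys_Pplus by (auto simp: polys_in_def)
  have "fneg \<Gamma> I h = Fract (m - Pplus \<Gamma> I h * d) d"
    using d(2) by (simp add: fneg_eq(1)[OF assms] f of_poly_def)
  then show ?thesis
    unfolding ratfuns_in_def using m d P polys_in_diff polys_in_mult by blast
qed

lemma fh_red_euclid:
  assumes "I \<noteq> {}"
  shows "\<exists>P R. euclid_decomposition I (fh_red \<Gamma> I h) P R"
proof -
  obtain b :: "'v \<Rightarrow> 'v qvec" and m where b: "\<And>v. restr I (b v) = b v" "\<And>v. prec_on I 0 (b v)"
    and m: "m \<in> polys_in I" "\<And>c. c \<in> keys m \<Longrightarrow> \<not> prec_on I c 0"
    and d: "(\<Prod>v\<in>UNIV. (1 - mon (b v)) ^ 2) \<noteq> 0"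
    and f: "fh_red \<Gamma> I h = Fract m (\<Prod>v\<in>UNIV. (1 - mon (b v)) ^ 2)"
    using fh_red_presentation[OF assms, of h] by metis
  obtain e where e: "bij_betw e {0..<card (UNIV :: 'v set)} (UNIV :: 'v set)"
    using ex_bij_betw_nat_finite[of "UNIV :: 'v set"] by auto
  \<comment> \<open>Each denominator occurs twice in the list.\<close>
  define a where "a = (\<lambda>i. b (e ((i - 1) div 2)))"
  have "(\<Prod>i\<in>{1..2 * card (UNIV :: 'v set)}. of_poly (1 - mon (a i)))
      = (\<Prod>j<card (UNIV :: 'v set). of_poly (1 - mon (b (e j))) ^ 2)"
    unfolding a_def by (rule prod_pairs)
  also have "\<dots> = (\<Prod>v\<in>UNIV. of_poly (1 - mon (b v)) ^ 2)"
    using prod.reindex_bij_betw[OF e, of "\<lambda>v. of_poly (1 - mon (b v)) ^ 2"] by (simp add: lessThan_atLeast0)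
  finally have "fh_red \<Gamma> I h = of_poly m / (\<Prod>i\<in>{1..2 * card (UNIV :: 'v set)}. of_poly (1 - mon (a i)))"
    unfolding f Fract_of_poly[OF d] by (simp add: of_poly_prod of_poly_power)
  then show ?thesis
    using assms m b by (intro euclid_decomposition_exists[of I m _ a]) (auto simp: a_def)
qed

text \<open>
  Some run of the division ends, and each run that ends gives the only decomposition with the
  properties of part (a).
\<close>

lemma euclid_decomposition_iff:
  assumes "I \<noteq> {}"
  shows "euclid_decomposition I (fh_red \<Gamma> I h) P R \<longleftrightarrow> P = Pplus \<Gamma> I h \<and> R = fneg \<Gamma> I h"
proof -
  have uniq: "P = Pplus \<Gamma> I h \<and> R = fneg \<Gamma> I h" if "euclid_decomposition I (fh_red \<Gamma> I h) P R" for P R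
  proof -
    have s: "\<And>c. c \<in> keys P \<Longrightarrow> \<not> prec_on I c 0" "\<And>i. i \<in> I \<Longrightarrow> rat_degree i R < 0"
      "fh_red \<Gamma> I h = of_poly P + R"
      using euclid_decomposition_sound[OF assms that] by auto
    have "of_poly P + R = of_poly (Pplus \<Gamma> I h) + fneg \<Gamma> I h"
      using s(3) by (simp add: fneg_eq(1)[OF assms])
    from decomposition_unique[OF s(1) keys_Pplus(2) s(2) rat_degree_fneg[OF assms] this]
    show ?thesis .
  qed
  then show ?thesis using fh_red_euclid[OF assms, of h] by blast
qed

text \<open>
  Reflection of the index set. In the class of \<open>r\<^sub>h\<close>, whose coordinates lie in \<open>[0, 1)\<close>, the
  conditions \<open>l\<^sub>i < 0\<close> and \<open>l\<^sub>i \<le> (r\<^sub>h)\<^sub>i - 1\<close> are the same.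
\<close>

lemma eval_one_Pplus:
  assumes "h \<in> groupH \<Gamma>"
  shows "eval_one (Pplus \<Gamma> I h) = Qcount \<Gamma> (cls_diff (cls (ZK \<Gamma>)) h) I (ZK \<Gamma> - rep h)"
proof -
  let ?F = "{l. wcoeff \<Gamma> h l \<noteq> 0 \<and> \<not> prec_on I l 0}"
  let ?P = "Pplus \<Gamma> I h"
  have fin: "finite ?F" by (rule finite_Pplus_index)
  have "keys ?P \<subseteq> restr I ` ?F"
  proof
    fix c assume "c \<in> keys ?P"
    then have "reduce_series I (\<lambda>l. if \<not> prec_on I l 0 then wcoeff \<Gamma> h l else 0) c \<noteq> 0"
      by (simp add: in_keys_iff lookup_Pplus)
    then show "c \<in> restr I ` ?F"
      by (elim reduce_series_nonzeroE) (auto split: if_splits)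
  qed
  then have "eval_one ?P = (\<Sum>c\<in>restr I ` ?F. lookup ?P c)"
    unfolding eval_one_def using fin by (intro sum.mono_neutral_left) (auto simp: in_keys_iff)
  also have "\<dots> = (\<Sum>l\<in>?F. \<Sum>c\<in>restr I ` ?F. if restr I l = c then wcoeff \<Gamma> h l else 0)"
    unfolding Pplus_def lookup_sum by (subst sum.swap) (simp add: lookup_single when_def)
  also have "\<dots> = (\<Sum>l\<in>?F. wcoeff \<Gamma> h l)"
    using fin by (intro sum.cong refl) auto
  also have "\<dots> = Qcount \<Gamma> (cls_diff (cls (ZK \<Gamma>)) h) I (ZK \<Gamma> - rep h)"
  proof -
    have key: "prec_on I l 0 \<longleftrightarrow> geq_on I (ZK \<Gamma> - sumE - l) (ZK \<Gamma> - rep h)" if "cls l = h" for l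
    proof -
      have "l - rep h \<in> latL" using that rep_properties(1)[OF assms] by (metis cls_eq_iff)
      then have "coord l i - coord (rep h) i \<in> \<int>" for i by (simp add: latL_def)
      moreover have "coord l i < 0 \<longleftrightarrow> coord l i - coord (rep h) i \<le> - 1" if int: "coord l i - coord (rep h) i \<in> \<int>" for i
      proof -
        obtain k :: int where k: "coord l i - coord (rep h) i = of_int k" by (rule Ints_cases[OF int])
        have r: "0 \<le> coord (rep h) i" "coord (rep h) i < 1" using rep_properties[OF assms] by auto
        have "coord l i < 0 \<longleftrightarrow> k \<le> - 1"
        proof
          assume "coord l i < 0"
          then have "rat_of_int k < 0" using k r by linarith
          then show "k \<le> - 1" by simp
        next
          assume "k \<le> - 1"
          then have "rat_of_int k \<le> - 1" by linarith
          then show "coord l i < 0" using k r by linarith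
        qed
        then show ?thesis unfolding k by linarith
      qed
      ultimately show ?thesis unfolding prec_on_def geq_on_def by (auto simp: algebra_simps)
    qed
    have "{l. zcoeff \<Gamma> l \<noteq> 0 \<and> cls l = cls_diff (cls (ZK \<Gamma>)) h \<and> \<not> geq_on I l (ZK \<Gamma> - rep h)}
        = {l. Zh \<Gamma> (cls_diff (cls (ZK \<Gamma>)) h) l \<noteq> 0 \<and> \<not> geq_on I l (ZK \<Gamma> - rep h)}"
      by (auto simp: Zh_def)
    then have "Qcount \<Gamma> (cls_diff (cls (ZK \<Gamma>)) h) I (ZK \<Gamma> - rep h)
        = (\<Sum>l | Zh \<Gamma> (cls_diff (cls (ZK \<Gamma>)) h) l \<noteq> 0 \<and> \<not> geq_on I l (ZK \<Gamma> - rep h). Zh \<Gamma> (cls_diff (cls (ZK \<Gamma>)) h) l)"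
      unfolding Qcount_def by (intro sum.cong) (auto simp: Zh_def split: if_splits)
    also have "\<dots> = (\<Sum>l\<in>?F. wcoeff \<Gamma> h l)"
    proof (rule sum.reindex_bij_witness[of _ "\<lambda>l. ZK \<Gamma> - sumE - l" "\<lambda>l. ZK \<Gamma> - sumE - l"])
      fix l assume "l \<in> ?F"
      moreover from this have "cls l = h" by (auto simp: wcoeff_def split: if_splits)
      ultimately show "ZK \<Gamma> - sumE - l \<in> {l. Zh \<Gamma> (cls_diff (cls (ZK \<Gamma>)) h) l \<noteq> 0 \<and> \<not> geq_on I l (ZK \<Gamma> - rep h)}"
        using key[of l] wcoeff_Zh[OF assms, of l] by simp
    next
      fix l assume l: "l \<in> {l. Zh \<Gamma> (cls_diff (cls (ZK \<Gamma>)) h) l \<noteq> 0 \<and> \<not> geq_on I l (ZK \<Gamma> - rep h)}"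
      let ?l = "ZK \<Gamma> - sumE - l"
      have w: "wcoeff \<Gamma> h ?l = Zh \<Gamma> (cls_diff (cls (ZK \<Gamma>)) h) l" by (simp add: wcoeff_Zh[OF assms])
      then have "cls ?l = h" using l by (auto simp: wcoeff_def split: if_splits)
      then show "?l \<in> ?F" using key[of ?l] w l by simp
      show "wcoeff \<Gamma> h ?l = Zh \<Gamma> (cls_diff (cls (ZK \<Gamma>)) h) l" by (rule w)
    qed auto
    finally show ?thesis by simp
  qed
  finally show ?thesis .
qed

end

section \<open>The coefficients as alternating sums over cubes\<close>

text \<open>The maximum of a function on the vertices of a cube, which are the subsets of \<open>J\<close>.\<close>

definition subset_max :: "('v set \<Rightarrow> rat) \<Rightarrow> 'v::finite set \<Rightarrow> rat" where
  "subset_max f J = Max (f ` Pow J)"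

lemma subset_max_ge: "J' \<subseteq> J \<Longrightarrow> f J' \<le> subset_max f J"
  unfolding subset_max_def by (intro Max_ge) auto

lemma subset_max_le: "(\<And>J'. J' \<subseteq> J \<Longrightarrow> f J' \<le> x) \<Longrightarrow> subset_max f J \<le> x"
  unfolding subset_max_def by (subst Max_le_iff) auto

lemma subset_max_cong: "(\<And>J'. J' \<subseteq> J \<Longrightarrow> f J' = g J') \<Longrightarrow> subset_max f J = subset_max g J"
  unfolding subset_max_def by (intro arg_cong[of _ _ Max] image_cong) auto

lemma subset_max_empty [simp]: "subset_max f {} = f {}"
  by (simp add: subset_max_def)

lemma subset_max_add: "subset_max (\<lambda>J'. c + f J') J = c + subset_max f J"
proof (rule antisym)
  show "subset_max (\<lambda>J'. c + f J') J \<le> c + subset_max f J"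
    by (rule subset_max_le) (simp add: subset_max_ge)
  have "subset_max f J \<le> subset_max (\<lambda>J'. c + f J') J - c"
    by (rule subset_max_le) (use subset_max_ge[of _ J "\<lambda>J'. c + f J'"] in \<open>simp add: algebra_simps\<close>)
  then show "c + subset_max f J \<le> subset_max (\<lambda>J'. c + f J') J" by simp
qed

lemma subset_insert_cases:
  assumes "J' \<subseteq> insert v J"
  obtains "J' \<subseteq> J" | K where "K \<subseteq> J" "v \<notin> K" "J' = insert v K"
proof (cases "v \<in> J'")
  case True
  then show ?thesis using that(2)[of "J' - {v}"] assms by auto
next
  case False
  then show ?thesis using that(1) assms by auto
qed

text \<open>
  If adding \<open>v\<close> never increases \<open>f\<close>, one half of the cube has the maximum of the whole cube; if
  it never decreases \<open>f\<close>, the other half has.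
\<close>

lemma subset_max_insert_same:
  assumes "\<And>K. K \<subseteq> J \<Longrightarrow> v \<notin> K \<Longrightarrow> f (insert v K) \<le> f K"
  shows "subset_max f (insert v J) = subset_max f J"
proof (rule antisym)
  show "subset_max f (insert v J) \<le> subset_max f J"
  proof (rule subset_max_le)
    fix J' assume "J' \<subseteq> insert v J"
    then show "f J' \<le> subset_max f J"
    proof (cases rule: subset_insert_cases)
      case 1
      then show ?thesis by (rule subset_max_ge)
    next
      case (2 K)
      then show ?thesis using assms[of K] subset_max_ge[of K J f] by auto
    qed
  qed
  show "subset_max f J \<le> subset_max f (insert v J)"
    by (intro subset_max_le subset_max_ge) auto
qed

lemma subset_max_insert_shift:
  assumes "\<And>K. K \<subseteq> J \<Longrightarrow> v \<notin> K \<Longrightarrow> f K \<le> f (insert v K)"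
  shows "subset_max f (insert v J) = subset_max (\<lambda>K. f (insert v K)) J"
proof (rule antisym)
  show "subset_max f (insert v J) \<le> subset_max (\<lambda>K. f (insert v K)) J"
  proof (rule subset_max_le)
    fix J' assume "J' \<subseteq> insert v J"
    then show "f J' \<le> subset_max (\<lambda>K. f (insert v K)) J"
    proof (cases rule: subset_insert_cases)
      case 1
      show ?thesis
      proof (cases "v \<in> J'")
        case True
        then show ?thesis using subset_max_ge[OF 1, of "\<lambda>K. f (insert v K)"] by (simp add: insert_absorb)
      next
        case False
        then show ?thesis using assms[OF 1] subset_max_ge[OF 1, of "\<lambda>K. f (insert v K)"] by simp
      qed
    next
      case (2 K)
      then show ?thesis using subset_max_ge[of K J "\<lambda>K. f (insert v K)"] by simp
    qed
  qed
  show "subset_max (\<lambda>K. f (insert v K)) J \<le> subset_max f (insert v J)"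
    by (intro subset_max_le subset_max_ge) auto
qed

lemma sum_Pow_insert:
  assumes "finite U" "v \<notin> U"
  shows "(\<Sum>J\<in>Pow (insert v U). g J) = (\<Sum>J\<in>Pow U. g J + g (insert v J))"
proof -
  have "(\<Sum>J\<in>Pow (insert v U). g J) = (\<Sum>J\<in>Pow U. g J) + (\<Sum>J\<in>insert v ` Pow U. g J)"
    unfolding Pow_insert using assms by (intro sum.union_disjoint) auto
  also have "(\<Sum>J\<in>insert v ` Pow U. g J) = (\<Sum>J\<in>Pow U. g (insert v J))"
    using assms(2) by (subst sum.reindex) (auto simp: inj_on_def)
  finally show ?thesis by (simp add: sum.distrib)
qed

definition altsum :: "('v::finite set \<Rightarrow> rat) \<Rightarrow> 'v set \<Rightarrow> rat" where
  "altsum g U = (\<Sum>J\<in>Pow U. (-1) ^ card J * g J)"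

lemma altsum_insert:
  assumes "v \<notin> U"
  shows "altsum g (insert v U) = altsum (\<lambda>J. g J - g (insert v J)) U"
proof -
  have "card (insert v J) = Suc (card J)" if "J \<in> Pow U" for J
    using that assms by (intro card_insert_disjoint) auto
  then show ?thesis
    unfolding altsum_def sum_Pow_insert[OF finite assms] by (intro sum.cong) (auto simp: algebra_simps)
qed

lemma altsum_cong: "(\<And>J. J \<subseteq> U \<Longrightarrow> g J = g' J) \<Longrightarrow> altsum g U = altsum g' U"
  by (simp add: altsum_def)

lemma altsum_diff: "altsum (\<lambda>J. g J - g' J) U = altsum g U - altsum g' U"
  by (simp add: altsum_def algebra_simps sum_subtractf)

lemma altsum_add: "altsum (\<lambda>J. g J + g' J) U = altsum g U + altsum g' U"
  by (simp add: altsum_def algebra_simps sum.distrib)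

lemma altsum_empty [simp]: "altsum g {} = g {}"
  by (simp add: altsum_def)

text \<open>Alternating sums vanish if some vertex makes no difference, since its pairs of subsets cancel.\<close>

lemma altsum_insert_same:
  assumes "\<And>J. J \<subseteq> U \<Longrightarrow> g (insert v J) = g J" "v \<notin> U"
  shows "altsum g (insert v U) = 0"
proof -
  have "altsum g (insert v U) = altsum (\<lambda>J. g J - g (insert v J)) U"
    using assms(2) by (rule altsum_insert)
  also have "\<dots> = altsum (\<lambda>_. 0) U" by (rule altsum_cong) (simp add: assms(1))
  finally show ?thesis by (simp add: altsum_def)
qed

lemma altsum_const:
  assumes "U \<noteq> {}"
  shows "altsum (\<lambda>_. c) U = 0"
proof -
  obtain v where v: "v \<in> U" using assms by blast
  then have "U = insert v (U - {v})" by blast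
  then show ?thesis using altsum_insert_same[of "U - {v}" "\<lambda>_. c" v] by simp
qed

text \<open>The subtrees, built by adding one leaf after the other.\<close>

inductive subtree :: "('v \<Rightarrow> 'v \<Rightarrow> bool) \<Rightarrow> 'v set \<Rightarrow> bool" for R where
  single: "subtree R {v}"
| leaf: "subtree R U \<Longrightarrow> v \<notin> U \<Longrightarrow> u \<in> U \<Longrightarrow> R v u \<Longrightarrow> (\<And>w. w \<in> U \<Longrightarrow> R v w \<Longrightarrow> w = u) \<Longrightarrow> subtree R (insert v U)"

definition simple_path :: "('v \<Rightarrow> 'v \<Rightarrow> bool) \<Rightarrow> 'v set \<Rightarrow> 'v \<Rightarrow> 'v \<Rightarrow> 'v list \<Rightarrow> bool" where
  "simple_path R U x y p \<longleftrightarrow> p \<noteq> [] \<and> hd p = x \<and> last p = y \<and> distinct p \<and> set p \<subseteq> U \<and> successively R p"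

lemma subtree_path:
  assumes "subtree R U" and sym: "\<And>v w. R v w \<Longrightarrow> R w v" and "x \<in> U" "y \<in> U"
  shows "\<exists>p. simple_path R U x y p"
  using assms(1,3,4)
proof (induction arbitrary: x y)
  case (single v)
  then show ?case by (intro exI[of _ "[v]"]) (simp add: simple_path_def)
next
  case (leaf U v u)
  consider "x \<in> U" "y \<in> U" | "x = v" "y = v" | "x = v" "y \<in> U" | "x \<in> U" "y = v"
    using leaf.prems by auto
  then show ?case
  proof cases
    case 1
    then obtain p where "simple_path R U x y p" using leaf.IH[of x y] by blast
    then show ?thesis by (intro exI[of _ p]) (simp add: simple_path_def subset_insertI2)
  next
    case 2
    then show ?thesis by (intro exI[of _ "[v]"]) (simp add: simple_path_def)
  next
    case 3
    then obtain p where p: "simple_path R U u y p" using leaf.IH[of u y] \<open>u \<in> U\<close> by blast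
    then have "v \<notin> set p" using \<open>v \<notin> U\<close> by (auto simp: simple_path_def)
    then show ?thesis using 3 p \<open>R v u\<close>
      by (intro exI[of _ "v # p"]) (simp add: simple_path_def successively_Cons subset_insertI2)
  next
    case 4
    then obtain p where p: "simple_path R U x u p" using leaf.IH[of x u] \<open>u \<in> U\<close> by blast
    then have "v \<notin> set p" using \<open>v \<notin> U\<close> by (auto simp: simple_path_def)
    then show ?thesis using 4 p sym[OF \<open>R v u\<close>]
      by (intro exI[of _ "p @ [v]"]) (simp add: simple_path_def successively_append_iff subset_insertI2)
  qed
qed

context negdef_tree begin

text \<open>
  By connectedness some edge leaves \<open>U\<close>. A second edge from its end back to \<open>U\<close> would close a
  cycle with a path inside \<open>U\<close>.
\<close>

lemma subtree_extend:
  assumes "subtree (adj \<Gamma>) U" "U \<noteq> UNIV"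
  shows "\<exists>v. v \<notin> U \<and> subtree (adj \<Gamma>) (insert v U)"
proof -
  have "U \<noteq> {}" using assms(1) by cases auto
  then obtain x where x: "x \<in> U" by blast
  have "\<exists>u\<in>U. \<exists>v. v \<notin> U \<and> adj \<Gamma> u v"
  proof (rule ccontr)
    assume none: "\<not> (\<exists>u\<in>U. \<exists>v. v \<notin> U \<and> adj \<Gamma> u v)"
    have "y \<in> U" for y
      using adj_connected[of x y]
    proof induction
      case (step y z)
      then show ?case using none by blast
    qed (rule x)
    then show False using assms(2) by blast
  qed
  then obtain u v where uv: "u \<in> U" "v \<notin> U" "adj \<Gamma> u v" by blast
  have "w = u" if w: "w \<in> U" "adj \<Gamma> v w" for w
  proof (rule ccontr)
    assume "w \<noteq> u"
    obtain p where "simple_path (adj \<Gamma>) U u w p"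
      using subtree_path[OF assms(1) adj_sym uv(1) w(1)] by blast
    then have p: "p \<noteq> []" "hd p = u" "last p = w" "distinct p" "set p \<subseteq> U" "successively (adj \<Gamma>) p"
      by (simp_all add: simple_path_def)
    let ?q = "p @ [v]"
    have len: "2 \<le> length p"
    proof (cases p)
      case (Cons a p')
      then show ?thesis using p(2,3) \<open>w \<noteq> u\<close> by (cases p') auto
    qed (use p(1) in simp)
    have "is_cycle \<Gamma> ?q"
      unfolding is_cycle_def
    proof (intro conjI allI impI)
      show "3 \<le> length ?q" using len by simp
      have "v \<notin> set p" using p(5) uv(2) by blast
      then show "distinct ?q" using p(4) by simp
      fix i assume i: "i < length ?q"
      consider "Suc i < length p" | "Suc i = length p" | "i = length p" using i by force
      then show "adj \<Gamma> (?q ! i) (?q ! (Suc i mod length ?q))"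
      proof cases
        case 1
        then show ?thesis using p(6) by (simp add: nth_append successively_conv_nth)
      next
        case 2
        then have i': "i < length p" "length p - 1 = i" by linarith+
        then have "p ! i = w" using p(3) last_conv_nth[OF p(1)] by simp
        then have "?q ! i = w" using i'(1) by (simp add: nth_append)
        moreover have "?q ! (Suc i mod length ?q) = v" using 2 by simp
        ultimately show ?thesis using adj_sym[OF w(2)] by simp
      next
        case 3
        have "?q ! i = v" using 3 by simp
        moreover have "?q ! (Suc i mod length ?q) = u"
          using 3 p(1,2) by (simp add: nth_append hd_conv_nth)
        ultimately show ?thesis using adj_sym[OF uv(3)] by simp
      qed
    qed
    then show False using tree by (auto simp: is_tree_def)
  qed
  then have "subtree (adj \<Gamma>) (insert v U)"
    using subtree.leaf[OF assms(1) uv(2,1) adj_sym[OF uv(3)]] by blast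
  then show ?thesis using uv(2) by blast
qed

lemma subtree_UNIV: "subtree (adj \<Gamma>) UNIV"
proof -
  have "\<exists>U. subtree (adj \<Gamma>) U \<and> card U = Suc n" if "Suc n \<le> card (UNIV :: 'v set)" for n
    using that
  proof (induction n)
    case 0
    show ?case by (intro exI[of _ "{undefined}"]) (auto intro: subtree.single)
  next
    case (Suc n)
    then obtain U where U: "subtree (adj \<Gamma>) U" "card U = Suc n" by auto
    then have "U \<noteq> UNIV" using Suc.prems by auto
    then obtain v where "v \<notin> U" "subtree (adj \<Gamma>) (insert v U)" using subtree_extend U(1) by blast
    then show ?case using U(2) by (intro exI[of _ "insert v U"]) simp
  qed
  moreover obtain n where "card (UNIV :: 'v set) = Suc n"
    by (metis UNIV_not_empty card_0_eq finite not0_implies_Suc)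
  ultimately obtain U where "subtree (adj \<Gamma>) U" "card U = card (UNIV :: 'v set)" by auto
  then show ?thesis by (metis card_subset_eq finite subset_UNIV)
qed

definition edge_count :: "'v set \<Rightarrow> rat" where
  "edge_count J = of_nat (card {(v, w). v \<in> J \<and> w \<in> J \<and> adj \<Gamma> v w}) / 2"

text \<open>The difference \<open>\<chi>(l + E\<^sub>J) - \<chi>(l)\<close> for \<open>l = \<Sum>k\<^sub>v E\<^sup>*\<^sub>v\<close>; see \<open>chi_add_ind\<close>.\<close>

definition cube_value :: "('v \<Rightarrow> int) \<Rightarrow> 'v set \<Rightarrow> rat" where
  "cube_value k J = (\<Sum>v\<in>J. of_int (k v) + 1) - edge_count J"

lemma edge_count_insert:
  assumes "v \<notin> J"
  shows "edge_count (insert v J) = edge_count J + of_nat (card {w \<in> J. adj \<Gamma> v w})"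
proof -
  let ?N = "{w \<in> J. adj \<Gamma> v w}"
  let ?P = "\<lambda>J. {(v, w). v \<in> J \<and> w \<in> J \<and> adj \<Gamma> v w}"
  have eq: "?P (insert v J) = ?P J \<union> (Pair v ` ?N \<union> (\<lambda>w. (w, v)) ` ?N)"
    using adj_irrefl adj_sym by blast
  have "card (?P J \<union> (Pair v ` ?N \<union> (\<lambda>w. (w, v)) ` ?N)) = card (?P J) + card (Pair v ` ?N \<union> (\<lambda>w. (w, v)) ` ?N)"
    using assms by (intro card_Un_disjoint finite) blast
  moreover have "card (Pair v ` ?N \<union> (\<lambda>w. (w, v)) ` ?N) = card (Pair v ` ?N) + card ((\<lambda>w. (w, v)) ` ?N)"
    using assms by (intro card_Un_disjoint finite) blast
  moreover have "card (Pair v ` ?N) = card ?N" by (rule card_image) (simp add: inj_on_def)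
  moreover have "card ((\<lambda>w. (w, v)) ` ?N) = card ?N" by (rule card_image) (simp add: inj_on_def)
  ultimately have "card (?P (insert v J)) = card (?P J) + 2 * card ?N"
    unfolding eq by linarith
  then show ?thesis unfolding edge_count_def by simp
qed

lemma cube_value_insert:
  assumes "v \<notin> J"
  shows "cube_value k (insert v J) = cube_value k J + of_int (k v) + 1 - of_nat (card {w \<in> J. adj \<Gamma> v w})"
  using assms by (simp add: cube_value_def edge_count_insert)

lemma cube_value_empty [simp]: "cube_value k {} = 0"
  by (simp add: cube_value_def edge_count_def)

text \<open>
  Let \<open>v\<close> be a leaf attached to \<open>u\<close>. If \<open>k\<^sub>v < 0\<close>, adding \<open>v\<close> to a set never increases its value,
  so the subsets with and without \<open>v\<close> cancel. If \<open>k\<^sub>v \<ge> 0\<close>, it never decreases it, and it costs an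
  edge exactly if \<open>u\<close> is present; thus the sum is a difference of the sums for the smaller tree
  at \<open>k\<^sub>u\<close> and \<open>k\<^sub>u - 1\<close>, which is multiplication by \<open>1 - x\<close> in the variable of \<open>u\<close>.
\<close>

lemma altsum_cube_value:
  assumes "subtree (adj \<Gamma>) U"
  shows "altsum (subset_max (cube_value k)) U = - of_int (\<Prod>v\<in>U. vertex_coeff (card {w \<in> U. adj \<Gamma> v w}) (k v))"
  using assms
proof (induction arbitrary: k)
  case (single v)
  have "subset_max (cube_value k) {v} = max 0 (of_int (k v) + 1)"
    by (simp add: subset_max_def Pow_insert cube_value_insert)
  moreover have "altsum g {v} = g {} - g {v}" for g using altsum_insert[of v "{}"] by simp
  moreover have "{w \<in> {v}. adj \<Gamma> v w} = {}" using adj_irrefl by blast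
  moreover have "max 0 (rat_of_int (k v) + 1) = of_int (vertex_coeff 0 (k v))"
    by (auto simp: vertex_coeff_def max_def)
  ultimately show ?case by (simp del: Collect_empty_eq empty_Collect_eq)
next
  case (leaf U v u)
  have nbr: "{w \<in> J. adj \<Gamma> v w} = (if u \<in> J then {u} else {})" if "J \<subseteq> U" for J
  proof -
    have "adj \<Gamma> v w \<longleftrightarrow> w = u" if "w \<in> U" for w using leaf.hyps(4,5) that by blast
    then show ?thesis using that by auto
  qed
  have vJ: "v \<notin> J" if "J \<subseteq> U" for J using leaf.hyps that by blast
  have val: "cube_value k (insert v J) = cube_value k J + of_int (k v) + 1 - (if u \<in> J then 1 else 0)"
    if "J \<subseteq> U" for J k
    using cube_value_insert[OF vJ[OF that]] nbr[OF that] by simp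
  have deg_v: "{w \<in> insert v U. adj \<Gamma> v w} = {u}"
  proof -
    have "{w \<in> insert v U. adj \<Gamma> v w} = {w \<in> U. adj \<Gamma> v w}" using adj_irrefl by blast
    then show ?thesis using nbr[OF subset_refl] leaf.hyps(3) by simp
  qed
  let ?d = "\<lambda>w. card {x \<in> U. adj \<Gamma> w x}" and ?d' = "\<lambda>w. card {x \<in> insert v U. adj \<Gamma> w x}"
  have deg_u: "?d' u = Suc (?d u)"
  proof -
    have "{x \<in> insert v U. adj \<Gamma> u x} = insert v {x \<in> U. adj \<Gamma> u x}"
      using adj_sym[OF leaf.hyps(4)] by auto
    then show ?thesis using leaf.hyps(2) by simp
  qed
  have deg: "?d' w = ?d w" if "w \<in> U" "w \<noteq> u" for w
  proof -
    have "\<not> adj \<Gamma> w v" using leaf.hyps(5) that adj_sym by blast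
    then have "{x \<in> insert v U. adj \<Gamma> w x} = {x \<in> U. adj \<Gamma> w x}" by auto
    then show ?thesis by simp
  qed
  show ?case
  proof (cases "k v < 0")
    case True
    have "subset_max (cube_value k) (insert v J) = subset_max (cube_value k) J" if "J \<subseteq> U" for J
    proof (rule subset_max_insert_same)
      fix K assume "K \<subseteq> J"
      moreover have "rat_of_int (k v) + 1 \<le> 0" using True by linarith
      ultimately show "cube_value k (insert v K) \<le> cube_value k K"
        using val[of K k] that by auto
    qed
    then have "altsum (subset_max (cube_value k)) (insert v U) = 0"
      using leaf.hyps(2) by (rule altsum_insert_same)
    moreover have "(\<Prod>w\<in>insert v U. vertex_coeff (?d' w) (k w)) = 0"
      using vertex_coeff_neg[OF True] by (intro prod_zero bexI[of _ v]) auto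
    ultimately show ?thesis by simp
  next
    case False
    define k' where "k' = k(u := k u - 1)"
    have val': "cube_value k' J = cube_value k J - (if u \<in> J then 1 else 0)" for J
    proof (cases "u \<in> J")
      case True
      have "(\<Sum>v\<in>J. of_int (k' v) + 1) = (\<Sum>v\<in>J. (of_int (k v) + 1) - (if v = u then 1 else 0 :: rat))"
        by (intro sum.cong) (auto simp: k'_def)
      then show ?thesis using True by (simp add: cube_value_def sum_subtractf)
    next
      case False
      then have "(\<Sum>v\<in>J. of_int (k' v) + 1 :: rat) = (\<Sum>v\<in>J. of_int (k v) + 1)"
        by (intro sum.cong) (auto simp: k'_def)
      then show ?thesis using False by (simp add: cube_value_def)
    qed
    have ins: "subset_max (cube_value k) (insert v J) = (of_int (k v) + 1) + subset_max (cube_value k') J" if "J \<subseteq> U" for J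
    proof -
      have "subset_max (cube_value k) (insert v J) = subset_max (\<lambda>K. cube_value k (insert v K)) J"
      proof (rule subset_max_insert_shift)
        fix K assume "K \<subseteq> J"
        then show "cube_value k K \<le> cube_value k (insert v K)"
          using val[of K k] that False by auto
      qed
      also have "\<dots> = subset_max (\<lambda>K. (of_int (k v) + 1) + cube_value k' K) J"
        using that by (intro subset_max_cong) (auto simp: val val')
      finally show ?thesis by (simp only: subset_max_add)
    qed
    have "U \<noteq> {}" using leaf.hyps(3) by blast
    have "altsum (subset_max (cube_value k)) (insert v U)
        = altsum (\<lambda>J. subset_max (cube_value k) J - subset_max (cube_value k) (insert v J)) U"
      using leaf.hyps(2) by (rule altsum_insert)
    also have "\<dots> = altsum (\<lambda>J. subset_max (cube_value k) J - ((of_int (k v) + 1) + subset_max (cube_value k') J)) U"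
      by (intro altsum_cong) (simp add: ins)
    also have "\<dots> = altsum (subset_max (cube_value k)) U - altsum (subset_max (cube_value k')) U"
      using altsum_const[OF \<open>U \<noteq> {}\<close>] by (simp only: altsum_diff altsum_add)
    also have "\<dots> = of_int (- (\<Prod>w\<in>insert v U. vertex_coeff (?d' w) (k w)))"
    proof -
      define r where "r = (\<Prod>w\<in>U - {u}. vertex_coeff (?d w) (k w))"
      have split: "(\<Prod>w\<in>U. f w) = f u * (\<Prod>w\<in>U - {u}. f w)" for f :: "'v \<Rightarrow> int"
        by (rule prod.remove[OF finite \<open>u \<in> U\<close>])
      have 1: "(\<Prod>w\<in>U. vertex_coeff (?d w) (k w)) = vertex_coeff (?d u) (k u) * r"
        unfolding r_def by (rule split)
      have "(\<Prod>w\<in>U - {u}. vertex_coeff (?d w) (k' w)) = r"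
        unfolding r_def by (intro prod.cong) (auto simp: k'_def)
      then have 2: "(\<Prod>w\<in>U. vertex_coeff (?d w) (k' w)) = vertex_coeff (?d u) (k u - 1) * r"
        unfolding split by (simp add: k'_def)
      have "(\<Prod>w\<in>U - {u}. vertex_coeff (?d' w) (k w)) = r"
        unfolding r_def by (intro prod.cong refl) (metis DiffD1 DiffD2 deg singletonI)
      then have 3: "(\<Prod>w\<in>U. vertex_coeff (?d' w) (k w)) = (vertex_coeff (?d u) (k u) - vertex_coeff (?d u) (k u - 1)) * r"
        unfolding split deg_u by (simp add: vertex_coeff_def backward_diff_def)
      have "vertex_coeff (?d' v) (k v) = 1"
        unfolding deg_v using False by (simp add: vertex_coeff_def backward_diff_def)
      then have "(\<Prod>w\<in>insert v U. vertex_coeff (?d' w) (k w)) = (\<Prod>w\<in>U. vertex_coeff (?d' w) (k w))"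
        using prod.insert[OF finite \<open>v \<notin> U\<close>, of "\<lambda>w. vertex_coeff (?d' w) (k w)"] by simp
      then have 4: "(\<Prod>w\<in>insert v U. vertex_coeff (?d' w) (k w)) = (vertex_coeff (?d u) (k u) - vertex_coeff (?d u) (k u - 1)) * r"
        unfolding 3 .
      show ?thesis unfolding 4 leaf.IH 1 2 by (simp add: algebra_simps)
    qed
    finally show ?thesis by simp
  qed
qed

text \<open>The Riemann--Roch function.\<close>

definition chi :: "'v qvec \<Rightarrow> rat" where
  "chi x = - (form \<Gamma> x x - form \<Gamma> x (ZK \<Gamma>)) / 2"

lemma form_add_left: "form \<Gamma> (x + y) z = form \<Gamma> x z + form \<Gamma> y z"
  and form_diff_left: "form \<Gamma> (x - y) z = form \<Gamma> x z - form \<Gamma> y z"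
  and form_add_right: "form \<Gamma> z (x + y) = form \<Gamma> z x + form \<Gamma> z y"
  and form_diff_right: "form \<Gamma> z (x - y) = form \<Gamma> z x - form \<Gamma> z y"
  by (simp_all add: form_def algebra_simps sum.distrib sum_subtractf)

lemma chi_add: "chi (x + y) = chi x + chi y - form \<Gamma> x y"
  by (simp add: chi_def form_add_left form_add_right form_sym[of y x] field_simps)

lemma chi_reflect: "chi (ZK \<Gamma> - x) = chi x"
  by (simp add: chi_def form_diff_left form_diff_right form_sym[of "ZK \<Gamma>" x] field_simps)

definition ind :: "'v set \<Rightarrow> 'v qvec" where
  "ind J = Qvec (\<lambda>v. if v \<in> J then 1 else 0)"

lemma coord_ind [simp]: "coord (ind J) v = (if v \<in> J then 1 else 0)"
  by (simp add: ind_def)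

lemma ind_empty [simp]: "ind {} = 0"
  by (simp add: qvec_eq_iff)

lemma form_ind: "form \<Gamma> x (ind J) = - (\<Sum>v\<in>J. dual_coord x v)"
proof -
  have "(\<Sum>v\<in>UNIV. coord (ind J) v * dual_coord x v) = (\<Sum>v\<in>UNIV. if v \<in> J then dual_coord x v else 0)"
    by (intro sum.cong) auto
  then show ?thesis by (simp add: form_dual_coord sum.If_cases)
qed

lemma form_ind_ind: "form \<Gamma> (ind J) (ind J) = (\<Sum>v\<in>J. of_int (euler \<Gamma> v)) + 2 * edge_count J"
proof -
  have "dual_coord (ind J) v = - of_int (euler \<Gamma> v) - of_nat (card {w \<in> J. adj \<Gamma> v w})" if "v \<in> J" for v
  proof -
    have 1: "pairing \<Gamma> (coord (ind J)) v = of_int (euler \<Gamma> v) + (\<Sum>u\<in>UNIV - {v}. if u \<in> J \<and> adj \<Gamma> u v then 1 else 0)"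
      unfolding pairing_split using that by (auto intro!: sum.cong split: if_splits)
    have 2: "(\<Sum>u\<in>UNIV - {v}. if u \<in> J \<and> adj \<Gamma> u v then 1 else 0 :: rat) = of_nat (card {u \<in> UNIV - {v}. u \<in> J \<and> adj \<Gamma> u v})"
      by (simp flip: sum.inter_filter)
    have 3: "{u \<in> UNIV - {v}. u \<in> J \<and> adj \<Gamma> u v} = {w \<in> J. adj \<Gamma> v w}" using adj_irrefl adj_sym by auto
    show ?thesis unfolding dual_coord_def 1 2 3 by linarith
  qed
  then have "(\<Sum>v\<in>J. dual_coord (ind J) v) = (\<Sum>v\<in>J. - of_int (euler \<Gamma> v) - of_nat (card {w \<in> J. adj \<Gamma> v w}))"
    by (rule sum.cong[OF refl])
  then have "(\<Sum>v\<in>J. dual_coord (ind J) v) = - (\<Sum>v\<in>J. of_int (euler \<Gamma> v)) - of_nat (\<Sum>v\<in>J. card {w \<in> J. adj \<Gamma> v w})"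
    by (simp only: sum_negf sum_subtractf of_nat_sum)
  then have "form \<Gamma> (ind J) (ind J) = (\<Sum>v\<in>J. of_int (euler \<Gamma> v)) + of_nat (\<Sum>v\<in>J. card {w \<in> J. adj \<Gamma> v w})"
    unfolding form_ind by linarith
  moreover have "(\<Sum>v\<in>J. card {w \<in> J. adj \<Gamma> v w}) = card {(v, w). v \<in> J \<and> w \<in> J \<and> adj \<Gamma> v w}"
  proof -
    have "{(v, w). v \<in> J \<and> w \<in> J \<and> adj \<Gamma> v w} = (SIGMA v:J. {w \<in> J. adj \<Gamma> v w})" by auto
    then show ?thesis by simp
  qed
  ultimately show ?thesis unfolding edge_count_def by simp
qed

lemma chi_add_ind: "chi (x + ind J) = chi x + (\<Sum>v\<in>J. dual_coord x v + 1) - edge_count J"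
proof -
  have "chi (ind J) = of_nat (card J) - edge_count J"
  proof -
    have "form \<Gamma> (ind J) (ZK \<Gamma>) = (\<Sum>v\<in>J. of_int (euler \<Gamma> v) + 2)"
      unfolding form_sym[of "ind J" "ZK \<Gamma>"] form_ind by (simp add: add.commute flip: sum_negf)
    then have "form \<Gamma> (ind J) (ZK \<Gamma>) = (\<Sum>v\<in>J. of_int (euler \<Gamma> v)) + 2 * of_nat (card J)"
      by (simp add: sum.distrib)
    then show ?thesis unfolding chi_def form_ind_ind by simp
  qed
  then show ?thesis by (simp add: chi_add form_ind sum.distrib)
qed

definition cube_weight :: "('v qvec \<Rightarrow> rat) \<Rightarrow> 'v qvec \<Rightarrow> 'v set \<Rightarrow> rat" where
  "cube_weight \<phi> l J = subset_max (\<lambda>J'. \<phi> (l + ind J')) J"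

text \<open>The constant \<open>\<chi>(l)\<close> drops out of the alternating sum, and the subtree is the whole graph.\<close>

lemma zcoeff_cubes:
  assumes "l \<in> dualL \<Gamma>"
  shows "altsum (cube_weight chi l) UNIV = - of_int (zcoeff \<Gamma> l)"
proof -
  define k where "k = (\<lambda>v. \<lfloor>dual_coord l v\<rfloor>)"
  have k: "of_int (k v) = dual_coord l v" for v
    using assms by (auto simp: k_def dualL_iff elim: Ints_cases)
  have "cube_weight chi l J = chi l + subset_max (cube_value k) J" for J
    unfolding cube_weight_def subset_max_add[symmetric]
    by (intro subset_max_cong) (simp add: chi_add_ind cube_value_def k)
  then have "altsum (cube_weight chi l) UNIV = altsum (\<lambda>J. chi l + subset_max (cube_value k) J) UNIV"
    by (intro altsum_cong)
  also have "\<dots> = altsum (subset_max (cube_value k)) UNIV"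
    by (simp add: altsum_add altsum_const)
  also have "\<dots> = - of_int (\<Prod>v\<in>UNIV. vertex_coeff (valency \<Gamma> v) (k v))"
    using altsum_cube_value[OF subtree_UNIV, of k] by (simp add: valency_def)
  finally show ?thesis by (simp add: zcoeff_prod[OF assms] k_def)
qed

text \<open>
  If \<open>k\<^sub>v < 0\<close>, adding \<open>v\<close> never increases \<open>\<chi>\<close>, so the cubes with and without the direction \<open>v\<close>
  have the same weight and cancel.
\<close>

lemma altsum_cube_weight_0:
  assumes "v \<in> U" "dual_coord l v \<le> - 1"
  shows "altsum (cube_weight chi l) U = 0"
proof -
  have "cube_weight chi l (insert v J) = cube_weight chi l J" for J
    unfolding cube_weight_def
  proof (rule subset_max_insert_same)
    fix K assume "v \<notin> K"
    then show "chi (l + ind (insert v K)) \<le> chi (l + ind K)"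
      using assms(2) by (simp add: chi_add_ind edge_count_insert)
  qed
  then have "altsum (cube_weight chi l) (insert v (U - {v})) = 0" by (intro altsum_insert_same) auto
  then show ?thesis using assms(1) by (simp add: insert_absorb)
qed

end

section \<open>Euler characteristics of boxes\<close>

text \<open>The coordinatewise order, in which boxes are intervals.\<close>

definition below :: "'v qvec \<Rightarrow> 'v qvec \<Rightarrow> bool" where
  "below x y \<longleftrightarrow> (\<forall>v. coord x v \<le> coord y v)"

lemma below_refl [simp]: "below x x"
  by (simp add: below_def)

lemma below_trans: "below x y \<Longrightarrow> below y z \<Longrightarrow> below x z"
  unfolding below_def using order_trans by blast

lemma basisE_latL [simp]: "basisE v \<in> latL"
  by (simp add: latL_def)

lemma latL_trans: "x - y \<in> latL \<Longrightarrow> y - z \<in> latL \<Longrightarrow> x - z \<in> latL"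
  using latL_add[of "x - y" "y - z"] by simp

lemma latL_minus_commute: "x - y \<in> latL \<Longrightarrow> y - x \<in> latL"
  using latL_uminus[of "x - y"] by simp

lemma latL_less_le:
  assumes "x - y \<in> latL" "coord y v < coord x v"
  shows "coord y v + 1 \<le> coord x v"
proof -
  have "coord x v - coord y v \<in> \<int>" using assms(1) by (simp add: latL_def)
  then obtain k :: int where k: "coord x v - coord y v = of_int k" by (rule Ints_cases)
  have "0 < rat_of_int k" unfolding k[symmetric] using assms(2) by simp
  then have "1 \<le> k" by simp
  then have "1 \<le> rat_of_int k" by simp
  then show ?thesis unfolding k[symmetric] by simp
qed

text \<open>A measure for inductions that move a corner of a box by one \<open>E\<^sub>v\<close> at a time.\<close>

definition steps :: "'v::finite qvec \<Rightarrow> nat" where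
  "steps d = nat \<lfloor>\<Sum>v\<in>UNIV. coord d v\<rfloor>"

lemma steps_decreases:
  assumes "\<And>u. 0 \<le> coord d u" "1 \<le> coord d v"
  shows "steps (d - basisE v) < steps d"
proof -
  have "(\<Sum>u\<in>UNIV. coord (d - basisE v) u) = (\<Sum>u\<in>UNIV. coord d u) - 1"
    by (simp add: sum_subtractf)
  moreover have "coord d v \<le> (\<Sum>u\<in>UNIV. coord d u)"
    using assms(1) by (intro member_le_sum) auto
  ultimately show ?thesis unfolding steps_def using assms(2) by linarith
qed

context negdef_tree begin

text \<open>The cubes in the box between \<open>a\<close> and \<open>b\<close>, given by their least vertex and their directions.\<close>

definition cubes :: "'v qvec \<Rightarrow> 'v qvec \<Rightarrow> ('v qvec \<times> 'v set) set" where
  "cubes a b = {(l, J). l - a \<in> latL \<and> below a l \<and> below (l + ind J) b}"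

definition euler_char :: "('v qvec \<Rightarrow> rat) \<Rightarrow> 'v qvec \<Rightarrow> 'v qvec \<Rightarrow> rat" where
  "euler_char \<phi> a b = (\<Sum>(l, J)\<in>cubes a b. (-1) ^ card J * cube_weight \<phi> l J)"

lemma finite_box: "finite {l :: 'v qvec. l - a \<in> latL \<and> below a l \<and> below l b}"
proof -
  have fin: "finite {l :: 'v qvec. \<forall>v. of_nat 1 * coord l v \<in> \<int> \<and> 0 \<le> coord l v \<and> coord l v \<le> coord (b - a) v}"
    by (rule finite_lattice_box) simp
  have "{l. l - a \<in> latL \<and> below a l \<and> below l b}
      \<subseteq> (\<lambda>d. a + d) ` {l. \<forall>v. of_nat 1 * coord l v \<in> \<int> \<and> 0 \<le> coord l v \<and> coord l v \<le> coord (b - a) v}"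
  proof
    fix l assume "l \<in> {l. l - a \<in> latL \<and> below a l \<and> below l b}"
    then have "l - a \<in> {l. \<forall>v. of_nat 1 * coord l v \<in> \<int> \<and> 0 \<le> coord l v \<and> coord l v \<le> coord (b - a) v}"
      by (auto simp: latL_def below_def)
    then show "l \<in> (\<lambda>d. a + d) ` {l. \<forall>v. of_nat 1 * coord l v \<in> \<int> \<and> 0 \<le> coord l v \<and> coord l v \<le> coord (b - a) v}"
      by (intro image_eqI[of _ _ "l - a"]) auto
  qed
  then show ?thesis by (rule finite_subset) (intro finite_imageI fin)
qed

lemma below_add_ind: "below (l + ind J) b \<Longrightarrow> below l b"
  unfolding below_def by (metis add_increasing2 coord_ind coord_plus dual_order.trans order_refl zero_le_one)

lemma finite_cubes: "finite (cubes a b)"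
proof (rule finite_subset)
  show "cubes a b \<subseteq> {l. l - a \<in> latL \<and> below a l \<and> below l b} \<times> UNIV"
    using below_add_ind by (auto simp: cubes_def)
qed (intro finite_cartesian_product finite_box finite)

lemma ind_insert: "v \<notin> J \<Longrightarrow> ind (insert v J) = basisE v + ind J"
  by (auto simp: qvec_eq_iff)

text \<open>
  Moving the upper corner from \<open>b\<close> to \<open>b + E\<^sub>v\<close> adds the cubes inside the new face and those
  that join it to the old one. If the values do not decrease towards the new face, these
  cancel in pairs.
\<close>

lemma euler_char_grow:
  assumes ba: "b - a \<in> latL" and v: "coord a v \<le> coord b v"
    and incr: "\<And>y. below y b \<Longrightarrow> coord y v = coord b v \<Longrightarrow> \<phi> y \<le> \<phi> (y + basisE v)"
  shows "euler_char \<phi> a (b + basisE v) = euler_char \<phi> a b"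
proof -
  let ?g = "\<lambda>(l, J). (-1) ^ card J * cube_weight \<phi> l J"
  define X where "X = {(l, J). (l, J) \<in> cubes a (b + basisE v) \<and> v \<in> J \<and> coord l v = coord b v}"
  define Y where "Y = {(l, J). (l, J) \<in> cubes a (b + basisE v) \<and> v \<notin> J \<and> coord l v = coord b v + 1}"
  have corner: "coord (l + ind J) u \<le> coord b u + (if u = v then 1 else 0)" if "(l, J) \<in> cubes a (b + basisE v)" for l J u
    using that by (auto simp: cubes_def below_def)
  have "cubes a (b + basisE v) = cubes a b \<union> (X \<union> Y)"
  proof (intro set_eqI iffI)
    fix c assume c: "c \<in> cubes a (b + basisE v)"
    obtain l J where lJ: "c = (l, J)" by force
    have l: "l - a \<in> latL" "below a l" using c by (auto simp: lJ cubes_def)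
    show "c \<in> cubes a b \<union> (X \<union> Y)"
    proof (cases "coord (l + ind J) v \<le> coord b v")
      case True
      then have "coord (l + ind J) u \<le> coord b u" for u
        using corner[of l J u] c by (cases "u = v") (auto simp: lJ)
      then show ?thesis using l by (simp add: lJ cubes_def below_def)
    next
      case False
      have "ind J \<in> latL" by (auto simp: latL_def)
      then have "(l + ind J) - b \<in> latL"
        using latL_add[OF latL_trans[OF l(1) latL_minus_commute[OF ba]], of "ind J"] by (simp add: algebra_simps)
      then have "coord b v + 1 \<le> coord (l + ind J) v" using False by (intro latL_less_le) auto
      then have "coord (l + ind J) v = coord b v + 1" using corner[of l J v] c by (auto simp: lJ)
      then show ?thesis using c by (auto simp: lJ X_def Y_def split: if_splits)
    qed
  next
    fix c assume "c \<in> cubes a b \<union> (X \<union> Y)"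
    moreover have "cubes a b \<subseteq> cubes a (b + basisE v)"
      by (auto simp: cubes_def below_def add_increasing2)
    ultimately show "c \<in> cubes a (b + basisE v)" by (auto simp: X_def Y_def)
  qed
  moreover have "cubes a b \<inter> (X \<union> Y) = {}"
    by (auto simp: X_def Y_def cubes_def below_def dest: spec[of _ v])
  moreover have "X \<inter> Y = {}" by (auto simp: X_def Y_def)
  moreover have fin: "finite X" "finite Y"
    unfolding X_def Y_def by (rule finite_subset[OF _ finite_cubes[of a "b + basisE v"]]; auto)+
  ultimately have "euler_char \<phi> a (b + basisE v) = euler_char \<phi> a b + (sum ?g X + sum ?g Y)"
    unfolding euler_char_def by (simp add: sum.union_disjoint finite_cubes)
  moreover have "sum ?g X = (\<Sum>c\<in>Y. - ?g c)"
  proof (rule sum.reindex_bij_witness[of _ "\<lambda>(l, J). (l - basisE v, insert v J)" "\<lambda>(l, J). (l + basisE v, J - {v})"])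
    fix c assume c: "c \<in> X"
    obtain l J where lJ: "c = (l, J)" by force
    have J: "v \<in> J" "J = insert v (J - {v})" and lv: "coord l v = coord b v" and cub: "(l, J) \<in> cubes a (b + basisE v)"
      using c by (auto simp: X_def lJ)
    show "(case case c of (l, J) \<Rightarrow> (l + basisE v, J - {v}) of (l, J) \<Rightarrow> (l - basisE v, insert v J)) = c"
      using J by (simp add: lJ insert_absorb)
    have corner_eq: "l + basisE v + ind (J - {v}) = l + ind J"
      using ind_insert[of v "J - {v}"] J by (simp add: algebra_simps)
    have "below (l + basisE v + ind (J - {v})) (b + basisE v)"
      unfolding corner_eq using cub by (simp add: cubes_def)
    moreover have "l + basisE v - a \<in> latL" "below a (l + basisE v)"
      using cub latL_add[of "l - a" "basisE v"] by (auto simp: cubes_def below_def algebra_simps add_increasing2)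
    ultimately show "(case c of (l, J) \<Rightarrow> (l + basisE v, J - {v})) \<in> Y"
      using cub lv by (simp add: lJ Y_def cubes_def)
    have "cube_weight \<phi> l (insert v (J - {v})) = subset_max (\<lambda>K. \<phi> (l + ind (insert v K))) (J - {v})"
      unfolding cube_weight_def
    proof (rule subset_max_insert_shift)
      fix K assume K: "K \<subseteq> J - {v}" "v \<notin> K"
      have "below (l + ind K) b"
        unfolding below_def
      proof
        fix u
        show "coord (l + ind K) u \<le> coord b u"
          using corner[OF cub, of u] lv K by (cases "u = v") (auto split: if_splits)
      qed
      then have "\<phi> (l + ind K) \<le> \<phi> (l + ind K + basisE v)" using lv K by (intro incr) auto
      then show "\<phi> (l + ind K) \<le> \<phi> (l + ind (insert v K))"
        using K by (simp add: ind_insert algebra_simps)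
    qed
    also have "\<dots> = cube_weight \<phi> (l + basisE v) (J - {v})"
      unfolding cube_weight_def
    proof (rule subset_max_cong)
      fix K assume "K \<subseteq> J - {v}"
      then have "v \<notin> K" by blast
      then show "\<phi> (l + ind (insert v K)) = \<phi> (l + basisE v + ind K)"
        by (simp add: ind_insert algebra_simps)
    qed
    finally have "cube_weight \<phi> l J = cube_weight \<phi> (l + basisE v) (J - {v})" using J by simp
    moreover have "card J = Suc (card (J - {v}))" by (rule card_Suc_Diff1[OF finite J(1), symmetric])
    ultimately show "- (case case c of (l, J) \<Rightarrow> (l + basisE v, J - {v}) of (l, J) \<Rightarrow> (- 1) ^ card J * cube_weight \<phi> l J)
        = (case c of (l, J) \<Rightarrow> (- 1) ^ card J * cube_weight \<phi> l J)"
      by (simp add: lJ)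
  next
    fix c assume c: "c \<in> Y"
    obtain l J where lJ: "c = (l, J)" by force
    have J: "v \<notin> J" and lv: "coord l v = coord b v + 1" and cub: "(l, J) \<in> cubes a (b + basisE v)"
      using c by (auto simp: Y_def lJ)
    show "(case case c of (l, J) \<Rightarrow> (l - basisE v, insert v J) of (l, J) \<Rightarrow> (l + basisE v, J - {v})) = c"
      using J by (simp add: lJ)
    have corner_eq: "l - basisE v + ind (insert v J) = l + ind J" using J by (simp add: ind_insert)
    have "below (l - basisE v + ind (insert v J)) (b + basisE v)"
      unfolding corner_eq using cub by (simp add: cubes_def)
    moreover have "l - basisE v - a \<in> latL"
      using cub latL_diff[of "l - a" "basisE v"] by (simp add: cubes_def algebra_simps)
    moreover have "below a (l - basisE v)"
      using cub lv v by (auto simp: cubes_def below_def)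
    ultimately show "(case c of (l, J) \<Rightarrow> (l - basisE v, insert v J)) \<in> X"
      using cub lv by (simp add: lJ X_def cubes_def)
  qed
  ultimately show ?thesis by (simp add: sum_negf)
qed

lemma cube_weight_reflect:
  "cube_weight \<phi> l J = cube_weight (\<lambda>x. \<phi> (c - x)) (c - (l + ind J)) J"
proof -
  have eq: "c - (c - (l + ind J) + ind J') = l + ind (J - J')" if "J' \<subseteq> J" for J'
    using that by (auto simp: qvec_eq_iff)
  show ?thesis
    unfolding cube_weight_def
  proof (rule antisym)
    show "subset_max (\<lambda>J'. \<phi> (l + ind J')) J \<le> subset_max (\<lambda>J'. \<phi> (c - (c - (l + ind J) + ind J'))) J"
    proof (rule subset_max_le)
      fix K assume K: "K \<subseteq> J"
      then have "J - (J - K) = K" by blast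
      then have "\<phi> (l + ind K) = \<phi> (c - (c - (l + ind J) + ind (J - K)))"
        by (simp only: eq[OF Diff_subset])
      also have "\<dots> \<le> subset_max (\<lambda>J'. \<phi> (c - (c - (l + ind J) + ind J'))) J"
        by (rule subset_max_ge[of "J - K" J "\<lambda>J'. \<phi> (c - (c - (l + ind J) + ind J'))"]) simp
      finally show "\<phi> (l + ind K) \<le> subset_max (\<lambda>J'. \<phi> (c - (c - (l + ind J) + ind J'))) J" .
    qed
    show "subset_max (\<lambda>J'. \<phi> (c - (c - (l + ind J) + ind J'))) J \<le> subset_max (\<lambda>J'. \<phi> (l + ind J')) J"
    proof (rule subset_max_le)
      fix K assume K: "K \<subseteq> J"
      show "\<phi> (c - (c - (l + ind J) + ind K)) \<le> subset_max (\<lambda>J'. \<phi> (l + ind J')) J"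
        unfolding eq[OF K] by (rule subset_max_ge[of "J - K" J "\<lambda>J'. \<phi> (l + ind J')"]) simp
    qed
  qed
qed

text \<open>A point reflection exchanges the least and the greatest vertex of a cube.\<close>

lemma euler_char_reflect:
  assumes "b - a \<in> latL"
  shows "euler_char \<phi> a b = euler_char (\<lambda>x. \<phi> (c - x)) (c - b) (c - a)"
proof -
  have L: "ind J \<in> latL" for J :: "'v set" by (auto simp: latL_def)
  have cub: "(c - (l + ind J), J) \<in> cubes (c - b) (c - a)" if "(l, J) \<in> cubes a b" "b - a \<in> latL" for l J a b
  proof -
    have "l - a \<in> latL" using that(1) by (simp add: cubes_def)
    then have "b - a - (l - a) - ind J \<in> latL"
      by (rule latL_diff[OF latL_diff[OF that(2)] L])
    then have "c - (l + ind J) - (c - b) \<in> latL" by (simp add: algebra_simps)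
    then show ?thesis using that(1) by (auto simp: cubes_def below_def algebra_simps)
  qed
  show ?thesis
    unfolding euler_char_def
  proof (rule sum.reindex_bij_witness[of _ "\<lambda>(l, J). (c - (l + ind J), J)" "\<lambda>(l, J). (c - (l + ind J), J)"])
    fix x assume "x \<in> cubes a b"
    moreover obtain l J where "x = (l, J)" by force
    ultimately show "(case x of (l, J) \<Rightarrow> (c - (l + ind J), J)) \<in> cubes (c - b) (c - a)"
      using cub assms by simp
  next
    fix x assume "x \<in> cubes (c - b) (c - a)"
    moreover obtain l J where "x = (l, J)" by force
    moreover have "(c - a) - (c - b) \<in> latL" using assms by simp
    ultimately show "(case x of (l, J) \<Rightarrow> (c - (l + ind J), J)) \<in> cubes a b"
      using cub[of l J "c - b" "c - a"] by simp
  next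
    fix x :: "'v qvec \<times> 'v set"
    obtain l J where "x = (l, J)" by force
    then show "(case case x of (l, J) \<Rightarrow> (c - (l + ind J), J) of (l, J) \<Rightarrow> (- 1) ^ card J * cube_weight (\<lambda>x. \<phi> (c - x)) l J)
        = (case x of (l, J) \<Rightarrow> (- 1) ^ card J * cube_weight \<phi> l J)"
      using cube_weight_reflect[of \<phi> l J c] by simp
  qed auto
qed

lemma euler_char_chi_reflect:
  assumes "b - a \<in> latL"
  shows "euler_char chi a b = euler_char chi (ZK \<Gamma> - b) (ZK \<Gamma> - a)"
  using euler_char_reflect[OF assms, of chi "ZK \<Gamma>"] by (simp add: chi_reflect)

lemma dual_coord_upper:
  assumes "\<And>u. 0 \<le> coord d u"
  shows "dual_coord d v \<le> - of_int (euler \<Gamma> v) * coord d v"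
proof -
  have "0 \<le> (\<Sum>u\<in>UNIV - {v}. coord d u * (if adj \<Gamma> u v then 1 else 0))"
    using assms by (intro sum_nonneg) auto
  then show ?thesis unfolding dual_coord_def pairing_split by simp
qed

lemma dual_coord_mono_at:
  assumes "below x y" "coord x v = coord y v"
  shows "dual_coord y v \<le> dual_coord x v"
  using dual_coord_upper[of "y - x" v] assms by (simp add: below_def)

lemma chi_add_basisE: "chi (y + basisE v) = chi y + dual_coord y v + 1"
proof -
  have "ind {v} = basisE v" by (auto simp: qvec_eq_iff)
  moreover have "edge_count {v} = 0" using adj_irrefl by (auto simp: edge_count_def)
  ultimately show ?thesis using chi_add_ind[of y "{v}"] by simp
qed

text \<open>
  On the upper face \<open>y\<^sub>v = b\<^sub>v\<close> the number \<open>\<chi>(y + E\<^sub>v) - \<chi>(y) = 1 - (y, E\<^sub>v)\<close> is smallest at the corner \<open>b\<close>,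
  so one inequality at \<open>b\<close> suffices. The statement for lower corners is its reflection in \<open>Z\<^sub>K\<close>,
  under which \<open>\<chi>\<close> is invariant.
\<close>

lemma euler_char_top_step:
  assumes "b - a \<in> latL" "coord a v \<le> coord b v" "- 1 \<le> dual_coord b v"
  shows "euler_char chi a (b + basisE v) = euler_char chi a b"
proof (rule euler_char_grow[OF assms(1,2)])
  fix y assume "below y b" "coord y v = coord b v"
  then have "dual_coord b v \<le> dual_coord y v" by (rule dual_coord_mono_at)
  then show "chi y \<le> chi (y + basisE v)" using assms(3) by (simp add: chi_add_basisE)
qed

lemma euler_char_bottom_step:
  assumes "b - c \<in> latL" "coord c v + 1 \<le> coord b v" "dual_coord c v \<le> - 1"
  shows "euler_char chi c b = euler_char chi (c + basisE v) b"
proof -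
  let ?b = "ZK \<Gamma> - c - basisE v"
  have bc: "b - (c + basisE v) \<in> latL" using latL_diff[OF assms(1), of "basisE v"] by (simp add: algebra_simps)
  have "euler_char chi c b = euler_char chi (ZK \<Gamma> - b) (?b + basisE v)"
    using euler_char_chi_reflect[OF assms(1)] by simp
  also have "\<dots> = euler_char chi (ZK \<Gamma> - b) ?b"
  proof (rule euler_char_top_step)
    show "?b - (ZK \<Gamma> - b) \<in> latL" using bc by (simp add: algebra_simps)
    show "coord (ZK \<Gamma> - b) v \<le> coord ?b v" using assms(2) by simp
    show "- 1 \<le> dual_coord ?b v" using assms(3) by (simp add: dual_coord_basisE basis_form_def)
  qed
  also have "\<dots> = euler_char chi (c + basisE v) b"
    using euler_char_chi_reflect[OF bc] by (simp add: algebra_simps)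
  finally show ?thesis .
qed

lemma dualL_translate: "x \<in> dualL \<Gamma> \<Longrightarrow> y - x \<in> latL \<Longrightarrow> y \<in> dualL \<Gamma>"
proof -
  assume x: "x \<in> dualL \<Gamma>" and yx: "y - x \<in> latL"
  have "dual_coord (y - x) v + dual_coord x v \<in> \<int>" for v
    using x latL_dualL[OF yx] unfolding dualL_iff by (intro Ints_add) auto
  then show "y \<in> dualL \<Gamma>" by (simp add: dualL_iff)
qed

lemma dual_coord_neg_le:
  assumes "x \<in> dualL \<Gamma>" "dual_coord x v < 0"
  shows "dual_coord x v \<le> - 1"
proof -
  obtain k :: int where k: "dual_coord x v = of_int k" using assms(1) by (auto simp: dualL_iff elim: Ints_cases)
  then have "k \<le> - 1" using assms(2) by simp
  then show ?thesis unfolding k by linarith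
qed

text \<open>
  Below a vector with coordinates in \<open>[0, 1)\<close>, the lower corner can be moved freely: where it
  differs from that vector it is negative, so by the maximum principle it violates
  \<open>(a, E\<^sub>v) \<le> 0\<close> at one of these places.
\<close>

lemma euler_char_bottom:
  assumes r: "r \<in> dualL \<Gamma>" "\<And>v. 0 \<le> coord r v" "\<And>v. coord r v < 1"
    and "r - a \<in> latL" "below a r" "b - r \<in> latL" "below r b"
  shows "euler_char chi a b = euler_char chi r b"
  using assms(4,5)
proof (induction "steps (r - a)" arbitrary: a rule: less_induct)
  case less
  show ?case
  proof (cases "a = r")
    case False
    have "\<exists>v. coord a v \<noteq> coord r v \<and> dual_coord a v < 0"
    proof (rule ccontr)
      assume none: "\<not> ?thesis"
      have "0 \<le> coord a v" for v
        by (rule max_principle_dual_coord[of "{v. coord a v = coord r v}"]) (use none r(2) in \<open>auto simp: not_less\<close>)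
      then have "coord a v = coord r v" for v
        using latL_less_le[OF less.prems(1), of v] less.prems(2) r(3)[of v]
        unfolding below_def by (metis add_increasing not_le order_le_less)
      then show False using False by (simp add: qvec_eq_iff)
    qed
    then obtain v where v: "coord a v \<noteq> coord r v" "dual_coord a v < 0" by blast
    have "a \<in> dualL \<Gamma>" by (rule dualL_translate[OF r(1) latL_minus_commute[OF less.prems(1)]])
    then have k: "dual_coord a v \<le> - 1" using v(2) by (rule dual_coord_neg_le)
    have "coord a v < coord r v" using v(1) less.prems(2) by (simp add: below_def order_less_le)
    then have av: "coord a v + 1 \<le> coord r v" by (rule latL_less_le[OF less.prems(1)])
    have ba: "b - a \<in> latL" by (rule latL_trans[OF assms(6) less.prems(1)])
    have "coord r v \<le> coord b v" using assms(7) by (simp add: below_def)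
    then have "euler_char chi a b = euler_char chi (a + basisE v) b"
      using av k by (intro euler_char_bottom_step[OF ba]) auto
    also have "\<dots> = euler_char chi r b"
    proof (rule less.hyps)
      have "steps (r - a - basisE v) < steps (r - a)"
        using less.prems(2) av by (intro steps_decreases) (auto simp: below_def)
      then show "steps (r - (a + basisE v)) < steps (r - a)" by (simp add: algebra_simps)
      show "r - (a + basisE v) \<in> latL"
        using latL_diff[OF less.prems(1), of "basisE v"] by (simp add: algebra_simps)
      show "below (a + basisE v) r" using less.prems(2) av by (auto simp: below_def)
    qed
    finally show ?thesis .
  qed simp
qed

lemma euler_char_top_path:
  assumes "b - a \<in> latL" "below a b" "b' - b \<in> latL" "below b b'"
    and "\<And>c v. below b c \<Longrightarrow> below c b' \<Longrightarrow> coord c v < coord b' v \<Longrightarrow> - 1 \<le> dual_coord c v"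
  shows "euler_char chi a b = euler_char chi a b'"
  using assms
proof (induction "steps (b' - b)" arbitrary: b rule: less_induct)
  case less
  show ?case
  proof (cases "b = b'")
    case False
    then obtain v where "coord b v \<noteq> coord b' v" by (auto simp: qvec_eq_iff)
    then have v: "coord b v < coord b' v" using less.prems(4) by (simp add: below_def order_less_le)
    have bv: "coord b v + 1 \<le> coord b' v" using less.prems(3) v by (rule latL_less_le)
    have "euler_char chi a b = euler_char chi a (b + basisE v)"
      using less.prems(1,2,4,5) v by (intro euler_char_top_step[symmetric]) (auto simp: below_def)
    also have "\<dots> = euler_char chi a b'"
    proof (rule less.hyps)
      have "steps (b' - b - basisE v) < steps (b' - b)"
        using less.prems(4) bv by (intro steps_decreases) (auto simp: below_def)
      then show "steps (b' - (b + basisE v)) < steps (b' - b)" by (simp add: algebra_simps)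
      show "b + basisE v - a \<in> latL"
        using latL_add[OF less.prems(1), of "basisE v"] by (simp add: algebra_simps)
      show "b' - (b + basisE v) \<in> latL"
        using latL_diff[OF less.prems(3), of "basisE v"] by (simp add: algebra_simps)
      have bb: "below b (b + basisE v)" by (simp add: below_def)
      show "below a (b + basisE v)" by (rule below_trans[OF less.prems(2) bb])
      show "below (b + basisE v) b'" using less.prems(4) bv by (auto simp: below_def)
      show "- 1 \<le> dual_coord c u" if "below (b + basisE v) c" "below c b'" "coord c u < coord b' u" for c u
        using less.prems(5)[OF below_trans[OF bb that(1)] that(2,3)] .
    qed
    finally show ?thesis .
  qed simp
qed

text \<open>An integral vector with positive coordinates in the interior of the cone.\<close>

definition ample :: "'v qvec" where
  "ample = (SOME s. s \<in> latL \<and> (\<forall>v. 1 \<le> coord s v \<and> 0 < dual_coord s v))"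

lemma ample: "ample \<in> latL" "1 \<le> coord ample v" "0 < dual_coord ample v"
proof -
  obtain N :: nat where N: "0 < N" "\<And>l u. (\<And>v. dual_coord l v \<in> \<int>) \<Longrightarrow> of_nat N * coord l u \<in> \<int>"
    using common_denominator_dual by blast
  define s where "s = qscale (of_nat N) (\<Sum>v\<in>UNIV. Estar \<Gamma> v)"
  have dual_coord: "dual_coord (\<Sum>v\<in>UNIV. Estar \<Gamma> v) u = 1" for u by (simp add: dual_coord_sum)
  have int: "coord s u \<in> \<int>" for u unfolding s_def coord_qscale by (rule N(2)) (simp add: dual_coord)
  have pos: "0 < coord s u" for u
    unfolding s_def coord_qscale coord_sum using N(1) Estar_pos by (intro mult_pos_pos sum_pos) auto
  have "1 \<le> coord s u" for u
  proof -
    obtain k :: int where k: "coord s u = of_int k" using int by (rule Ints_cases)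
    then show ?thesis using pos[of u] by simp
  qed
  then have "\<exists>s. s \<in> latL \<and> (\<forall>v. 1 \<le> coord s v \<and> 0 < dual_coord s v)"
    using N(1) int dual_coord by (intro exI[of _ s]) (simp add: latL_def s_def)
  from someI_ex[OF this] show "ample \<in> latL" "1 \<le> coord ample v" "0 < dual_coord ample v"
    by (simp_all add: ample_def)
qed

text \<open>
  The margin is such that all vectors between \<open>b - ample\<close> and \<open>b\<close> still allow the upper corner
  to be moved in the directions of \<open>U\<close>.
\<close>

definition deep :: "'v set \<Rightarrow> 'v qvec \<Rightarrow> bool" where
  "deep U b \<longleftrightarrow> (\<forall>v\<in>U. - 1 - of_int (euler \<Gamma> v) * coord ample v \<le> dual_coord b v)"

lemma ample_nonneg: "0 \<le> coord ample v"
  using ample(2)[of v] by linarith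

lemma dual_coord_restr_ample: "v \<in> U \<Longrightarrow> 0 < dual_coord (restr U ample) v"
proof -
  assume "v \<in> U"
  have "below (restr U ample) ample" by (simp add: below_def ample_nonneg)
  then have "dual_coord ample v \<le> dual_coord (restr U ample) v" using \<open>v \<in> U\<close> by (intro dual_coord_mono_at) simp_all
  then show ?thesis using ample(3)[of v] by simp
qed

text \<open>
  The corner moves from \<open>b\<close> to \<open>b'\<close> through the vectors \<open>min(b', b + i ample)\<close>, with the ample
  vector restricted to \<open>U\<close>. A coordinatewise minimum of deep vectors is deep, and two
  consecutive ones are so close that the coordinates can be raised in any order.
\<close>

lemma euler_char_top_aux:
  assumes "b - a \<in> latL" "below a b" "deep U b"
    and "b' - b \<in> latL" "below b b'" "deep U b'" "\<And>v. v \<notin> U \<Longrightarrow> coord b' v = coord b v"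
    and "below b' (b + qscale (of_nat n) (restr U ample))"
  shows "euler_char chi a b = euler_char chi a b'"
  using assms(4-8)
proof (induction n arbitrary: b')
  case 0
  have "b = b'" using 0(2,5) by (intro qvec_eqI antisym) (auto simp: below_def)
  then show ?case by simp
next
  case (Suc n)
  define t where "t = b + qscale (of_nat n) (restr U ample)"
  define y where "y = Qvec (\<lambda>v. min (coord b' v) (coord t v))"
  have y: "coord y v = min (coord b' v) (coord t v)" for v by (simp add: y_def)
  have "coord t v - coord b v \<in> \<int>" for v
    using ample(1) by (auto simp: t_def latL_def intro!: Ints_mult)
  then have yb: "y - b \<in> latL"
    using Suc.prems(1) by (auto simp: latL_def y min_def)
  have bt: "below b t"
    by (simp add: t_def below_def ample_nonneg)
  have b_y: "below b y" using bt Suc.prems(2) by (simp add: below_def y)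
  have yb': "below y b'" by (simp add: below_def y)
  have deepy: "deep U y"
    unfolding deep_def
  proof
    fix v assume v: "v \<in> U"
    show "- 1 - of_int (euler \<Gamma> v) * coord ample v \<le> dual_coord y v"
    proof (cases "coord b' v \<le> coord t v")
      case True
      then have "dual_coord b' v \<le> dual_coord y v" using yb' by (intro dual_coord_mono_at) (simp_all add: y)
      then show ?thesis using Suc.prems(3) v unfolding deep_def by (meson order_trans)
    next
      case False
      then have "dual_coord t v \<le> dual_coord y v" by (intro dual_coord_mono_at) (simp_all add: y below_def)
      moreover have "dual_coord b v \<le> dual_coord t v" using dual_coord_restr_ample[OF v] by (simp add: t_def)
      ultimately show ?thesis using assms(3) v unfolding deep_def by (meson order_trans)
    qed
  qed
  have "euler_char chi a b = euler_char chi a y"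
  proof (rule Suc.IH[OF yb b_y deepy])
    show "coord y v = coord b v" if "v \<notin> U" for v using Suc.prems(4)[OF that] that by (simp add: y t_def)
    show "below y (b + qscale (of_nat n) (restr U ample))" by (simp add: below_def y t_def)
  qed
  also have "\<dots> = euler_char chi a b'"
  proof (rule euler_char_top_path)
    show "y - a \<in> latL" by (rule latL_trans[OF yb assms(1)])
    show "below a y" by (rule below_trans[OF assms(2) b_y])
    show "b' - y \<in> latL" by (rule latL_trans[OF Suc.prems(1) latL_minus_commute[OF yb]])
    show "below y b'" by (rule yb')
    fix c v assume c: "below y c" "below c b'" "coord c v < coord b' v"
    have v: "v \<in> U"
    proof (rule ccontr)
      assume v: "v \<notin> U"
      have "coord y v = coord b' v" using Suc.prems(4)[OF v] v by (simp add: y t_def)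
      moreover have "coord y v \<le> coord c v" using c(1) by (simp add: below_def)
      ultimately show False using c(3) by simp
    qed
    have "coord b' v \<le> coord y v + coord ample v"
    proof -
      have "coord b' v \<le> coord t v + coord ample v"
        using spec[OF Suc.prems(5)[unfolded below_def], of v] v by (simp add: t_def algebra_simps)
      then show ?thesis using ample(2)[of v] by (simp add: y min_def)
    qed
    moreover have "coord y v \<le> coord c v" using c(1) by (simp add: below_def)
    ultimately have cv: "coord (b' - c) v \<le> coord ample v" by simp
    have "dual_coord (b' - c) v \<le> - of_int (euler \<Gamma> v) * coord (b' - c) v"
      using c(2) by (intro dual_coord_upper) (simp add: below_def)
    also have "\<dots> \<le> - of_int (euler \<Gamma> v) * coord ample v"
      using cv euler_neg[of v] by (intro mult_left_mono) auto
    finally show "- 1 \<le> dual_coord c v" using Suc.prems(3) v unfolding deep_def by fastforce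
  qed
  finally show ?case .
qed

lemma euler_char_top:
  assumes "b - a \<in> latL" "below a b" "deep U b"
    and "b' - b \<in> latL" "below b b'" "deep U b'" "\<And>v. v \<notin> U \<Longrightarrow> coord b' v = coord b v"
  shows "euler_char chi a b = euler_char chi a b'"
proof -
  obtain n :: nat where n: "Max (range (coord (b' - b))) \<le> of_nat n"
    by (meson less_imp_le reals_Archimedean2)
  have "coord b' v \<le> coord (b + qscale (of_nat n) (restr U ample)) v" for v
  proof (cases "v \<in> U")
    case True
    have "coord (b' - b) v \<le> of_nat n" using n by (meson Max_ge finite finite_imageI order_trans rangeI)
    also have "\<dots> \<le> of_nat n * coord ample v" using ample(2)[of v] by (simp add: mult_le_cancel_left1)
    finally show ?thesis using True by simp
  qed (use assms(7) in simp)
  then have "below b' (b + qscale (of_nat n) (restr U ample))" by (simp add: below_def)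
  then show ?thesis using assms by (intro euler_char_top_aux)
qed

text \<open>
  If \<open>l\<close> is large somewhere and \<open>(l, E\<^sub>v) \<le> 0\<close> elsewhere, it is large everywhere, by comparison
  with a multiple of some \<open>E\<^sup>*\<^sub>t\<close>.
\<close>

lemma large_somewhere_large_everywhere:
  obtains N :: rat where
    "\<And>b l u. (\<And>v. N \<le> coord b v) \<Longrightarrow> \<exists>v. coord b v \<le> coord l v
      \<Longrightarrow> (\<And>v. coord l v < coord b v \<Longrightarrow> 0 \<le> dual_coord l v) \<Longrightarrow> M \<le> coord l u"
proof -
  let ?E = "range (\<lambda>(t, u). coord (Estar \<Gamma> t) u)"
  define mx where "mx = Max ?E"
  define mn where "mn = Min ?E"
  have mx: "coord (Estar \<Gamma> t) u \<le> mx" for t u unfolding mx_def by (intro Max_ge) (auto intro: image_eqI[of _ _ "(t, u)"])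
  have mn: "mn \<le> coord (Estar \<Gamma> t) u" for t u unfolding mn_def by (intro Min_le) (auto intro: image_eqI[of _ _ "(t, u)"])
  have mn0: "0 < mn" unfolding mn_def using Estar_pos by (subst Min_gr_iff) auto
  have mx0: "0 < mx" using mx[of undefined undefined] Estar_pos[of undefined undefined] by linarith
  \<comment> \<open>So that \<open>N / mx\<close> times \<open>E\<^sup>*\<^sub>t\<close> is at most \<open>N\<close> and at least \<open>M\<close> everywhere.\<close>
  define N where "N = max 0 (M * mx / mn)"
  have "M \<le> coord l u"
    if b: "\<And>v. N \<le> coord b v" and T: "\<exists>v. coord b v \<le> coord l v" and k: "\<And>v. coord l v < coord b v \<Longrightarrow> 0 \<le> dual_coord l v"
    for b l u
  proof -
    obtain t where t: "coord b t \<le> coord l t" using T by blast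
    define y where "y = qscale (N / mx) (Estar \<Gamma> t)"
    have N0: "0 \<le> N / mx" using mx0 by (simp add: N_def)
    have "0 \<le> coord (l - y) u"
    proof (rule max_principle_dual_coord[of "{v. coord b v \<le> coord l v}"])
      fix v assume "v \<in> {v. coord b v \<le> coord l v}"
      then have "N \<le> coord l v" using b[of v] by simp
      moreover have "N / mx * coord (Estar \<Gamma> t) v \<le> N / mx * mx" using N0 mx by (intro mult_left_mono)
      ultimately show "0 \<le> coord (l - y) v" using mx0 by (simp add: y_def)
    next
      fix v assume "v \<notin> {v. coord b v \<le> coord l v}"
      then have "coord l v < coord b v" by simp
      moreover from this have "v \<noteq> t" using t by auto
      ultimately show "0 \<le> dual_coord (l - y) v" using k[of v] by (simp add: y_def)
    qed
    moreover have "M \<le> coord y u"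
    proof -
      have "M * mx / mn \<le> N" by (simp add: N_def)
      then have "M \<le> N / mx * mn" using mn0 mx0 by (simp add: field_simps)
      also have "\<dots> \<le> N / mx * coord (Estar \<Gamma> t) u" using N0 mn by (intro mult_left_mono)
      finally show ?thesis by (simp add: y_def)
    qed
    ultimately show ?thesis by simp
  qed
  then show ?thesis by (rule that)
qed

text \<open>The coordinates of \<open>x\<close> on \<open>I\<close> and those of \<open>a\<close> elsewhere.\<close>

definition join :: "'v set \<Rightarrow> 'v qvec \<Rightarrow> 'v qvec \<Rightarrow> 'v qvec" where
  "join I x a = Qvec (\<lambda>v. if v \<in> I then coord x v else coord a v)"

lemma coord_join [simp]: "coord (join I x a) v = (if v \<in> I then coord x v else coord a v)"
  by (simp add: join_def)

lemma join_latL: "x - y \<in> latL \<Longrightarrow> a - y \<in> latL \<Longrightarrow> join I x a - y \<in> latL"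
  by (simp add: latL_def)

text \<open>
  The counting function: the cubes of the large box with lower corner \<open>a\<close> that are not in the
  one with lower corner \<open>(x on I, a elsewhere)\<close> are those whose least vertex \<open>l\<close> is not
  \<open>\<ge> x\<close> on \<open>I\<close>. Cubes at such an \<open>l\<close> cut off by the upper faces contribute nothing.
\<close>

lemma Qcount_euler_char:
  assumes x: "x \<in> dualL \<Gamma>"
  obtains N where
    "\<And>a b. a - x \<in> latL \<Longrightarrow> below a 0 \<Longrightarrow> below a x \<Longrightarrow> b - x \<in> latL \<Longrightarrow> below x b \<Longrightarrow> (\<And>v. N \<le> coord b v)
      \<Longrightarrow> of_int (Qcount \<Gamma> (cls x) I x) = euler_char chi (join I x a) b - euler_char chi a b"
proof -
  define M where "M = Max (range (coord x))"
  have M: "coord x v \<le> M" for v unfolding M_def by (intro Max_ge) auto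
  obtain N where N: "\<And>b l u. (\<And>v. N \<le> coord b v) \<Longrightarrow> \<exists>v. coord b v \<le> coord l v
      \<Longrightarrow> (\<And>v. coord l v < coord b v \<Longrightarrow> 0 \<le> dual_coord l v) \<Longrightarrow> M \<le> coord l u"
    using large_somewhere_large_everywhere[of M] by blast
  have "of_int (Qcount \<Gamma> (cls x) I x) = euler_char chi (join I x a) b - euler_char chi a b"
    if a: "a - x \<in> latL" "below a 0" "below a x" and b: "b - x \<in> latL" "below x b" "\<And>v. N \<le> coord b v" for a b
  proof -
    let ?g = "\<lambda>(l, J). (-1) ^ card J * cube_weight chi l J"
    define S where "S = {l. l - a \<in> latL \<and> below a l \<and> below l b \<and> \<not> geq_on I l x}"
    define F where "F = (\<lambda>l. {v. coord l v < coord b v})"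
    have far: "geq_on I l x" if "\<exists>v. coord b v \<le> coord l v" "\<And>v. coord l v < coord b v \<Longrightarrow> 0 \<le> dual_coord l v" for l
      unfolding geq_on_def using N[OF b(3) that] M order_trans by blast
    have finS: "finite S"
      by (rule finite_subset[OF _ finite_box[of a b]]) (auto simp: S_def)
    have ja: "join I x a - a \<in> latL" by (rule join_latL[OF latL_minus_commute[OF a(1)]]) simp
    have sub: "cubes (join I x a) b = {(l, J) \<in> cubes a b. geq_on I l x}"
    proof -
      have "below (join I x a) l \<longleftrightarrow> below a l \<and> geq_on I l x" for l
        using a(3) by (auto simp: below_def geq_on_def intro: order_trans)
      moreover have "l - join I x a \<in> latL \<longleftrightarrow> l - a \<in> latL" for l
        using latL_trans[OF _ ja] latL_trans[OF _ latL_minus_commute[OF ja]] by blast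
      ultimately show ?thesis by (auto simp: cubes_def)
    qed
    have diff: "cubes a b - cubes (join I x a) b = (SIGMA l:S. Pow (F l))"
    proof (intro set_eqI)
      fix c :: "'v qvec \<times> 'v set"
      obtain l J where c: "c = (l, J)" by force
      have "below (l + ind J) b \<longleftrightarrow> below l b \<and> J \<subseteq> F l" if "l - a \<in> latL"
      proof
        assume h: "below (l + ind J) b"
        have "coord l v < coord b v" if "v \<in> J" for v
        proof -
          have "coord (l + ind J) v \<le> coord b v" using h by (simp add: below_def)
          then show ?thesis using that by simp
        qed
        then show "below l b \<and> J \<subseteq> F l" using below_add_ind[OF h] by (auto simp: F_def)
      next
        assume h: "below l b \<and> J \<subseteq> F l"
        have bl: "b - l \<in> latL"
          by (rule latL_trans[OF b(1) latL_trans[OF latL_minus_commute[OF a(1)] latL_minus_commute[OF that]]])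
        have "coord (l + ind J) v \<le> coord b v" for v
        proof (cases "v \<in> J")
          case True
          then have "coord l v < coord b v" using h by (auto simp: F_def)
          then show ?thesis using latL_less_le[OF bl] True by simp
        next
          case False
          then show ?thesis using h by (simp add: below_def)
        qed
        then show "below (l + ind J) b" by (simp add: below_def)
      qed
      then show "c \<in> cubes a b - cubes (join I x a) b \<longleftrightarrow> c \<in> (SIGMA l:S. Pow (F l))"
        unfolding sub c by (auto simp: cubes_def S_def)
    qed
    have "euler_char chi a b - euler_char chi (join I x a) b = sum ?g (cubes a b - cubes (join I x a) b)"
      unfolding euler_char_def by (subst sum_diff[OF finite_cubes]) (auto simp: sub)
    also have "\<dots> = (\<Sum>l\<in>S. altsum (cube_weight chi l) (F l))"
      unfolding diff altsum_def using finS by (subst sum.Sigma) auto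
    also have "\<dots> = (\<Sum>l\<in>S. - of_int (zcoeff \<Gamma> l))"
    proof (rule sum.cong[OF refl])
      fix l assume l: "l \<in> S"
      have "l - x \<in> latL" using l latL_trans[OF _ a(1)] by (auto simp: S_def)
      then have ld: "l \<in> dualL \<Gamma>" by (rule dualL_translate[OF x])
      show "altsum (cube_weight chi l) (F l) = - of_int (zcoeff \<Gamma> l)"
      proof (cases "F l = UNIV")
        case True
        then show ?thesis using zcoeff_cubes[OF ld] by simp
      next
        case False
        then have "\<exists>v. coord b v \<le> coord l v" by (auto simp: F_def not_less)
        then have "\<exists>v. coord l v < coord b v \<and> dual_coord l v < 0"
          using far[of l] l unfolding S_def by (metis (mono_tags, lifting) mem_Collect_eq not_le)
        then obtain v where v: "v \<in> F l" "dual_coord l v < 0" by (auto simp: F_def)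
        have "altsum (cube_weight chi l) (F l) = 0"
          using v dual_coord_neg_le[OF ld] by (intro altsum_cube_weight_0) auto
        moreover have "zcoeff \<Gamma> l = 0"
        proof (rule ccontr)
          assume "zcoeff \<Gamma> l \<noteq> 0"
          then have "dual_coord l v \<in> \<nat>" using zcoeff_support by (auto simp: monoidS_iff)
          then show False using v(2) by (auto elim!: Nats_cases)
        qed
        ultimately show ?thesis by simp
      qed
    qed
    also have "\<dots> = - of_int (\<Sum>l\<in>S. zcoeff \<Gamma> l)" by (simp add: sum_negf)
    also have "(\<Sum>l\<in>S. zcoeff \<Gamma> l) = Qcount \<Gamma> (cls x) I x"
      unfolding Qcount_def
    proof (rule sum.mono_neutral_right[OF finS])
      show "{l. zcoeff \<Gamma> l \<noteq> 0 \<and> cls l = cls x \<and> \<not> geq_on I l x} \<subseteq> S"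
      proof clarify
        fix l assume l: "zcoeff \<Gamma> l \<noteq> 0" "cls l = cls x" "\<not> geq_on I l x"
        have lS: "l \<in> monoidS \<Gamma>" using l(1) by (rule zcoeff_support)
        then have k: "0 \<le> dual_coord l v" for v by (auto simp: monoidS_iff Nats_altdef2)
        have "coord l v < coord b v" for v
          using far[of l] l(3) k by (meson not_le)
        then have "below l b" by (simp add: below_def less_imp_le)
        moreover have "below a l"
          using a(2) monoidS_nonneg[OF lS] unfolding below_def by (metis coord_zero order_trans)
        moreover have "l - a \<in> latL"
          using l(2) latL_trans[OF _ latL_minus_commute[OF a(1)]] by (simp add: cls_eq_iff)
        ultimately show "l \<in> S" using l(3) by (simp add: S_def)
      qed
      show "\<forall>l\<in>S - {l. zcoeff \<Gamma> l \<noteq> 0 \<and> cls l = cls x \<and> \<not> geq_on I l x}. zcoeff \<Gamma> l = 0"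
        using latL_trans[OF _ a(1)] by (auto simp: S_def cls_eq_iff)
    qed
    finally show ?thesis by simp
  qed
  then show ?thesis by (rule that)
qed

end

section \<open>The periodic constant\<close>

lemma eventually_large:
  fixes f g :: "'v::finite \<Rightarrow> 'a::archimedean_field"
  assumes "\<And>v. 0 < g v"
  shows "\<forall>\<^sub>F k :: nat in sequentially. \<forall>v. f v \<le> of_nat k * g v"
proof (rule eventually_all_finite)
  fix v
  obtain n :: nat where n: "f v / g v \<le> of_nat n" by (meson less_imp_le reals_Archimedean2)
  have "f v \<le> of_nat k * g v" if "n \<le> k" for k
  proof -
    have "f v / g v \<le> of_nat k" using n that by (meson of_nat_le_iff order_trans)
    then show ?thesis using assms[of v] by (simp add: pos_divide_le_eq)
  qed
  then show "\<forall>\<^sub>F k :: nat in sequentially. f v \<le> of_nat k * g v"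
    unfolding eventually_sequentially by blast
qed

lemma eventually_obtain:
  assumes "\<forall>\<^sub>F k :: nat in sequentially. P k"
  obtains k where "P k"
  using assms unfolding eventually_sequentially by blast

lemma qscale_latL: "x \<in> latL \<Longrightarrow> qscale (of_nat n) x \<in> latL"
  by (simp add: latL_def)

text \<open>
  Periodic constants are unique: along a ray into the cone, on a common sublattice, two
  quasipolynomials become polynomials in one variable that agree at all large integers.
\<close>

lemma polynomial_along_ray_unique:
  assumes "real_polynomial_function p" "real_polynomial_function p'"
    and "\<forall>\<^sub>F t :: nat in sequentially. p (of_nat t *\<^sub>R y) = p' (of_nat t *\<^sub>R y)"
  shows "p 0 = p' 0"
proof -
  define g where "g = (\<lambda>t :: real. p (t *\<^sub>R y) - p' (t *\<^sub>R y))"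
  have lin: "polynomial_function (\<lambda>t :: real. t *\<^sub>R y)"
    by (intro polynomial_function_bounded_linear bounded_linear_scaleR_left)
  have "real_polynomial_function (\<lambda>t :: real. p (t *\<^sub>R y))" "real_polynomial_function (\<lambda>t :: real. p' (t *\<^sub>R y))"
    using real_polynomial_function_compose[OF lin assms(1)] real_polynomial_function_compose[OF lin assms(2)]
    by (simp_all add: comp_def)
  then have "real_polynomial_function g" unfolding g_def by (rule real_polynomial_function_diff)
  then obtain a n where g: "g = (\<lambda>x. \<Sum>i\<le>n. a i * x ^ i)"
    by (auto simp: real_polynomial_function_iff_sum)
  obtain t0 where t0: "\<And>t :: nat. t0 \<le> t \<Longrightarrow> g (of_nat t) = 0"
    using assms(3) unfolding eventually_sequentially g_def by auto
  have "infinite (of_nat ` {t0..} :: real set)"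
    by (simp add: finite_image_iff inj_on_def infinite_Ici)
  moreover have "of_nat ` {t0..} \<subseteq> {x. (\<Sum>i\<le>n. a i * x ^ i) = 0}"
    using t0 by (auto simp: g)
  ultimately have "infinite {x. (\<Sum>i\<le>n. a i * x ^ i) = 0}" using finite_subset by blast
  then have "\<forall>i\<le>n. a i = 0" using polyfun_finite_roots[of a n] by blast
  then have "g 0 = 0" by (simp add: g)
  then show ?thesis by (simp add: g_def)
qed

lemma sublattice_qscale:
  assumes "finite_index_sublattice M L" "x \<in> M"
  shows "qscale (of_nat n) x \<in> M"
proof (induction n)
  case 0
  have "qscale (of_nat 0) x = 0" by (simp add: qvec_eq_iff)
  then show ?case using assms(1) by (simp add: finite_index_sublattice_def)
next
  case (Suc n)
  have M: "0 \<in> M" "\<And>x y. x \<in> M \<Longrightarrow> y \<in> M \<Longrightarrow> x - y \<in> M"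
    using assms(1) by (auto simp: finite_index_sublattice_def)
  have "qscale (of_nat (Suc n)) x = qscale (of_nat n) x - (0 - x)" by (simp add: qvec_eq_iff algebra_simps)
  then show ?case using M(2)[OF Suc M(2)[OF M(1) assms(2)]] by simp
qed

text \<open>The cosets of the multiples of \<open>x\<close> cannot all be different.\<close>

lemma sublattice_contains_multiple:
  assumes "finite_index_sublattice M L" "\<And>n. qscale (of_nat n) x \<in> L"
  obtains j :: nat where "0 < j" "qscale (of_nat j) x \<in> M"
proof -
  have M: "0 \<in> M" and fin: "finite ((\<lambda>x. (+) x ` M) ` L)"
    using assms(1) by (auto simp: finite_index_sublattice_def)
  let ?f = "\<lambda>n :: nat. (+) (qscale (of_nat n) x) ` M"
  have "finite (range ?f)"
    by (rule finite_subset[OF _ fin]) (use assms(2) in blast)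
  then have "\<not> inj ?f" using finite_imageD infinite_UNIV_nat by blast
  then obtain m n where "m \<noteq> n" "?f m = ?f n" unfolding inj_on_def by blast
  then obtain m n where mn: "m < n" "?f m = ?f n" by (metis linorder_neqE_nat)
  have "qscale (of_nat n) x \<in> ?f n" using M by (intro image_eqI[of _ _ 0]) auto
  then obtain y where y: "y \<in> M" "qscale (of_nat n) x = qscale (of_nat m) x + y" using mn(2) by blast
  have "qscale (of_nat (n - m)) x = qscale (of_nat n) x - qscale (of_nat m) x"
    using mn(1) by (simp add: qvec_eq_iff of_nat_diff algebra_simps)
  then have "qscale (of_nat (n - m)) x = y" using y(2) by simp
  then show ?thesis using y(1) mn(1) that[of "n - m"] by simp
qed

lemma qscale_qscale: "qscale (of_nat m) (qscale (of_nat n) x) = qscale (of_nat (m * n)) x"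
  by (simp add: qvec_eq_iff)

lemma to_real_nth [simp]: "to_real x $ v = of_rat (coord x v)"
  by (simp add: to_real_def)

lemma to_real_qscale: "to_real (qscale (of_nat n) x) = of_nat n *\<^sub>R to_real x"
  by (simp add: vec_eq_iff of_rat_mult)

lemma to_real_zero [simp]: "to_real 0 = 0"
  by (simp add: vec_eq_iff)

lemma restr_real_nth [simp]: "restr_real I x $ v = (if v \<in> I then x $ v else 0)"
  by (simp add: restr_real_def)

lemma linear_restr_real: "linear (restr_real I)"
  by (rule linearI) (auto simp: vec_eq_iff)

lemma restr_real_add: "restr_real I (x + y) = restr_real I x + restr_real I y"
  by (rule linear_add[OF linear_restr_real])

lemma finite_index_multiples:
  assumes "0 < N"
  shows "finite_index_sublattice {x :: 'v::finite qvec. \<forall>v. coord x v / of_nat N \<in> \<int>} latL"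
    (is "finite_index_sublattice ?M latL")
  unfolding finite_index_sublattice_def
proof (intro conjI ballI)
  show "?M \<subseteq> latL"
  proof (clarsimp simp: latL_def)
    fix x :: "'v qvec" and v assume "\<forall>v. coord x v / of_nat N \<in> \<int>"
    then have "of_nat N * (coord x v / of_nat N) \<in> \<int>" by (intro Ints_mult[OF Ints_of_nat]) blast
    then show "coord x v \<in> \<int>" using assms by simp
  qed
  show "0 \<in> ?M" by simp
  have diff: "x - y \<in> ?M" if "x \<in> ?M" "y \<in> ?M" for x y
    using that by (auto simp: diff_divide_distrib)
  then show "x - y \<in> ?M" if "x \<in> ?M" "y \<in> ?M" for x y using that by blast
  let ?B = "{l :: 'v qvec. \<forall>v. of_nat 1 * coord l v \<in> \<int> \<and> 0 \<le> coord l v \<and> coord l v \<le> of_nat N}"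
  have "(\<lambda>x. (+) x ` ?M) ` latL \<subseteq> (\<lambda>x. (+) x ` ?M) ` ?B"
  proof clarify
    fix x :: "'v qvec" assume x: "x \<in> latL"
    define \<rho> where "\<rho> = Qvec (\<lambda>v. of_int (\<lfloor>coord x v\<rfloor> mod int N))"
    have \<rho>: "coord \<rho> v = of_int (\<lfloor>coord x v\<rfloor> mod int N)" for v by (simp add: \<rho>_def)
    have xr: "(coord x v - coord \<rho> v) / of_nat N \<in> \<int>" for v
    proof -
      have "coord x v \<in> \<int>" using x by (simp add: latL_def)
      then have "coord x v = of_int \<lfloor>coord x v\<rfloor>" by (metis Ints_cases floor_of_int)
      moreover have "\<lfloor>coord x v\<rfloor> = int N * (\<lfloor>coord x v\<rfloor> div int N) + \<lfloor>coord x v\<rfloor> mod int N" by simp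
      ultimately have "coord x v - coord \<rho> v = of_int (int N * (\<lfloor>coord x v\<rfloor> div int N))"
        unfolding \<rho> by (metis add_diff_cancel_right' of_int_add)
      then have "(coord x v - coord \<rho> v) / of_nat N = of_int (\<lfloor>coord x v\<rfloor> div int N)"
        using assms by simp
      then show ?thesis by simp
    qed
    then have M1: "x - \<rho> \<in> ?M" by simp
    then have M2: "\<rho> - x \<in> ?M" using diff[OF \<open>0 \<in> ?M\<close> M1] by simp
    have "(+) x ` ?M = (+) \<rho> ` ?M"
    proof (intro set_eqI iffI)
      fix z assume "z \<in> (+) x ` ?M"
      then obtain m where m: "m \<in> ?M" "z = x + m" by blast
      then show "z \<in> (+) \<rho> ` ?M" using diff[OF m(1) M2] by (intro image_eqI[of _ _ "m - (\<rho> - x)"]) auto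
    next
      fix z assume "z \<in> (+) \<rho> ` ?M"
      then obtain m where m: "m \<in> ?M" "z = \<rho> + m" by blast
      then show "z \<in> (+) x ` ?M" using diff[OF m(1) M1] by (intro image_eqI[of _ _ "m - (x - \<rho>)"]) auto
    qed
    moreover have "\<rho> \<in> ?B"
    proof clarify
      fix v
      have "0 \<le> \<lfloor>coord x v\<rfloor> mod int N" "\<lfloor>coord x v\<rfloor> mod int N \<le> int N"
        using assms by (simp_all add: less_imp_le)
      then have "0 \<le> rat_of_int (\<lfloor>coord x v\<rfloor> mod int N)" "rat_of_int (\<lfloor>coord x v\<rfloor> mod int N) \<le> of_int (int N)"
        by (simp_all only: of_int_le_iff of_int_0_le_iff)
      then show "of_nat 1 * coord \<rho> v \<in> \<int> \<and> 0 \<le> coord \<rho> v \<and> coord \<rho> v \<le> of_nat N" by (simp add: \<rho>)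
    qed
    ultimately show "(+) x ` ?M \<in> (\<lambda>x. (+) x ` ?M) ` ?B" by blast
  qed
  moreover have "finite ?B" by (rule finite_lattice_box) simp
  ultimately show "finite ((\<lambda>x. (+) x ` ?M) ` latL)" by (meson finite_imageI finite_subset)
qed

lemma finite_index_self:
  assumes "finite_index_sublattice M L"
  shows "finite_index_sublattice M M"
proof -
  have M: "0 \<in> M" "\<And>x y. x \<in> M \<Longrightarrow> y \<in> M \<Longrightarrow> x - y \<in> M"
    using assms by (auto simp: finite_index_sublattice_def)
  have "(+) x ` M = M" if x: "x \<in> M" for x
  proof (intro set_eqI iffI)
    fix z assume "z \<in> (+) x ` M"
    then obtain m where "m \<in> M" "z = x - (0 - m)" by auto
    then show "z \<in> M" using M x by blast
  next
    fix z assume "z \<in> M"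
    then show "z \<in> (+) x ` M" using M(2)[OF _ x] by (intro image_eqI[of _ _ "z - x"]) auto
  qed
  then have "(\<lambda>x. (+) x ` M) ` M \<subseteq> {M}" by blast
  then have "finite ((\<lambda>x. (+) x ` M) ` M)" by (rule finite_subset) simp
  then show ?thesis using M by (simp add: finite_index_sublattice_def)
qed

context negdef_tree begin

text \<open>
  The maximum principle over the reals: at a place where the quotient of \<open>f\<close> and the ample
  vector is minimal, a negative minimum is impossible.
\<close>

lemma max_principle_real:
  fixes f :: "'v \<Rightarrow> real"
  assumes "\<And>v. v \<in> T \<Longrightarrow> 0 \<le> f v" "\<And>v. v \<notin> T \<Longrightarrow> pairing \<Gamma> f v \<le> 0"
  shows "0 \<le> f v"
proof -
  define s where "s = (\<lambda>v. real_of_rat (coord ample v))"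
  have s: "0 < s v" for v
    using ample(2)[of v] by (simp add: s_def)
  have ps: "pairing \<Gamma> s v < 0" for v
  proof -
    have "pairing \<Gamma> s v = of_rat (pairing \<Gamma> (coord ample) v)"
      by (simp add: pairing_def s_def of_rat_sum of_rat_mult)
    then show ?thesis using ample(3)[of v] by (simp add: dual_coord_def)
  qed
  define \<mu> where "\<mu> = Min (range (\<lambda>v. f v / s v))"
  have le: "\<mu> * s v \<le> f v" for v
  proof -
    have "\<mu> \<le> f v / s v" unfolding \<mu>_def by (intro Min_le) auto
    then show ?thesis using s[of v] by (simp add: pos_le_divide_eq)
  qed
  have "0 \<le> \<mu>"
  proof (rule ccontr)
    assume neg: "\<not> 0 \<le> \<mu>"
    have "\<mu> \<in> range (\<lambda>v. f v / s v)" unfolding \<mu>_def by (intro Min_in) auto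
    then obtain w where w: "\<mu> = f w / s w" by blast
    then have fw: "f w = \<mu> * s w" using s[of w] by simp
    have "f w < 0" unfolding fw using neg s[of w] by (simp add: mult_neg_pos)
    then have "w \<notin> T" using assms(1)[of w] by auto
    then have "pairing \<Gamma> f w \<le> 0" by (rule assms(2))
    moreover have "0 \<le> pairing \<Gamma> (\<lambda>v. f v - \<mu> * s v) w"
      unfolding pairing_split using fw le by (auto intro!: sum_nonneg)
    then have "\<mu> * pairing \<Gamma> s w \<le> pairing \<Gamma> f w"
      by (simp add: pairing_diff pairing_scale)
    moreover have "0 < \<mu> * pairing \<Gamma> s w" using neg ps[of w] by (simp add: mult_neg_neg)
    ultimately show False by linarith
  qed
  then have "0 \<le> \<mu> * s v" using s[of v] by simp
  then show ?thesis using le[of v] by linarith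
qed

lemma pairing_to_real: "pairing \<Gamma> (\<lambda>u. to_real x $ u) v = of_rat (pairing \<Gamma> (coord x) v)"
  by (simp add: pairing_def of_rat_sum of_rat_mult)

lemma to_real_expansion: "to_real x = (\<Sum>v\<in>UNIV. of_rat (dual_coord x v) *\<^sub>R to_real (Estar \<Gamma> v))"
proof -
  have "of_rat (coord x u) = (\<Sum>v\<in>UNIV. of_rat (dual_coord x v) * real_of_rat (coord (Estar \<Gamma> v) u))" for u
    by (subst coord_expansion) (simp add: of_rat_sum of_rat_mult)
  then show ?thesis by (simp add: vec_eq_iff)
qed

lemma convex_cone_coneS: "convex_cone (coneS \<Gamma>)"
  unfolding convex_cone_iff
proof (intro conjI ballI allI impI)
  show "0 \<in> coneS \<Gamma>" unfolding coneS_def by (intro CollectI exI[of _ "\<lambda>_. 0"]) simp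
  fix x assume "x \<in> coneS \<Gamma>"
  then obtain a where a: "x = (\<Sum>v\<in>UNIV. a v *\<^sub>R to_real (Estar \<Gamma> v))" "\<forall>v. 0 \<le> a v"
    unfolding coneS_def by blast
  show "x + y \<in> coneS \<Gamma>" if y: "y \<in> coneS \<Gamma>" for y
  proof -
    obtain b where b: "y = (\<Sum>v\<in>UNIV. b v *\<^sub>R to_real (Estar \<Gamma> v))" "\<forall>v. 0 \<le> b v"
      using y unfolding coneS_def by blast
    then show ?thesis unfolding coneS_def using a
      by (intro CollectI exI[of _ "\<lambda>v. a v + b v"]) (simp add: scaleR_add_left sum.distrib)
  qed
  show "c *\<^sub>R x \<in> coneS \<Gamma>" if "0 \<le> c" for c
    unfolding coneS_def using a that
    by (intro CollectI exI[of _ "\<lambda>v. c * a v"]) (simp add: scaleR_sum_right)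
qed

text \<open>The \<open>E\<^sup>*\<^sub>v\<close> span the whole space, so their images span all coordinates in \<open>I\<close>.\<close>

lemma top_dim_cone_coneS: "top_dim_cone I (restr_real I ` coneS \<Gamma>)"
  unfolding top_dim_cone_def
proof (intro conjI)
  let ?K = "restr_real I ` coneS \<Gamma>"
  show "convex_cone ?K" using convex_cone_coneS linear_restr_real by (intro convex_cone_linear_image) auto
  show "?K \<subseteq> range (restr_real I)" by blast
  let ?B = "(\<lambda>i. axis i 1) ` I :: (real ^ 'v) set"
  have "dim (span ?K) = card I"
  proof (rule dim_unique)
    show "?B \<subseteq> span ?K"
    proof clarify
      fix i assume i: "i \<in> I"
      have Es: "restr_real I (to_real (Estar \<Gamma> v)) \<in> span ?K" for v
      proof -
        have "to_real (Estar \<Gamma> v) = (\<Sum>u\<in>UNIV. (if u = v then 1 else 0) *\<^sub>R to_real (Estar \<Gamma> u))"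
          by (simp add: if_distrib[of "\<lambda>c. c *\<^sub>R _"] cong: if_cong)
        then have "to_real (Estar \<Gamma> v) \<in> coneS \<Gamma>"
          unfolding coneS_def by (intro CollectI exI[of _ "\<lambda>u. if u = v then 1 else 0"]) simp
        then show ?thesis by (intro span_base) blast
      qed
      have "axis i 1 = restr_real I (to_real (basisE i))"
        using i by (auto simp: vec_eq_iff axis_def)
      also have "\<dots> = (\<Sum>v\<in>UNIV. of_rat (dual_coord (basisE i) v) *\<^sub>R restr_real I (to_real (Estar \<Gamma> v)))"
        by (subst to_real_expansion)
          (simp add: linear_sum[OF linear_restr_real] linear_scale[OF linear_restr_real])
      also have "\<dots> \<in> span ?K" by (intro span_sum span_scale Es)
      finally show "axis i 1 \<in> span ?K" .
    qed
    have "?K \<subseteq> span ?B"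
    proof clarify
      fix x
      have "restr_real I x = (\<Sum>i\<in>I. (x $ i) *\<^sub>R axis i 1)"
        by (auto simp: vec_eq_iff axis_def if_distrib[of "(*) _"] cong: if_cong)
      also have "\<dots> \<in> span ?B" by (intro span_sum span_scale span_base) blast
      finally show "restr_real I x \<in> span ?B" .
    qed
    then show "span ?K \<subseteq> span ?B" by (simp add: span_minimal)
    show "independent ?B"
      by (rule independent_mono[OF independent_Basis]) (auto simp: axis_in_Basis_iff)
    show "card ?B = card I" by (rule card_image) (auto simp: inj_on_def axis_eq_axis)
  qed
  then show "dim ?K = card I" by simp
qed

lemma in_shifted_cone_eventually:
  assumes "l0 \<in> restr_real I ` coneS \<Gamma>" "0 < J"
  shows "\<forall>\<^sub>F t :: nat in sequentially. restr_real I (to_real (qscale (of_nat t) (qscale (of_nat J) ample) + r))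
    \<in> (+) l0 ` restr_real I ` coneS \<Gamma>"
proof -
  obtain a where a: "l0 = restr_real I (\<Sum>v\<in>UNIV. a v *\<^sub>R to_real (Estar \<Gamma> v))"
    using assms(1) unfolding coneS_def by blast
  have "0 < of_nat J * real_of_rat (dual_coord ample v)" for v
    using ample(3)[of v] assms(2) by simp
  then have "\<forall>\<^sub>F t :: nat in sequentially. \<forall>v. a v - of_rat (dual_coord r v) \<le> of_nat t * (of_nat J * real_of_rat (dual_coord ample v))"
    by (rule eventually_large)
  then show ?thesis
  proof (rule eventually_mono)
    fix t :: nat
    assume t: "\<forall>v. a v - of_rat (dual_coord r v) \<le> of_nat t * (of_nat J * real_of_rat (dual_coord ample v))"
    define x where "x = qscale (of_nat t) (qscale (of_nat J) ample) + r"
    define b where "b = (\<lambda>v. real_of_rat (dual_coord x v) - a v)"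
    have "0 \<le> b v" for v
      using spec[OF t, of v] by (simp add: b_def x_def of_rat_add of_rat_mult)
    then have B: "(\<Sum>v\<in>UNIV. b v *\<^sub>R to_real (Estar \<Gamma> v)) \<in> coneS \<Gamma>" unfolding coneS_def by blast
    have "to_real x = (\<Sum>v\<in>UNIV. a v *\<^sub>R to_real (Estar \<Gamma> v)) + (\<Sum>v\<in>UNIV. b v *\<^sub>R to_real (Estar \<Gamma> v))"
      by (subst to_real_expansion) (simp add: b_def scaleR_diff_left sum_subtractf)
    then have "restr_real I (to_real x) = l0 + restr_real I (\<Sum>v\<in>UNIV. b v *\<^sub>R to_real (Estar \<Gamma> v))"
      by (simp only: a restr_real_add)
    then show "restr_real I (to_real (qscale (of_nat t) (qscale (of_nat J) ample) + r)) \<in> (+) l0 ` restr_real I ` coneS \<Gamma>"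
      unfolding x_def[symmetric] using B by blast
  qed
qed

lemma has_pc_along_ray:
  assumes "has_pc \<Gamma> I h (restr_real I ` coneS \<Gamma>) c"
  shows "\<exists>j p. 0 < j \<and> real_polynomial_function p \<and> p 0 = c \<and>
    (\<forall>J>0. j dvd J \<longrightarrow> (\<forall>\<^sub>F t :: nat in sequentially.
      of_int (Qcount \<Gamma> h I (qscale (of_nat t) (qscale (of_nat J) ample) + rep h))
        = p (of_nat t *\<^sub>R to_real (qscale (of_nat J) ample))))"
proof -
  let ?K = "restr_real I ` coneS \<Gamma>"
  obtain l0 M q where l0: "l0 \<in> ?K" and M: "finite_index_sublattice M latL" and q: "quasipolynomial_on M q"
    and Q: "\<And>l. l \<in> M \<Longrightarrow> restr_real I (to_real (l + rep h)) \<in> (+) l0 ` ?K \<Longrightarrow> of_int (Qcount \<Gamma> h I (l + rep h)) = q l"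
    and c: "c = q 0"
    using assms unfolding has_pc_def by blast
  obtain M0 where M0: "finite_index_sublattice M0 M"
    and p': "\<forall>a\<in>M. \<exists>p. real_polynomial_function p \<and> (\<forall>x\<in>M0. q (a + x) = p (to_real (a + x)))"
    using q unfolding quasipolynomial_on_def by blast
  have z: "0 \<in> M" "0 \<in> M0" "M0 \<subseteq> M" using M M0 by (auto simp: finite_index_sublattice_def)
  then obtain p where p: "real_polynomial_function p" "\<And>x. x \<in> M0 \<Longrightarrow> q x = p (to_real x)"
    using p' by (metis add_0)
  obtain j1 :: nat where j1: "0 < j1" "qscale (of_nat j1) ample \<in> M"
    using sublattice_contains_multiple[OF M qscale_latL[OF ample(1)]] by blast
  obtain j2 :: nat where j2: "0 < j2" "qscale (of_nat j2) (qscale (of_nat j1) ample) \<in> M0"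
    using sublattice_contains_multiple[OF M0 sublattice_qscale[OF M j1(2)]] by blast
  show ?thesis
  proof (intro exI[of _ "j2 * j1"] exI[of _ p] conjI allI impI)
    show "0 < j2 * j1" using j1 j2 by simp
    show "p 0 = c" using p(2)[OF z(2)] c by simp
    fix J :: nat assume J: "0 < J" "j2 * j1 dvd J"
    then obtain k where k: "J = k * (j2 * j1)" by (metis dvd_def mult.commute)
    have "qscale (of_nat J) ample \<in> M0"
      using sublattice_qscale[OF M0 j2(2), of k] by (simp only: qscale_qscale k)
    then have tJ: "qscale (of_nat t) (qscale (of_nat J) ample) \<in> M0" for t by (rule sublattice_qscale[OF M0])
    show "\<forall>\<^sub>F t :: nat in sequentially.
      of_int (Qcount \<Gamma> h I (qscale (of_nat t) (qscale (of_nat J) ample) + rep h)) = p (of_nat t *\<^sub>R to_real (qscale (of_nat J) ample))"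
    proof (rule eventually_mono[OF in_shifted_cone_eventually[OF l0 J(1), of "rep h"]])
      fix t :: nat
      assume "restr_real I (to_real (qscale (of_nat t) (qscale (of_nat J) ample) + rep h)) \<in> (+) l0 ` ?K"
      then have "of_int (Qcount \<Gamma> h I (qscale (of_nat t) (qscale (of_nat J) ample) + rep h))
          = q (qscale (of_nat t) (qscale (of_nat J) ample))"
        using tJ z(3) by (intro Q) auto
      also have "\<dots> = p (of_nat t *\<^sub>R to_real (qscale (of_nat J) ample))"
        using p(2)[OF tJ] by (simp only: to_real_qscale)
      finally show "of_int (Qcount \<Gamma> h I (qscale (of_nat t) (qscale (of_nat J) ample) + rep h))
          = p (of_nat t *\<^sub>R to_real (qscale (of_nat J) ample))" .
    qed
  qed (rule p(1))
qed

lemma has_pc_unique: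
  assumes "has_pc \<Gamma> I h (restr_real I ` coneS \<Gamma>) c" "has_pc \<Gamma> I h (restr_real I ` coneS \<Gamma>) c'"
  shows "c = c'"
proof -
  obtain j p where p: "0 < j" "real_polynomial_function p" "p 0 = c"
    "\<forall>J>0. j dvd J \<longrightarrow> (\<forall>\<^sub>F t :: nat in sequentially.
      of_int (Qcount \<Gamma> h I (qscale (of_nat t) (qscale (of_nat J) ample) + rep h))
        = p (of_nat t *\<^sub>R to_real (qscale (of_nat J) ample)))"
    using has_pc_along_ray[OF assms(1)] by blast
  obtain j' p' where p': "0 < j'" "real_polynomial_function p'" "p' 0 = c'"
    "\<forall>J>0. j' dvd J \<longrightarrow> (\<forall>\<^sub>F t :: nat in sequentially.
      of_int (Qcount \<Gamma> h I (qscale (of_nat t) (qscale (of_nat J) ample) + rep h))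
        = p' (of_nat t *\<^sub>R to_real (qscale (of_nat J) ample)))"
    using has_pc_along_ray[OF assms(2)] by blast
  have "0 < j * j'" "j dvd j * j'" "j' dvd j * j'" using p(1) p'(1) by simp_all
  then have "\<forall>\<^sub>F t :: nat in sequentially.
      of_int (Qcount \<Gamma> h I (qscale (of_nat t) (qscale (of_nat (j * j')) ample) + rep h))
        = p (of_nat t *\<^sub>R to_real (qscale (of_nat (j * j')) ample))"
    and "\<forall>\<^sub>F t :: nat in sequentially.
      of_int (Qcount \<Gamma> h I (qscale (of_nat t) (qscale (of_nat (j * j')) ample) + rep h))
        = p' (of_nat t *\<^sub>R to_real (qscale (of_nat (j * j')) ample))"
    using p(4) p'(4) by blast+
  then have "\<forall>\<^sub>F t :: nat in sequentially. p (of_nat t *\<^sub>R to_real (qscale (of_nat (j * j')) ample))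
      = p' (of_nat t *\<^sub>R to_real (qscale (of_nat (j * j')) ample))"
    by eventually_elim simp
  from polynomial_along_ray_unique[OF p(2) p'(2) this] show ?thesis using p(3) p'(3) by simp
qed

text \<open>The extension of the coordinates on \<open>I\<close> that is orthogonal to all \<open>E\<^sub>v\<close> with \<open>v \<notin> I\<close>.\<close>

lemma harmonic_extension:
  obtains H :: "'v \<Rightarrow> 'v \<Rightarrow> rat" where
    "\<And>x v. v \<in> I \<Longrightarrow> (\<Sum>w\<in>UNIV. H v w * coord x w) = coord x v"
    "\<And>x v. v \<notin> I \<Longrightarrow> dual_coord (Qvec (\<lambda>u. \<Sum>w\<in>UNIV. H u w * coord x w)) v = 0"
proof -
  define A where "A = (\<lambda>v u. if v \<in> I then if u = v then 1 else 0 else rat_of_int (basis_form \<Gamma> u v))"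
  have AI: "(\<Sum>u\<in>UNIV. A v u * x u) = x v" if "v \<in> I" for v x
    using that by (simp add: A_def if_distrib[of "\<lambda>c. c * _"] cong: if_cong)
  have An: "(\<Sum>u\<in>UNIV. A v u * x u) = - dual_coord (Qvec x) v" if "v \<notin> I" for v x
    using that by (simp add: A_def dual_coord_def pairing_def mult.commute)
  obtain H' where H': "\<And>b v. (\<Sum>u\<in>UNIV. A v u * (\<Sum>w\<in>UNIV. H' u w * b w)) = b v"
  proof (rule linear_system_inverse[of A])
    fix x assume x: "\<And>v. (\<Sum>u\<in>UNIV. A v u * x u) = 0"
    have "coord (Qvec x) v * dual_coord (Qvec x) v = 0" for v
    proof (cases "v \<in> I")
      case True
      then show ?thesis using x[of v] AI[of v x] by simp
    next
      case False
      then show ?thesis using x[of v] An[of v x] by simp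
    qed
    then have "(\<Sum>v\<in>UNIV. coord (Qvec x) v * dual_coord (Qvec x) v) = 0" by (intro sum.neutral) blast
    then have "form \<Gamma> (Qvec x) (Qvec x) = 0" unfolding form_dual_coord by simp
    then have "Qvec x = 0" using form_neg by force
    then show "x = (\<lambda>_. 0)" by (metis coord_Qvec coord_zero ext)
  qed blast
  define H where "H = (\<lambda>u w. if w \<in> I then H' u w else 0)"
  have H: "(\<Sum>w\<in>UNIV. H u w * coord x w) = (\<Sum>w\<in>UNIV. H' u w * (if w \<in> I then coord x w else 0))" for u x
    unfolding H_def by (intro sum.cong) auto
  have sol: "(\<Sum>u\<in>UNIV. A v u * (\<Sum>w\<in>UNIV. H u w * coord x w)) = (if v \<in> I then coord x v else 0)" for v x
    unfolding H by (rule H')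
  show ?thesis
  proof (rule that[of H])
    show "(\<Sum>w\<in>UNIV. H v w * coord x w) = coord x v" if "v \<in> I" for x v
      using sol[of v x] AI[OF that] that by simp
    show "dual_coord (Qvec (\<lambda>u. \<Sum>w\<in>UNIV. H u w * coord x w)) v = 0" if "v \<notin> I" for x v
      using sol[of v x] An[OF that] that by simp
  qed
qed

lemma cube_weight_const: "cube_weight (\<lambda>_. c) l J = c"
proof -
  have "(\<lambda>_. c) ` Pow J = {c}" by auto
  then show ?thesis by (simp add: cube_weight_def subset_max_def)
qed

text \<open>The Euler characteristic of a contractible complex.\<close>

lemma euler_char_one:
  assumes "b - a \<in> latL" "below a b"
  shows "euler_char (\<lambda>_. 1) a b = 1"
  using assms
proof (induction "steps (b - a)" arbitrary: b rule: less_induct)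
  case less
  show ?case
  proof (cases "b = a")
    case True
    have "l = a" if "below a l" "below (l + ind J) a" for l and J :: "'v set"
      using that(1) below_add_ind[OF that(2)] by (intro qvec_eqI antisym) (auto simp: below_def)
    moreover have "J = {}" if "below (a + ind J) a" for J
    proof (rule ccontr)
      assume "J \<noteq> {}"
      then obtain v where "v \<in> J" by blast
      then show False using spec[OF that[unfolded below_def], of v] by simp
    qed
    ultimately have "cubes a b = {(a, {})}" unfolding True by (fastforce simp: cubes_def)
    then show ?thesis by (simp add: euler_char_def cube_weight_const)
  next
    case False
    then obtain v where "coord b v \<noteq> coord a v" by (auto simp: qvec_eq_iff)
    then have "coord a v < coord b v" using less.prems(2) by (simp add: below_def order_less_le)
    then have v: "coord a v + 1 \<le> coord b v" by (rule latL_less_le[OF less.prems(1)])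
    let ?b = "b - basisE v"
    have L: "?b - a \<in> latL" using latL_diff[OF less.prems(1), of "basisE v"] by (simp add: algebra_simps)
    have "euler_char (\<lambda>_. 1) a (?b + basisE v) = euler_char (\<lambda>_. 1) a ?b"
      using v by (intro euler_char_grow[OF L]) auto
    also have "\<dots> = 1"
    proof (rule less.hyps[OF _ L])
      have "steps (b - a - basisE v) < steps (b - a)"
        using less.prems(2) v by (intro steps_decreases) (auto simp: below_def)
      then show "steps (?b - a) < steps (b - a)" by (simp add: algebra_simps)
      show "below a ?b" using less.prems(2) v by (auto simp: below_def)
    qed
    finally show ?thesis by simp
  qed
qed

lemma euler_char_translate: "euler_char \<phi> a b = euler_char (\<lambda>y. \<phi> (y + m)) (a - m) (b - m)"
proof -
  have cub: "(l - m, J) \<in> cubes (a - m) (b - m) \<longleftrightarrow> (l, J) \<in> cubes a b" for l J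
  proof -
    have "below (a - m) (l - m) \<longleftrightarrow> below a l" by (simp add: below_def)
    moreover have "below (l - m + ind J) (b - m) \<longleftrightarrow> below (l + ind J) b"
      unfolding below_def by (simp only: coord_plus coord_minus) (simp add: algebra_simps)
    ultimately show ?thesis by (simp add: cubes_def)
  qed
  have w: "cube_weight (\<lambda>y. \<phi> (y + m)) (l - m) J = cube_weight \<phi> l J" for l J
    by (simp add: cube_weight_def algebra_simps)
  show ?thesis
    unfolding euler_char_def
  proof (rule sum.reindex_bij_witness[of _ "\<lambda>(l, J). (l + m, J)" "\<lambda>(l, J). (l - m, J)"])
    show "(case x of (l, J) \<Rightarrow> (l - m, J)) \<in> cubes (a - m) (b - m)" if "x \<in> cubes a b" for x
      using that cub by (cases x) simp
    show "(case y of (l, J) \<Rightarrow> (l + m, J)) \<in> cubes a b" if "y \<in> cubes (a - m) (b - m)" for y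
      using that cub[of "fst y + m" "snd y"] by (cases y) simp
    show "(case case x of (l, J) \<Rightarrow> (l - m, J) of (l, J) \<Rightarrow> (- 1) ^ card J * cube_weight (\<lambda>y. \<phi> (y + m)) l J)
        = (case x of (l, J) \<Rightarrow> (- 1) ^ card J * cube_weight \<phi> l J)" for x
      using w by (cases x) simp
  qed (auto split: prod.split)
qed

lemma euler_char_add_const:
  assumes "b - a \<in> latL" "below a b"
    and "\<And>y. below a y \<Longrightarrow> below y b \<Longrightarrow> \<phi> y = c + \<psi> y"
  shows "euler_char \<phi> a b = c + euler_char \<psi> a b"
proof -
  have "cube_weight \<phi> l J = c + cube_weight \<psi> l J" if lJ: "(l, J) \<in> cubes a b" for l J
    unfolding cube_weight_def subset_max_add[symmetric]
  proof (rule subset_max_cong)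
    fix K assume K: "K \<subseteq> J"
    have "below a (l + ind K)" using lJ by (auto simp: cubes_def below_def add_increasing2)
    moreover have "below (l + ind K) (l + ind J)" using K by (auto simp: below_def)
    then have "below (l + ind K) b" using lJ by (auto simp: cubes_def intro: below_trans)
    ultimately show "\<phi> (l + ind K) = c + \<psi> (l + ind K)" by (rule assms(3))
  qed
  then have "euler_char \<phi> a b = (\<Sum>(l, J)\<in>cubes a b. c * ((-1) ^ card J * cube_weight (\<lambda>_. 1) l J) + (-1) ^ card J * cube_weight \<psi> l J)"
    unfolding euler_char_def by (intro sum.cong) (auto simp: cube_weight_const algebra_simps)
  also have "\<dots> = c * euler_char (\<lambda>_. 1) a b + euler_char \<psi> a b"
    unfolding euler_char_def by (simp add: sum.distrib sum_distrib_left case_prod_unfold)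
  finally show ?thesis by (simp add: euler_char_one[OF assms(1,2)])
qed

lemma deep_mono: "deep U x \<Longrightarrow> (\<And>v. v \<in> U \<Longrightarrow> dual_coord x v \<le> dual_coord y v) \<Longrightarrow> deep U y"
  unfolding deep_def by (meson order_trans)

lemma deep_eventually:
  assumes "\<And>v. v \<in> U \<Longrightarrow> 0 < dual_coord s v"
  shows "\<forall>\<^sub>F n :: nat in sequentially. deep U (r + qscale (of_nat n) s)"
proof -
  have "\<forall>\<^sub>F n :: nat in sequentially. \<forall>v. (if v \<in> U then - 1 - of_int (euler \<Gamma> v) * coord ample v - dual_coord r v else 0)
      \<le> of_nat n * (if v \<in> U then dual_coord s v else 1)"
    by (rule eventually_large) (use assms in auto)
  then show ?thesis
  proof (rule eventually_mono)
    fix n :: nat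
    assume n: "\<forall>v. (if v \<in> U then - 1 - of_int (euler \<Gamma> v) * coord ample v - dual_coord r v else 0)
      \<le> of_nat n * (if v \<in> U then dual_coord s v else 1)"
    show "deep U (r + qscale (of_nat n) s)"
      unfolding deep_def
    proof
      fix v assume "v \<in> U"
      then show "- 1 - of_int (euler \<Gamma> v) * coord ample v \<le> dual_coord (r + qscale (of_nat n) s) v"
        using spec[OF n, of v] by (simp add: algebra_simps)
    qed
  qed
qed

lemma eventually_below: "\<forall>\<^sub>F n :: nat in sequentially. below x (y + qscale (of_nat n) ample)"
proof -
  have "\<forall>\<^sub>F n :: nat in sequentially. \<forall>v. coord (x - y) v \<le> of_nat n * coord ample v"
    by (rule eventually_large) (rule less_le_trans[OF zero_less_one ample(2)])
  then show ?thesis by (rule eventually_mono) (auto simp: below_def algebra_simps)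
qed

lemma eventually_above: "\<forall>\<^sub>F n :: nat in sequentially. below (y - qscale (of_nat n) ample) x"
  using eventually_below[of y x] by (rule eventually_mono) (auto simp: below_def algebra_simps)

end

text \<open>
  The vector \<open>r\<close> is the representative of its class with coordinates in \<open>[0, 1)\<close>. The number \<open>n\<close>
  is so large that adding \<open>n\<close> times the ample vector makes it deep, and that adding \<open>n\<close> times
  the part of the ample vector outside \<open>I\<close> makes it deep in the directions outside \<open>I\<close>.
\<close>

locale counting = negdef_tree +
  fixes I :: "'a set" and r :: "'a qvec" and n :: nat
  assumes r: "r \<in> dualL \<Gamma>" "\<And>v. 0 \<le> coord r v" "\<And>v. coord r v < 1"
    and deep_all: "deep UNIV (r + qscale (of_nat n) ample)"
    and deep_off: "deep (- I) (r + qscale (of_nat n) (restr (- I) ample))"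
begin

text \<open>The upper corner of a box inside the slice of the vectors that agree with \<open>r\<close> on \<open>I\<close>.\<close>

definition slice_top :: "'a qvec" where
  "slice_top = r + qscale (of_nat n) (restr (- I) ample)"

definition box_top :: "'a qvec" where
  "box_top = r + qscale (of_nat n) ample"

text \<open>The periodic constant, by \<open>Qcount_dual\<close> and \<open>has_pc_box_defect\<close>.\<close>

definition box_defect :: rat where
  "box_defect = euler_char chi r slice_top - euler_char chi r box_top"

lemma slice_top: "slice_top - r \<in> latL" "below r slice_top" "deep (- I) slice_top"
  "\<And>v. v \<in> I \<Longrightarrow> coord slice_top v = coord r v"
  using ample(1) deep_off by (auto simp: slice_top_def latL_def below_def ample_nonneg)

lemma box_top: "box_top - r \<in> latL" "below r box_top" "deep UNIV box_top"
  using ample(1) deep_all by (auto simp: box_top_def latL_def below_def ample_nonneg)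

text \<open>The lower corner moves up to \<open>r\<close> first, then the upper corner moves between two deep vectors.\<close>

lemma euler_char_box:
  assumes "a - r \<in> latL" "below a r" "b - r \<in> latL" "below box_top b" "deep UNIV b"
  shows "euler_char chi a b = euler_char chi r box_top"
proof -
  have rb: "below r b" by (rule below_trans[OF box_top(2) assms(4)])
  have "euler_char chi a b = euler_char chi r b"
    by (rule euler_char_bottom[OF r latL_minus_commute[OF assms(1)] assms(2,3) rb])
  also have "\<dots> = euler_char chi r box_top"
    by (rule euler_char_top[OF box_top latL_trans[OF assms(3) latL_minus_commute[OF box_top(1)]] assms(4,5), symmetric])
      simp
  finally show ?thesis .
qed

text \<open>
  The box and its subset that count for the class \<open>[Z\<^sub>K] - h\<close> at \<open>Z\<^sub>K - r\<close> are reflected in \<open>Z\<^sub>K\<close>. Then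
  the condition on lower corners in \<open>I\<close> becomes one on upper corners, and the lower corners can
  be moved to \<open>r\<close>.
\<close>

lemma Qcount_dual:
  "of_int (Qcount \<Gamma> (cls (ZK \<Gamma> - r)) I (ZK \<Gamma> - r)) = box_defect"
proof -
  let ?x = "ZK \<Gamma> - r"
  have x: "?x \<in> dualL \<Gamma>"
    using r(1) unfolding dualL_iff by (auto intro!: Ints_diff)
  obtain N where N: "\<And>a b. a - ?x \<in> latL \<Longrightarrow> below a 0 \<Longrightarrow> below a ?x \<Longrightarrow> b - ?x \<in> latL \<Longrightarrow> below ?x b \<Longrightarrow> (\<And>v. N \<le> coord b v)
      \<Longrightarrow> of_int (Qcount \<Gamma> (cls ?x) I ?x) = euler_char chi (join I ?x a) b - euler_char chi a b"
    using Qcount_euler_char[OF x, of I] by blast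
  have "\<forall>\<^sub>F k :: nat in sequentially. n \<le> k \<and> below (ZK \<Gamma>) (r + qscale (of_nat k) ample)
      \<and> below box_top (r + qscale (of_nat k) ample) \<and> deep UNIV (r + qscale (of_nat k) ample)
      \<and> deep (- I) (r + qscale (of_nat k) (restr (- I) ample))"
    by (intro eventually_conj eventually_ge_at_top eventually_below deep_eventually ample(3) dual_coord_restr_ample)
  from eventually_obtain[OF this] obtain k where k: "n \<le> k" "below (ZK \<Gamma>) (r + qscale (of_nat k) ample)"
      "below box_top (r + qscale (of_nat k) ample)" "deep UNIV (r + qscale (of_nat k) ample)"
      "deep (- I) (r + qscale (of_nat k) (restr (- I) ample))"
    by blast
  have "\<forall>\<^sub>F j :: nat in sequentially. below (Qvec (\<lambda>_. N)) (?x + qscale (of_nat j) ample)"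
    by (rule eventually_below)
  from eventually_obtain[OF this] obtain j where j: "below (Qvec (\<lambda>_. N)) (?x + qscale (of_nat j) ample)"
    by blast
  define \<alpha> where "\<alpha> = r - qscale (of_nat j) ample"
  define \<beta> where "\<beta> = r + qscale (of_nat k) ample"
  define \<beta>' where "\<beta>' = r + qscale (of_nat k) (restr (- I) ample)"
  have L: "qscale (of_nat i) ample \<in> latL" for i by (rule qscale_latL[OF ample(1)])
  have r\<beta>: "below r \<beta>" by (simp add: \<beta>_def below_def ample_nonneg)
  have \<alpha>r: "\<alpha> - r \<in> latL" "below \<alpha> r"
    using latL_uminus[OF L] by (simp_all add: \<alpha>_def below_def ample_nonneg)
  have \<beta>r: "\<beta> - r \<in> latL" using L by (simp add: \<beta>_def)
  have \<beta>'r: "\<beta>' - r \<in> latL" "below r \<beta>'"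
    using ample(1) by (auto simp: \<beta>'_def latL_def below_def ample_nonneg)
  have "of_int (Qcount \<Gamma> (cls ?x) I ?x)
      = euler_char chi (join I ?x (ZK \<Gamma> - \<beta>)) (ZK \<Gamma> - \<alpha>) - euler_char chi (ZK \<Gamma> - \<beta>) (ZK \<Gamma> - \<alpha>)"
  proof (rule N)
    show "ZK \<Gamma> - \<beta> - ?x \<in> latL" using latL_uminus[OF \<beta>r] by (simp add: algebra_simps)
    show "below (ZK \<Gamma> - \<beta>) 0" using k(2) by (simp add: \<beta>_def below_def)
    show "below (ZK \<Gamma> - \<beta>) ?x" using r\<beta> by (simp add: below_def)
    show "ZK \<Gamma> - \<alpha> - ?x \<in> latL" using latL_uminus[OF \<alpha>r(1)] by (simp add: algebra_simps)
    show "below ?x (ZK \<Gamma> - \<alpha>)" using \<alpha>r(2) by (simp add: below_def)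
    show "N \<le> coord (ZK \<Gamma> - \<alpha>) v" for v using spec[OF j[unfolded below_def], of v] by (simp add: \<alpha>_def algebra_simps)
  qed
  also have "join I ?x (ZK \<Gamma> - \<beta>) = ZK \<Gamma> - \<beta>'"
    by (auto simp: qvec_eq_iff \<beta>_def \<beta>'_def)
  also have "euler_char chi (ZK \<Gamma> - \<beta>') (ZK \<Gamma> - \<alpha>) = euler_char chi \<alpha> \<beta>'"
    by (rule euler_char_chi_reflect[symmetric, OF latL_trans[OF \<beta>'r(1) latL_minus_commute[OF \<alpha>r(1)]]])
  also have "euler_char chi (ZK \<Gamma> - \<beta>) (ZK \<Gamma> - \<alpha>) = euler_char chi \<alpha> \<beta>"
    by (rule euler_char_chi_reflect[symmetric, OF latL_trans[OF \<beta>r latL_minus_commute[OF \<alpha>r(1)]]])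
  also have "euler_char chi \<alpha> \<beta> = euler_char chi r box_top"
    using k(3,4) by (intro euler_char_box \<alpha>r \<beta>r) (simp_all add: \<beta>_def)
  also have "euler_char chi \<alpha> \<beta>' = euler_char chi r \<beta>'"
    by (rule euler_char_bottom[OF r latL_minus_commute[OF \<alpha>r(1)] \<alpha>r(2) \<beta>'r])
  also have "\<dots> = euler_char chi r slice_top"
  proof (rule euler_char_top[OF slice_top(1-3), symmetric])
    show "\<beta>' - slice_top \<in> latL" by (rule latL_trans[OF \<beta>'r(1) latL_minus_commute[OF slice_top(1)]])
    show "below slice_top \<beta>'"
      using k(1) by (auto simp: slice_top_def \<beta>'_def below_def ample_nonneg intro!: mult_right_mono)
    show "deep (- I) \<beta>'" using k(5) by (simp add: \<beta>'_def)
    show "coord \<beta>' v = coord slice_top v" if "v \<notin> - I" for v using that by (simp add: slice_top_def \<beta>'_def)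
  qed
  finally show ?thesis by (simp add: box_defect_def)
qed

text \<open>
  As \<open>m\<close> is orthogonal to all \<open>E\<^sub>v\<close> with \<open>v \<notin> I\<close>, the number \<open>(y, m)\<close> only depends on the coordinates
  of \<open>y\<close> on \<open>I\<close>. So translation by \<open>m\<close> changes \<open>\<chi>\<close> by a constant on the slice of \<open>r\<close>, and the
  Euler characteristic of the slice by the same constant.
\<close>

lemma Qcount_quadratic:
  assumes l: "l \<in> latL" and m: "m \<in> latL" "\<And>v. v \<in> I \<Longrightarrow> coord m v = coord l v" "\<And>v. v \<notin> I \<Longrightarrow> dual_coord m v = 0"
    and deep_m: "\<And>v. v \<in> I \<Longrightarrow> - 1 - of_int (euler \<Gamma> v) * coord ample v \<le> dual_coord slice_top v + dual_coord m v"
  shows "of_int (Qcount \<Gamma> (cls r) I (l + r)) = box_defect + (chi m - form \<Gamma> m r)"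
proof -
  let ?x = "l + r"
  define b0 where "b0 = slice_top + m"
  have x: "?x \<in> dualL \<Gamma>" by (rule dualL_translate[OF r(1)]) (use l in simp)
  have deep0: "deep UNIV b0"
    unfolding deep_def
  proof
    fix v
    show "- 1 - of_int (euler \<Gamma> v) * coord ample v \<le> dual_coord b0 v"
    proof (cases "v \<in> I")
      case True
      then show ?thesis using deep_m[of v] by (simp add: b0_def)
    next
      case False
      then show ?thesis using slice_top(3) m(3)[of v] by (simp add: b0_def deep_def)
    qed
  qed
  obtain N where N: "\<And>a b. a - ?x \<in> latL \<Longrightarrow> below a 0 \<Longrightarrow> below a ?x \<Longrightarrow> b - ?x \<in> latL \<Longrightarrow> below ?x b \<Longrightarrow> (\<And>v. N \<le> coord b v)
      \<Longrightarrow> of_int (Qcount \<Gamma> (cls ?x) I ?x) = euler_char chi (join I ?x a) b - euler_char chi a b"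
    using Qcount_euler_char[OF x, of I] by blast
  have "\<forall>\<^sub>F j :: nat in sequentially. below (r - qscale (of_nat j) ample) 0 \<and> below (r - qscale (of_nat j) ample) ?x
      \<and> below (r - qscale (of_nat j) ample) b0 \<and> below (r - qscale (of_nat j) ample) (r + m) \<and> below (r - qscale (of_nat j) ample) r"
    by (intro eventually_conj eventually_above)
  from eventually_obtain[OF this] obtain j where j: "below (r - qscale (of_nat j) ample) 0"
    "below (r - qscale (of_nat j) ample) ?x" "below (r - qscale (of_nat j) ample) b0"
    "below (r - qscale (of_nat j) ample) (r + m)" "below (r - qscale (of_nat j) ample) r"
    by blast
  define a where "a = r - qscale (of_nat j) ample"
  note a = j[folded a_def]
  have "\<forall>\<^sub>F k :: nat in sequentially. below box_top (b0 + qscale (of_nat k) ample) \<and> below ?x (b0 + qscale (of_nat k) ample)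
      \<and> below (Qvec (\<lambda>_. N)) (b0 + qscale (of_nat k) ample)"
    by (intro eventually_conj eventually_below)
  from eventually_obtain[OF this] obtain k where k: "below box_top (b0 + qscale (of_nat k) ample)"
      "below ?x (b0 + qscale (of_nat k) ample)" "below (Qvec (\<lambda>_. N)) (b0 + qscale (of_nat k) ample)"
    by blast
  define b where "b = b0 + qscale (of_nat k) ample"
  note b = k[folded b_def]
  define a' where "a' = join I ?x a"
  have L: "qscale (of_nat i) ample \<in> latL" for i by (rule qscale_latL[OF ample(1)])
  have ar: "a - r \<in> latL" using latL_uminus[OF L] by (simp add: a_def)
  have xr: "?x - r \<in> latL" using l by simp
  have b0r: "b0 - r \<in> latL" using latL_add[OF slice_top(1) m(1)] by (simp add: b0_def algebra_simps)
  have bb0: "b - b0 \<in> latL" using L by (simp add: b_def)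
  have br: "b - r \<in> latL" by (rule latL_trans[OF bb0 b0r])
  have rx: "y - ?x \<in> latL" if "y - r \<in> latL" for y by (rule latL_trans[OF that latL_minus_commute[OF xr]])
  have deepb: "deep UNIV b"
    using deep0 by (rule deep_mono) (simp add: b_def less_imp_le[OF ample(3)])
  have a'r: "a' - r \<in> latL" unfolding a'_def using xr ar by (rule join_latL)
  have a'b0: "below a' b0"
    using a(3) slice_top(4) m(2) by (auto simp: a'_def below_def b0_def)
  have Q: "of_int (Qcount \<Gamma> (cls ?x) I ?x) = euler_char chi a' b - euler_char chi a b"
    unfolding a'_def using a(1,2) b(2) spec[OF b(3)[unfolded below_def]]
    by (intro N rx ar br) auto
  have 1: "euler_char chi a b = euler_char chi r box_top"
    by (rule euler_char_box[OF ar a(5) br b(1) deepb])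
  have 2: "euler_char chi a' b = euler_char chi a' b0"
  proof (rule euler_char_top[symmetric, OF _ a'b0 deep0 bb0 _ deepb])
    show "b0 - a' \<in> latL" by (rule latL_trans[OF b0r latL_minus_commute[OF a'r]])
    show "below b0 b" by (simp add: b_def below_def ample_nonneg)
  qed simp
  have am: "slice_top - (a' - m) \<in> latL" "below (a' - m) slice_top"
    using latL_trans[OF b0r latL_minus_commute[OF a'r]] a'b0 by (auto simp: b0_def below_def algebra_simps)
  have "euler_char chi a' b0 = euler_char (\<lambda>y. chi (y + m)) (a' - m) slice_top"
    using euler_char_translate[of chi a' b0 m] by (simp add: b0_def)
  also have "\<dots> = (chi m - form \<Gamma> m r) + euler_char chi (a' - m) slice_top"
  proof (rule euler_char_add_const[OF am])
    fix y assume y: "below (a' - m) y" "below y slice_top"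
    have "coord y v = coord r v" if "v \<in> I" for v
    proof (rule antisym)
      show "coord y v \<le> coord r v" using y(2) slice_top(4)[OF that] by (simp add: below_def) metis
      show "coord r v \<le> coord y v" using spec[OF y(1)[unfolded below_def], of v] m(2)[OF that] that by (simp add: a'_def)
    qed
    then have "(\<Sum>v\<in>UNIV. coord y v * dual_coord m v) = (\<Sum>v\<in>UNIV. coord r v * dual_coord m v)"
      using m(3) by (intro sum.cong refl) (metis mult_zero_right)
    then have "form \<Gamma> m y = form \<Gamma> m r" by (simp only: form_dual_coord)
    then show "chi (y + m) = (chi m - form \<Gamma> m r) + chi y"
      by (simp add: chi_add form_sym[of y m])
  qed
  also have "euler_char chi (a' - m) slice_top = euler_char chi r slice_top"
  proof (rule euler_char_bottom[OF r _ _ slice_top(1,2)])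
    have "r - a' + m \<in> latL" by (rule latL_add[OF latL_minus_commute[OF a'r] m(1)])
    then show "r - (a' - m) \<in> latL" by (simp add: algebra_simps)
    have "coord (a' - m) v \<le> coord r v" for v
      using m(2)[of v] spec[OF a(4)[unfolded below_def], of v] by (simp add: a'_def)
    then show "below (a' - m) r" by (simp add: below_def)
  qed
  finally have 3: "euler_char chi a' b0 = (chi m - form \<Gamma> m r) + euler_char chi r slice_top" .
  have "cls ?x = cls r" unfolding cls_eq_iff using l by simp
  then show ?thesis using Q 1 2 3 by (simp add: box_defect_def)
qed

text \<open>
  The sublattice consists of the multiples of a common denominator of the harmonic extension.
  The vertex of the shifted cone is chosen such that, by the maximum principle, the harmonic
  extension \<open>m\<close> of each of its points \<open>l\<close> satisfies the depth condition on \<open>I\<close>: a point of the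
  cone with the same coordinates on \<open>I\<close> is \<open>\<ge> m + r\<close>, so its products with the \<open>E\<^sub>v\<close>, for
  \<open>v \<in> I\<close>, are not smaller than those of \<open>m + r\<close>.
\<close>

lemma has_pc_box_defect:
  assumes rep: "rep (cls r) = r"
  shows "has_pc \<Gamma> I (cls r) (restr_real I ` coneS \<Gamma>) (of_rat box_defect)"
proof -
  let ?K = "restr_real I ` coneS \<Gamma>"
  obtain H :: "'a \<Rightarrow> 'a \<Rightarrow> rat" where
    HI: "\<And>x v. v \<in> I \<Longrightarrow> (\<Sum>w\<in>UNIV. H v w * coord x w) = coord x v" and
    Hn: "\<And>x v. v \<notin> I \<Longrightarrow> dual_coord (Qvec (\<lambda>u. \<Sum>w\<in>UNIV. H u w * coord x w)) v = 0"
    using harmonic_extension[of I] by blast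
  define m where "m = (\<lambda>x :: 'a qvec. Qvec (\<lambda>u. \<Sum>w\<in>UNIV. H u w * coord x w))"
  have m: "coord (m x) u = (\<Sum>w\<in>UNIV. H u w * coord x w)" for x u by (simp add: m_def)
  obtain N :: nat where N: "0 < N" "\<And>u w. of_nat N * H u w \<in> \<int>"
    using common_denominator_ex[of "UNIV :: ('a \<times> 'a) set" "\<lambda>(u, w). H u w"] by auto
  define M where "M = {x :: 'a qvec. \<forall>v. coord x v / of_nat N \<in> \<int>}"
  have fiM: "finite_index_sublattice M latL" unfolding M_def using N(1) by (rule finite_index_multiples)
  then have M_sub: "M \<subseteq> latL" by (simp add: finite_index_sublattice_def)
  have mL: "m x \<in> latL" if "x \<in> M" for x
    unfolding latL_def
  proof (intro CollectI allI)
    fix u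
    have "coord (m x) u = (\<Sum>w\<in>UNIV. (of_nat N * H u w) * (coord x w / of_nat N))"
      unfolding m using N(1) by (intro sum.cong) auto
    also have "\<dots> \<in> \<int>" using that N(2) unfolding M_def by (intro Ints_sum Ints_mult[OF N(2)]) blast
    finally show "coord (m x) u \<in> \<int>" .
  qed
  define q where "q = (\<lambda>l. real_of_rat (box_defect + (chi (m l) - form \<Gamma> (m l) r)))"
  define P where "P = (\<lambda>u (x :: real ^ 'a). \<Sum>w\<in>UNIV. of_rat (H u w) * x $ w)"
  have P: "real_polynomial_function (P u)" for u
    unfolding P_def
    by (intro real_polynomial_function_sum real_polynomial_function.intros(4,2,1) bounded_linear_vec_nth finite)
  have Pm: "P u (to_real x) = of_rat (coord (m x) u)" for u x
    by (simp add: P_def m of_rat_sum of_rat_mult)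
  define F where "F = (\<lambda>(g :: 'a \<Rightarrow> real ^ 'a \<Rightarrow> real) x. \<Sum>v\<in>UNIV. \<Sum>w\<in>UNIV. P v x * g w x * of_int (basis_form \<Gamma> v w))"
  have F: "real_polynomial_function (F g)" if "\<And>w. real_polynomial_function (g w)" for g
    unfolding F_def
    by (intro real_polynomial_function_sum real_polynomial_function.intros(4,2) P that finite)
  define p where "p = (\<lambda>x. of_rat box_defect + ((- 1 / 2) * (F P x - F (\<lambda>w _. of_rat (coord (ZK \<Gamma>) w)) x)
      - F (\<lambda>w _. of_rat (coord r w)) x))"
  have p: "real_polynomial_function p"
    unfolding p_def
    by (intro real_polynomial_function.intros(2-4) real_polynomial_function_diff F P)
  have formF: "of_rat (form \<Gamma> (m x) y) = F (\<lambda>w _. of_rat (coord y w)) (to_real x)" for x y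
    by (simp add: F_def Pm form_def of_rat_sum of_rat_mult)
  have formP: "of_rat (form \<Gamma> (m x) (m x)) = F P (to_real x)" for x
    by (simp add: F_def Pm form_def of_rat_sum of_rat_mult)
  have chi': "chi y = (- 1 / 2) * (form \<Gamma> y y - form \<Gamma> y (ZK \<Gamma>))" for y unfolding chi_def by linarith
  have qp: "q x = p (to_real x)" for x
    by (simp only: q_def p_def chi' of_rat_add of_rat_diff of_rat_mult formP)
      (simp add: formF of_rat_divide of_rat_minus)
  have qpoly: "quasipolynomial_on M q"
    unfolding quasipolynomial_on_def
    using finite_index_self[OF fiM] p qp by blast
  have q0: "q 0 = of_rat box_defect"
  proof -
    have "m 0 = 0" by (simp add: qvec_eq_iff m)
    then show ?thesis by (simp add: q_def chi_def form_def)
  qed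
  \<comment> \<open>The three requirements are: \<open>l0\<close> is in the cone, the difference below is superharmonic
    outside \<open>I\<close>, and \<open>m\<close> is deep enough on \<open>I\<close>.\<close>
  define need where "need = (\<lambda>v. max 0 (max (dual_coord r v) (dual_coord r v - 1 - of_int (euler \<Gamma> v) * coord ample v - dual_coord slice_top v)))"
  define c where "c = Max (range need)"
  have c_ge: "need v \<le> c" for v unfolding c_def by (intro Max_ge) auto
  have c: "0 \<le> c" "dual_coord r v \<le> c" "dual_coord r v - 1 - of_int (euler \<Gamma> v) * coord ample v - dual_coord slice_top v \<le> c" for v
    using c_ge[of v] by (simp_all add: need_def)
  define l0 where "l0 = restr_real I (\<Sum>v\<in>UNIV. of_rat c *\<^sub>R to_real (Estar \<Gamma> v))"
  have l0: "l0 \<in> ?K"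
    unfolding l0_def coneS_def using c(1) by (intro imageI CollectI exI[of _ "\<lambda>_. of_rat c"]) simp
  have count: "of_int (Qcount \<Gamma> (cls r) I (l + r)) = q l"
    if l: "l \<in> M" and cone: "restr_real I (to_real (l + r)) \<in> (+) l0 ` ?K" for l
  proof -
    obtain a where a: "\<And>v. 0 \<le> a v"
      and eq: "restr_real I (to_real (l + r)) = l0 + restr_real I (\<Sum>v\<in>UNIV. a v *\<^sub>R to_real (Estar \<Gamma> v))"
      using cone unfolding coneS_def by blast
    define Y where "Y = (\<Sum>v\<in>UNIV. (of_rat c + a v) *\<^sub>R to_real (Estar \<Gamma> v))"
    have "restr_real I (to_real (l + r)) = restr_real I Y"
      unfolding eq l0_def Y_def restr_real_add[symmetric] by (simp add: scaleR_add_left sum.distrib)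
    then have rY: "restr_real I (to_real (l + r)) $ v = restr_real I Y $ v" for v by simp
    have YI: "Y $ v = of_rat (coord (l + r) v)" if "v \<in> I" for v
      using rY[of v] that by simp
    have pY: "pairing \<Gamma> (\<lambda>u. Y $ u) v = - (of_rat c + a v)" for v
    proof -
      have "pairing \<Gamma> (\<lambda>u. Y $ u) v = (\<Sum>w\<in>UNIV. (of_rat c + a w) * pairing \<Gamma> (\<lambda>u. to_real (Estar \<Gamma> w) $ u) v)"
        by (simp only: Y_def sum_component vector_scaleR_component real_scaleR_def pairing_sum pairing_scale)
      also have "\<dots> = (\<Sum>w\<in>UNIV. if w = v then - (of_rat c + a w) else 0)"
        unfolding pairing_to_real pairing_Estar by (intro sum.cong) auto
      finally show ?thesis by simp
    qed
    have pm: "pairing \<Gamma> (\<lambda>u. to_real (m l + r) $ u) v = - of_rat (dual_coord (m l) v + dual_coord r v)" for v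
    proof -
      have "pairing \<Gamma> (coord (m l + r)) v = - (dual_coord (m l) v + dual_coord r v)" by (simp add: dual_coord_def)
      then show ?thesis unfolding pairing_to_real by (simp only: of_rat_minus)
    qed
    \<comment> \<open>\<open>Y\<close> is a point of the cone with the coordinates of \<open>l + r\<close> on \<open>I\<close>, and \<open>e\<close> is nonnegative.\<close>
    define e where "e = (\<lambda>u. Y $ u - to_real (m l + r) $ u)"
    have eI: "e v = 0" if "v \<in> I" for v
      using YI[OF that] HI[OF that, of l] by (simp add: e_def m of_rat_add)
    have pe: "pairing \<Gamma> e v = of_rat (dual_coord (m l) v + dual_coord r v) - (of_rat c + a v)" for v
      unfolding e_def pairing_diff pY pm by simp
    have e0: "0 \<le> e v" for v
    proof (rule max_principle_real[of I])
      fix v assume v: "v \<notin> I"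
      have "dual_coord (m l) v = 0" using Hn[OF v, of l] by (simp add: m_def)
      moreover have "real_of_rat (dual_coord r v) \<le> of_rat c" using c(2)[of v] by (simp add: of_rat_less_eq)
      ultimately show "pairing \<Gamma> e v \<le> 0" unfolding pe using a[of v] by simp
    qed (simp add: eI)
    have deep: "- 1 - of_int (euler \<Gamma> v) * coord ample v \<le> dual_coord slice_top v + dual_coord (m l) v" if v: "v \<in> I" for v
    proof -
      have "0 \<le> pairing \<Gamma> e v"
        unfolding pairing_split using e0 eI[OF v] by (auto intro!: sum_nonneg)
      then have "real_of_rat c \<le> of_rat (dual_coord (m l) v + dual_coord r v)" unfolding pe using a[of v] by simp
      then have "c \<le> dual_coord (m l) v + dual_coord r v" by (simp only: of_rat_less_eq)
      then show ?thesis using c(3)[of v] by linarith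
    qed
    have "rat_of_int (Qcount \<Gamma> (cls r) I (l + r)) = box_defect + (chi (m l) - form \<Gamma> (m l) r)"
    proof (rule Qcount_quadratic)
      show "l \<in> latL" using l M_sub by blast
      show "m l \<in> latL" using l by (rule mL)
      show "coord (m l) v = coord l v" if "v \<in> I" for v using HI[OF that, of l] by (simp add: m)
      show "dual_coord (m l) v = 0" if "v \<notin> I" for v using Hn[OF that, of l] by (simp add: m_def)
    qed (rule deep)
    then show ?thesis unfolding q_def by (metis of_rat_of_int_eq)
  qed
  show ?thesis
    unfolding has_pc_def rep
    using top_dim_cone_coneS l0 fiM qpoly count q0[symmetric] by blast
qed

end

context negdef_tree begin

lemma has_pc_Pplus:
  assumes "h \<in> groupH \<Gamma>"
  shows "has_pc \<Gamma> I h (restr_real I ` coneS \<Gamma>) (of_int (eval_one (Pplus \<Gamma> I h)))"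
proof -
  let ?r = "rep h"
  note rep = rep_properties[OF assms]
  have "\<forall>\<^sub>F n :: nat in sequentially. deep UNIV (?r + qscale (of_nat n) ample)
      \<and> deep (- I) (?r + qscale (of_nat n) (restr (- I) ample))"
    by (intro eventually_conj deep_eventually ample(3) dual_coord_restr_ample)
  from eventually_obtain[OF this] obtain n where n: "deep UNIV (?r + qscale (of_nat n) ample)"
      "deep (- I) (?r + qscale (of_nat n) (restr (- I) ample))"
    by blast
  interpret counting \<Gamma> I ?r n
    by unfold_locales (use rep n in auto)
  have h: "cls ?r = h" using rep(1) by simp
  have "rat_of_int (eval_one (Pplus \<Gamma> I h)) = box_defect"
    using eval_one_Pplus[OF assms, of I] Qcount_dual by (metis cls_diff_cls h)
  then have "real_of_rat box_defect = of_int (eval_one (Pplus \<Gamma> I h))" by (metis of_rat_of_int_eq)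
  then show ?thesis using has_pc_box_defect unfolding h by simp
qed

lemma pc_eq:
  assumes "has_pc \<Gamma> I h (restr_real I ` coneS \<Gamma>) c"
  shows "pc \<Gamma> I h (restr_real I ` coneS \<Gamma>) = c"
  unfolding pc_def using assms has_pc_unique by (intro the_equality)

end

section \<open>The theorem\<close>

theorem theorem5p3p2:
  fixes \<Gamma> :: "'v::finite plumbing" and I :: "'v set" and h :: "'v qvec set"
  assumes "is_tree \<Gamma>" and "negative_definite \<Gamma>"
    and "I \<noteq> {}" and "h \<in> groupH \<Gamma>"
  shows
    "({l. wcoeff \<Gamma> h l \<noteq> 0} \<subseteq> {ZK \<Gamma> - sumE - s | s. s \<in> monoidS \<Gamma>} \<and>
      (\<forall>c. reduce_series I (wcoeff \<Gamma> h) c =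
           reduce_series I (Zh \<Gamma> (cls_diff (cls (ZK \<Gamma>)) h)) (restr I (ZK \<Gamma> - sumE) - c)) \<and>
      expansion_at_infinity (reduce_series I (wcoeff \<Gamma> h)) (fh_red \<Gamma> I h)) \<and>
     (fh_red \<Gamma> I h = of_poly (Pplus \<Gamma> I h) + fneg \<Gamma> I h \<and>
      finite {l. wcoeff \<Gamma> h l \<noteq> 0 \<and> \<not> prec_on I l 0} \<and>
      Pplus \<Gamma> I h \<in> polys_in I \<and>
      (\<forall>c\<in>Poly_Mapping.keys (Pplus \<Gamma> I h). \<not> prec_on I c 0) \<and>
      expansion_at_infinity (fneg_series \<Gamma> I h) (fneg \<Gamma> I h) \<and>
      fneg \<Gamma> I h \<in> ratfuns_in I \<and>
      (\<forall>i\<in>I. rat_degree i (fneg \<Gamma> I h) < 0) \<and>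
      (\<forall>P R. P \<in> polys_in I \<and> (\<forall>c\<in>Poly_Mapping.keys P. \<not> prec_on I c 0) \<and>
             R \<in> ratfuns_in I \<and> (\<forall>i\<in>I. rat_degree i R < 0) \<and>
             fh_red \<Gamma> I h = of_poly P + R \<longrightarrow>
             P = Pplus \<Gamma> I h \<and> R = fneg \<Gamma> I h) \<and>
      (\<forall>P R. euclid_decomposition I (fh_red \<Gamma> I h) P R \<longleftrightarrow>
             P = Pplus \<Gamma> I h \<and> R = fneg \<Gamma> I h)) \<and>
     (eval_one (Pplus \<Gamma> I h) = Qcount \<Gamma> (cls_diff (cls (ZK \<Gamma>)) h) I (ZK \<Gamma> - rep h) \<and>
      has_pc \<Gamma> I h (restr_real I ` coneS \<Gamma>) (of_int (eval_one (Pplus \<Gamma> I h))) \<and>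
      of_int (eval_one (Pplus \<Gamma> I h)) = pc \<Gamma> I h (restr_real I ` coneS \<Gamma>))"
proof -
  interpret negdef_tree \<Gamma> by unfold_locales (rule assms(1), rule assms(2))
  note I = assms(3) and h = assms(4)
  have supp: "{l. wcoeff \<Gamma> h l \<noteq> 0} \<subseteq> {ZK \<Gamma> - sumE - s | s. s \<in> monoidS \<Gamma>}"
  proof clarify
    fix l assume "wcoeff \<Gamma> h l \<noteq> 0"
    then have "ZK \<Gamma> - sumE - l \<in> monoidS \<Gamma>" by (rule wcoeff_support)
    moreover have "l = ZK \<Gamma> - sumE - (ZK \<Gamma> - sumE - l)" by simp
    ultimately show "\<exists>s. l = ZK \<Gamma> - sumE - s \<and> s \<in> monoidS \<Gamma>" by blast
  qed
  have "represents (reduce_series I (wcoeff \<Gamma> h)) (fh_red \<Gamma> I h)"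
    using fh_red_presentation[OF I, of h] by metis
  then have expansion: "expansion_at_infinity (reduce_series I (wcoeff \<Gamma> h)) (fh_red \<Gamma> I h)"
    using expansion_at_infinity_part[of I "\<lambda>_. True" h "fh_red \<Gamma> I h"] by simp
  have sum: "fh_red \<Gamma> I h = of_poly (Pplus \<Gamma> I h) + fneg \<Gamma> I h"
    by (simp add: fneg_eq(1)[OF I])
  have unique: "P = Pplus \<Gamma> I h \<and> R = fneg \<Gamma> I h"
    if "P \<in> polys_in I \<and> (\<forall>c\<in>keys P. \<not> prec_on I c 0) \<and>
      R \<in> ratfuns_in I \<and> (\<forall>i\<in>I. rat_degree i R < 0) \<and> fh_red \<Gamma> I h = of_poly P + R" for P R
  proof (rule decomposition_unique)
    show "\<not> prec_on I c 0" if "c \<in> keys P" for c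
      using that \<open>P \<in> polys_in I \<and> _\<close> by blast
    show "\<not> prec_on I c 0" if "c \<in> keys (Pplus \<Gamma> I h)" for c
      using that by (rule keys_Pplus(2))
    show "rat_degree i R < 0" if "i \<in> I" for i
      using that \<open>P \<in> polys_in I \<and> _\<close> by blast
    show "rat_degree i (fneg \<Gamma> I h) < 0" if "i \<in> I" for i
      using I that by (rule rat_degree_fneg)
    show "of_poly P + R = of_poly (Pplus \<Gamma> I h) + fneg \<Gamma> I h"
      using that sum by simp
  qed
  have P: "Pplus \<Gamma> I h \<in> polys_in I"
    using keys_Pplus(1) by (auto simp: polys_in_def)
  have reflected: "\<forall>c. reduce_series I (wcoeff \<Gamma> h) c =
      reduce_series I (Zh \<Gamma> (cls_diff (cls (ZK \<Gamma>)) h)) (restr I (ZK \<Gamma> - sumE) - c)"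
    using reduce_wcoeff[OF h] by blast
  have keys: "\<forall>c\<in>keys (Pplus \<Gamma> I h). \<not> prec_on I c 0"
    using keys_Pplus(2) by blast
  have degree: "\<forall>i\<in>I. rat_degree i (fneg \<Gamma> I h) < 0"
    using rat_degree_fneg[OF I] by blast
  have unique': "\<forall>P R. P \<in> polys_in I \<and> (\<forall>c\<in>keys P. \<not> prec_on I c 0) \<and>
             R \<in> ratfuns_in I \<and> (\<forall>i\<in>I. rat_degree i R < 0) \<and>
             fh_red \<Gamma> I h = of_poly P + R \<longrightarrow>
             P = Pplus \<Gamma> I h \<and> R = fneg \<Gamma> I h"
    using unique by blast
  have euclid: "\<forall>P R. euclid_decomposition I (fh_red \<Gamma> I h) P R \<longleftrightarrow>
             P = Pplus \<Gamma> I h \<and> R = fneg \<Gamma> I h"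
    using euclid_decomposition_iff[OF I] by blast
  show ?thesis
    by (intro conjI supp reflected expansion sum finite_Pplus_index P keys fneg_eq(2)[OF I] fneg_in[OF I]
        degree unique' euclid eval_one_Pplus[OF h] has_pc_Pplus[OF h] pc_eq[OF has_pc_Pplus[OF h], symmetric])
qed

end
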